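(* Let $B$ be a finite set of Boolean functions with $\mathrm{S}_1\subseteq[B]$. Then $\mathrm{SAT}(\{\mathsf{S}\},B)$ and $\mathrm{SAT}(\{\mathsf{U}\},B)$ are $\mathrm{PSPACE}$-complete.
   Context: A Boolean function is a map $f:\{0,1\}^n\to\{0,1\}$; each is used as an $n$-ary propositional connective. For a set $B$ of Boolean functions, $[B]$ denotes the clone generated by $B$: the smallest set of Boolean functions containing $B$ and all projections and closed under composition. $\mathrm{S}_1$ is the clone of 1-separating functions, i.e. those $n$-ary $f$ for which there is $i$ such that $f(a_1,\dots,a_n)=1$ implies $a_i=1$; equivalently $\mathrm{S}_1=[\{x\wedge\neg y\}]$. A temporal $B$-formula over a set $M$ of temporal operators is built from propositional variables using connectives from $B$ and operators from $M$. A structure $S=(s,V,\xi)$ is an infinite sequence $(s_i)_{i\in\mathbb N}$ of distinct states, a variable set $V$, and $\xi$ assigning to each state the set of variables true there. Semantics: $S,s_i\models x$ iff $x\in\xi(s_i)$; Boolean connectives pointwise; $S,s_i\models\varphi_1\mathsf{U}\varphi_2$ iff some $k\ge i$ has $S,s_k\models\varphi_2$ and $S,s_j\models\varphi_1$ for all $i\le j<k$; $S,s_i\models\varphi_1\mathsf{S}\varphi_2$ iff some $k\le i$ has $S,s_k\models\varphi_2$ and $S,s_j\models\varphi_1$ for all $k<j\le i$. A formula is satisfiable if it holds at some state of some structure. $\mathrm{SAT}(M,B)$ is the problem of deciding satisfiability of temporal $B$-formulae over $M$. *)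

theory Defs
  imports Main "HOL-Computational_Algebra.Polynomial"
begin

section \<open>Boolean functions and clones\<close>

text \<open>
  An n-ary Boolean function is a pair of its arity n and a predicate on bit lists of length n.
  Outside lists of length n the predicate is fixed to False, so that equality of the type is
  equality of Boolean functions (including their arity). Arity 0 is allowed.
\<close>

typedef boolfun = "{(n :: nat, f :: bool list \<Rightarrow> bool). \<forall>xs. f xs \<longrightarrow> length xs = n}"
  by (rule exI[of _ "(0, \<lambda>_. False)"]) simp

definition arity :: "boolfun \<Rightarrow> nat" where
  "arity f = fst (Rep_boolfun f)"

definition app :: "boolfun \<Rightarrow> bool list \<Rightarrow> bool" where
  "app f = snd (Rep_boolfun f)"

definition mk_boolfun :: "nat \<Rightarrow> (bool list \<Rightarrow> bool) \<Rightarrow> boolfun" where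
  "mk_boolfun n g = Abs_boolfun (n, \<lambda>xs. length xs = n \<and> g xs)"

lemma arity_mk_boolfun [simp]: "arity (mk_boolfun n g) = n"
  by (simp add: arity_def mk_boolfun_def Abs_boolfun_inverse)

lemma app_mk_boolfun [simp]: "app (mk_boolfun n g) xs \<longleftrightarrow> length xs = n \<and> g xs"
  by (simp add: app_def mk_boolfun_def Abs_boolfun_inverse)

lemma app_length: "app f xs \<Longrightarrow> length xs = arity f"
  using Rep_boolfun[of f] by (auto simp: app_def arity_def)

lemma boolfun_eqI:
  assumes "arity f = arity g"
    and "\<And>xs. length xs = arity f \<Longrightarrow> app f xs = app g xs"
  shows "f = g"
proof -
  have "app f xs = app g xs" for xs
    using assms app_length[of f xs] app_length[of g xs] by (cases "length xs = arity f") auto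
  hence "app f = app g" by blast
  with assms(1) have "Rep_boolfun f = Rep_boolfun g"
    by (simp add: app_def arity_def prod_eq_iff)
  thus ?thesis by (simp add: Rep_boolfun_inject)
qed

definition projection :: "nat \<Rightarrow> nat \<Rightarrow> boolfun" where
  "projection n i = mk_boolfun n (\<lambda>xs. xs ! i)"

definition compose :: "nat \<Rightarrow> boolfun \<Rightarrow> boolfun list \<Rightarrow> boolfun" where
  "compose m f gs = mk_boolfun m (\<lambda>xs. app f (map (\<lambda>g. app g xs) gs))"

inductive_set clone :: "boolfun set \<Rightarrow> boolfun set" for B :: "boolfun set" where
  base: "f \<in> B \<Longrightarrow> f \<in> clone B"
| proj: "i < n \<Longrightarrow> projection n i \<in> clone B"
| comp: "f \<in> clone B \<Longrightarrow> length gs = arity f \<Longrightarrow>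
    (\<And>g. g \<in> set gs \<Longrightarrow> g \<in> clone B \<and> arity g = m) \<Longrightarrow> compose m f gs \<in> clone B"

definition S1 :: "boolfun set" where
  "S1 = {f. \<exists>i < arity f. \<forall>xs. length xs = arity f \<longrightarrow> app f xs \<longrightarrow> xs ! i}"


section \<open>Temporal formulae\<close>

datatype temporal_op = Until | Since

datatype formula =
    Var nat
  | Conn boolfun "formula list"
  | Temp temporal_op formula formula

inductive is_formula :: "temporal_op set \<Rightarrow> boolfun set \<Rightarrow> formula \<Rightarrow> bool"
  for M :: "temporal_op set" and B :: "boolfun set" where
  "is_formula M B (Var x)"
| "f \<in> B \<Longrightarrow> length \<phi>s = arity f \<Longrightarrow> (\<And>\<phi>. \<phi> \<in> set \<phi>s \<Longrightarrow> is_formula M B \<phi>) \<Longrightarrow>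
    is_formula M B (Conn f \<phi>s)"
| "op \<in> M \<Longrightarrow> is_formula M B \<phi> \<Longrightarrow> is_formula M B \<psi> \<Longrightarrow> is_formula M B (Temp op \<phi> \<psi>)"

record 'st temporal_structure =
  state_at :: "nat \<Rightarrow> 'st"
  variables :: "nat set"
  assignment :: "'st \<Rightarrow> nat set"

definition is_structure :: "'st temporal_structure \<Rightarrow> bool" where
  "is_structure S \<longleftrightarrow> inj (state_at S) \<and> (\<forall>i. assignment S (state_at S i) \<subseteq> variables S)"

fun holds :: "'st temporal_structure \<Rightarrow> nat \<Rightarrow> formula \<Rightarrow> bool" where
  "holds S i (Var x) \<longleftrightarrow> x \<in> assignment S (state_at S i)"
| "holds S i (Conn f \<phi>s) \<longleftrightarrow> app f (map (\<lambda>\<phi>. holds S i \<phi>) \<phi>s)"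
| "holds S i (Temp Until \<phi> \<psi>) \<longleftrightarrow>
    (\<exists>k\<ge>i. holds S k \<psi> \<and> (\<forall>j. i \<le> j \<and> j < k \<longrightarrow> holds S j \<phi>))"
| "holds S i (Temp Since \<phi> \<psi>) \<longleftrightarrow>
    (\<exists>k\<le>i. holds S k \<psi> \<and> (\<forall>j. k < j \<and> j \<le> i \<longrightarrow> holds S j \<phi>))"

text \<open>
  An existential quantifier cannot range over types, so states are taken to be natural numbers
  here; by the lemma below this loses no structure.
\<close>

definition satisfiable :: "formula \<Rightarrow> bool" where
  "satisfiable \<phi> \<longleftrightarrow> (\<exists>(S :: nat temporal_structure) i. is_structure S \<and> holds S i \<phi>)"

lemma satisfiableI:
  fixes S :: "'st temporal_structure"
  assumes "is_structure S" and "holds S i \<phi>"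
  shows "satisfiable \<phi>"
proof -
  define S' :: "nat temporal_structure" where
    "S' = \<lparr>state_at = id, variables = variables S, assignment = (\<lambda>j. assignment S (state_at S j))\<rparr>"
  have eq: "holds S' j \<psi> = holds S j \<psi>" for j \<psi>
  proof (induction \<psi> arbitrary: j)
    case (Conn f \<phi>s)
    hence "map (\<lambda>\<phi>. holds S' j \<phi>) \<phi>s = map (\<lambda>\<phi>. holds S j \<phi>) \<phi>s" by simp
    thus ?case by (simp only: holds.simps)
  next
    case (Temp op \<phi> \<psi>)
    thus ?case by (cases op) simp_all
  qed (simp add: S'_def)
  have "is_structure S'"
    using assms(1) by (simp add: is_structure_def S'_def)
  with assms(2) eq show ?thesis
    unfolding satisfiable_def by blast
qed


section \<open>Satisfiability as a language over the binary alphabet\<close>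

text \<open>
  Formulae are written in prefix notation. A node starts with a two-bit tag; variable indices
  (binary, least significant bit first) and truth tables are made self-delimiting.
  A truth table of length 2^n determines n, hence the number of arguments that follow.
\<close>

fun binary :: "nat \<Rightarrow> bool list" where
  "binary n = (if n = 0 then [] else odd n # binary (n div 2))"

declare binary.simps [simp del]

fun delimited :: "bool list \<Rightarrow> bool list" where
  "delimited [] = [False]"
| "delimited (b # bs) = True # b # delimited bs"

definition truth_table :: "boolfun \<Rightarrow> bool list" where
  "truth_table f = map (app f) (List.n_lists (arity f) [False, True])"

fun encode :: "formula \<Rightarrow> bool list" where
  "encode (Var x) = [False, False] @ delimited (binary x)"
| "encode (Conn f \<phi>s) = [False, True] @ delimited (truth_table f) @ concat (map encode \<phi>s)"
| "encode (Temp Until \<phi> \<psi>) = [True, False] @ encode \<phi> @ encode \<psi>"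
| "encode (Temp Since \<phi> \<psi>) = [True, True] @ encode \<phi> @ encode \<psi>"

definition SAT :: "temporal_op set \<Rightarrow> boolfun set \<Rightarrow> bool list set" where
  "SAT M B = encode ` {\<phi>. is_formula M B \<phi> \<and> satisfiable \<phi>}"

text \<open>The encoding is faithful: distinct formulae have distinct codes.\<close>

lemma binary_inject: "binary m = binary n \<Longrightarrow> m = n"
proof (induction m arbitrary: n rule: less_induct)
  case (less m)
  show ?case
  proof (cases "m = 0 \<or> n = 0")
    case True
    thus ?thesis using less.prems binary.simps[of m] binary.simps[of n]
      by (auto split: if_splits)
  next
    case False
    hence "odd m = odd n" "binary (m div 2) = binary (n div 2)"
      using less.prems binary.simps[of m] binary.simps[of n] by auto
    moreover from this(2) have "m div 2 = n div 2" using less.IH False by simp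
    ultimately show ?thesis by (metis even_two_times_div_two odd_two_times_div_two_succ)
  qed
qed

lemma delimited_inject: "delimited a @ u = delimited b @ v \<Longrightarrow> a = b \<and> u = v"
proof (induction a arbitrary: b)
  case Nil thus ?case by (cases b) auto
next
  case (Cons x a) thus ?case by (cases b) auto
qed

lemma truth_table_inject:
  assumes "truth_table f = truth_table g"
  shows "f = g"
proof (rule boolfun_eqI)
  have "length (truth_table f) = length (truth_table g)" using assms by simp
  thus a: "arity f = arity g"
    by (simp add: truth_table_def length_n_lists)
  fix xs :: "bool list" assume "length xs = arity f"
  hence "xs \<in> set (List.n_lists (arity f) [False, True])"
    by (auto simp: set_n_lists)
  thus "app f xs = app g xs"
    using assms a by (auto simp: truth_table_def)
qed

lemma encode_prefix_inject:
  assumes "is_formula M B \<phi>" "is_formula M B \<psi>" "encode \<phi> @ u = encode \<psi> @ v"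
  shows "\<phi> = \<psi> \<and> u = v"
  using assms
proof (induction arbitrary: \<psi> u v)
  case (1 x)
  from "1.prems"(2) obtain y where "\<psi> = Var y"
    by (cases \<psi> rule: encode.cases) auto
  thus ?case using "1.prems" by (auto dest: delimited_inject binary_inject)
next
  case (2 f \<phi>s)
  from "2.prems"(2) obtain g \<psi>s where \<psi>: "\<psi> = Conn g \<psi>s"
    by (cases \<psi> rule: encode.cases) auto
  have "delimited (truth_table f) @ concat (map encode \<phi>s) @ u =
        delimited (truth_table g) @ concat (map encode \<psi>s) @ v"
    using "2.prems"(2) \<psi> by simp
  from delimited_inject[OF this]
  have fg: "f = g" and cat: "concat (map encode \<phi>s) @ u = concat (map encode \<psi>s) @ v"
    by (auto dest: truth_table_inject)
  from "2.prems"(1) \<psi> fg have len: "length \<psi>s = length \<phi>s"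
    and \<psi>s: "\<forall>\<psi> \<in> set \<psi>s. is_formula M B \<psi>"
    using "2.hyps" by (auto elim: is_formula.cases)
  have IH: "\<And>\<phi> \<psi> u v. \<phi> \<in> set \<phi>s \<Longrightarrow> is_formula M B \<psi> \<Longrightarrow> encode \<phi> @ u = encode \<psi> @ v \<Longrightarrow>
      \<phi> = \<psi> \<and> u = v"
    using "2.IH" by blast
  have "\<phi>s = \<psi>s \<and> u = v"
    using len IH \<psi>s cat
  proof (induction \<psi>s \<phi>s arbitrary: u v rule: list_induct2)
    case Nil thus ?case by simp
  next
    case (Cons b bs a as)
    have "a = b \<and> concat (map encode as) @ u = concat (map encode bs) @ v"
      using Cons.prems by (intro Cons.prems(1)) auto
    moreover from this have "as = bs \<and> u = v"
      using Cons.prems(1,2) by (intro Cons.IH) (auto 4 3)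
    ultimately show ?case by simp
  qed
  thus ?case using \<psi> fg by simp
next
  case (3 op \<phi>1 \<phi>2)
  obtain \<psi>1 \<psi>2 where \<psi>: "\<psi> = Temp op \<psi>1 \<psi>2"
    and e: "encode \<phi>1 @ encode \<phi>2 @ u = encode \<psi>1 @ encode \<psi>2 @ v"
    using "3.prems"(2) by (cases op; cases \<psi> rule: encode.cases) auto
  from "3.prems"(1) \<psi> have "is_formula M B \<psi>1" "is_formula M B \<psi>2"
    by (auto elim: is_formula.cases)
  with "3.IH" e \<psi> show ?case by blast
qed

lemma encode_in_SAT_iff:
  assumes "is_formula M B \<phi>"
  shows "encode \<phi> \<in> SAT M B \<longleftrightarrow> satisfiable \<phi>"
  using assms encode_prefix_inject[OF assms, of _ "[]" "[]"] by (auto simp: SAT_def)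


section \<open>Turing machines\<close>

text \<open>
  Deterministic multi-tape machines with tapes that are infinite to the right; a left move on
  cell 0 stays. States and symbols are initial segments of the natural numbers. State 0 is
  initial, state 1 accepting, state 2 rejecting. Symbol 0 is the blank, symbols 1 and 2
  represent the bits 0 and 1. The input is on the first tape; the output of a function is read
  off the last tape.
\<close>

datatype move = Left_move | Stay | Right_move

record tm =
  num_tapes :: nat
  num_syms :: nat
  num_states :: nat
  trans :: "nat \<Rightarrow> nat list \<Rightarrow> nat \<times> (nat \<times> move) list"

definition is_tm :: "tm \<Rightarrow> bool" where
  "is_tm T \<longleftrightarrow> num_tapes T \<ge> 1 \<and> num_syms T \<ge> 3 \<and> num_states T \<ge> 3 \<and>
    (\<forall>q ss. q < num_states T \<longrightarrow> length ss = num_tapes T \<longrightarrow> (\<forall>s \<in> set ss. s < num_syms T) \<longrightarrow>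
      (case trans T q ss of (q', acts) \<Rightarrow>
        q' < num_states T \<and> length acts = num_tapes T \<and> (\<forall>(s, d) \<in> set acts. s < num_syms T)))"

type_synonym tape = "(nat \<Rightarrow> nat) \<times> nat"
type_synonym config = "nat \<times> tape list"

fun read_tape :: "tape \<Rightarrow> nat" where
  "read_tape (c, h) = c h"

fun act_tape :: "tape \<Rightarrow> nat \<times> move \<Rightarrow> tape" where
  "act_tape (c, h) (s, d) =
    (c(h := s), case d of Left_move \<Rightarrow> h - 1 | Stay \<Rightarrow> h | Right_move \<Rightarrow> h + 1)"

fun step :: "tm \<Rightarrow> config \<Rightarrow> config" where
  "step T (q, ts) =
    (if q = 1 \<or> q = 2 then (q, ts)
     else case trans T q (map read_tape ts) of (q', acts) \<Rightarrow> (q', map2 act_tape ts acts))"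

definition tape_content :: "bool list \<Rightarrow> nat \<Rightarrow> nat" where
  "tape_content x i = (if i < length x then (if x ! i then 2 else 1) else 0)"

definition init_config :: "tm \<Rightarrow> bool list \<Rightarrow> config" where
  "init_config T x = (0, (tape_content x, 0) # replicate (num_tapes T - 1) (\<lambda>_. 0, 0))"

definition run :: "tm \<Rightarrow> bool list \<Rightarrow> nat \<Rightarrow> config" where
  "run T x t = (step T ^^ t) (init_config T x)"


section \<open>Polynomial space and polynomial-time many-one reductions\<close>

definition decides :: "tm \<Rightarrow> bool list set \<Rightarrow> bool" where
  "decides T L \<longleftrightarrow> (\<forall>x. \<exists>t. fst (run T x t) = (if x \<in> L then 1 else 2))"

text \<open>
  Heads start on cell 0 and move by at most one cell per step, so all heads staying below s
  means that at most the first s cells of each tape are visited.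
\<close>

definition runs_in_space :: "tm \<Rightarrow> (nat \<Rightarrow> nat) \<Rightarrow> bool" where
  "runs_in_space T s \<longleftrightarrow> (\<forall>x t. \<forall>(c, h) \<in> set (snd (run T x t)). h < s (length x))"

definition PSPACE :: "bool list set set" where
  "PSPACE = {L. \<exists>T (p :: nat poly). is_tm T \<and> decides T L \<and> runs_in_space T (poly p)}"

definition computes_in_time :: "tm \<Rightarrow> (bool list \<Rightarrow> bool list) \<Rightarrow> (nat \<Rightarrow> nat) \<Rightarrow> bool" where
  "computes_in_time T f b \<longleftrightarrow>
    (\<forall>x. \<exists>t \<le> b (length x). fst (run T x t) = 1 \<and>
      fst (last (snd (run T x t))) = tape_content (f x))"

definition poly_time_computable :: "(bool list \<Rightarrow> bool list) \<Rightarrow> bool" where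
  "poly_time_computable f \<longleftrightarrow> (\<exists>T (p :: nat poly). is_tm T \<and> computes_in_time T f (poly p))"

definition poly_time_reducible :: "bool list set \<Rightarrow> bool list set \<Rightarrow> bool" where
  "poly_time_reducible L L' \<longleftrightarrow> (\<exists>f. poly_time_computable f \<and> (\<forall>x. x \<in> L \<longleftrightarrow> f x \<in> L'))"

definition PSPACE_complete :: "bool list set \<Rightarrow> bool" where
  "PSPACE_complete L \<longleftrightarrow> L \<in> PSPACE \<and> (\<forall>L' \<in> PSPACE. poly_time_reducible L' L)"

end

theory Submission
  imports Defs
begin

text \<open>
  Membership in PSPACE: a formula is satisfiable iff there is an ultimately periodic sequence of
  locally consistent truth assignments to its subformulae in which every eventuality of the period
  is fulfilled. This is reachability in a graph whose vertices have polynomial size, and a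
  midpoint game evaluated by depth-first search decides it in polynomial space.

  Hardness: since tapes are described relative to the heads, each step of a machine follows a
  bounded set of local monotone rules, and \<open>Until\<close> or \<open>Since\<close> over alternating phases forces the
  rules to be respected until the machine accepts. The clone contains \<open>x \<and> y\<close> and \<open>x \<and> \<not> y\<close>, which
  is all the formula needs; but its long conjunction calls for a term in which one argument occurs
  only once. Switching the occurrences of \<open>y\<close> from false to true one at a time, some switch turns
  \<open>x \<and> \<not> y\<close> from true to false at \<open>x = True\<close>, and some switch changes \<open>x \<and> y\<close> for exactly one of
  the two values of \<open>x\<close>. With the other occurrences fixed, these give a negation and a conjunction
  up to negations. The constant true is a variable required to hold in all relevant states.
\<close>

section \<open>A stack language and its compilation to Turing machines\<close>

text \<open>The complexity classes are defined by concrete multi-tape machines, so both halves need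
  explicit machines. One closure calculus, \<open>pcf tm\<close>, supplies them: with
  \<open>tm = True\<close> it bounds time and yields the reduction, with \<open>tm = False\<close>
  it bounds space only and yields the decision procedure. The obstacle in the hardness half is that
  the rule part of the formula can demand the truth of facts but cannot forbid additional ones.
  Hence the rules are monotone, and \<open>Alive\<close> expresses that the machine has not accepted
  rather than that it has: every model contains the facts derivable at each stage, so a model that
  comes to an end needs a stage at which \<open>Alive\<close> is not derivable. Conversely the
  stages themselves form a model as soon as \<open>Alive\<close> is lost. As \<open>Until\<close>
  places its end at a finite distance, a machine that never accepts would force more stages than
  there are states before the end. Both operators share one proof: read along a sequence,
  \<open>Since\<close> is \<open>Until\<close> restricted to sequences that become constant, and the
  models built for the network can be taken constant after the end.\<close>

text \<open>
  A program state assigns a stack of bits to each of six registers. Register 0 is the input tape,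
  which can only be consumed; register 5 is the output tape, which can only be extended, so its
  contents are stored in reverse; registers 1 to 4 are work tapes with the top of the stack under
  the head and a blank bottom cell.
\<close>

type_synonym store = "nat \<Rightarrow> bool list"

datatype prog =
    Skip
  | Push nat bool
  | Pop nat
  | Seq prog prog (infixr ";;" 60)
  | Cond nat "bool option" prog prog
  | Loop nat "bool option" prog

definition top_bit :: "store \<Rightarrow> nat \<Rightarrow> bool option" where
  "top_bit s r = (case s r of [] \<Rightarrow> None | b # _ \<Rightarrow> Some b)"

text \<open>\<open>m\<close> bounds the stacks and is tested at pushes only. The counter gives the
  exact number of steps of the compiled machine, which is why the charges differ: the first branch
  of \<open>Cond\<close> also pays for the jump over the second one, and a loop round for its test
  and its jump back. \<open>Loop r c p\<close> runs until the top of \<open>r\<close> is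
  \<open>c\<close>.\<close>

inductive exec :: "nat \<Rightarrow> prog \<Rightarrow> store \<Rightarrow> nat \<Rightarrow> store \<Rightarrow> bool" for m where
  Skip: "exec m Skip s 0 s"
| Push: "length (s r) < m \<Longrightarrow> exec m (Push r b) s 2 (s(r := b # s r))"
| Pop: "exec m (Pop r) s 1 (s(r := tl (s r)))"
| Seq: "exec m p s n s' \<Longrightarrow> exec m q s' n' s'' \<Longrightarrow> exec m (p ;; q) s (n + n') s''"
| CondT: "top_bit s r = c \<Longrightarrow> exec m p s n s' \<Longrightarrow> exec m (Cond r c p q) s (n + 2) s'"
| CondF: "top_bit s r \<noteq> c \<Longrightarrow> exec m q s n s' \<Longrightarrow> exec m (Cond r c p q) s (n + 1) s'"
| LoopF: "top_bit s r = c \<Longrightarrow> exec m (Loop r c p) s 1 s"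
| LoopT: "top_bit s r \<noteq> c \<Longrightarrow> exec m p s n s' \<Longrightarrow> exec m (Loop r c p) s' n' s'' \<Longrightarrow>
    exec m (Loop r c p) s (n + n' + 2) s''"

lemma exec_mono: "exec m p s n s' \<Longrightarrow> m \<le> m' \<Longrightarrow> exec m' p s n s'"
  by (induction rule: exec.induct) (rule exec.intros; (assumption | linarith)?)+

fun wf_prog :: "prog \<Rightarrow> bool" where
  "wf_prog Skip = True"
| "wf_prog (Push r b) = (1 \<le> r \<and> r \<le> 5)"
| "wf_prog (Pop r) = (r < 5)"
| "wf_prog (p ;; q) = (wf_prog p \<and> wf_prog q)"
| "wf_prog (Cond r c p q) = (r < 5 \<and> wf_prog p \<and> wf_prog q)"
| "wf_prog (Loop r c p) = (r < 5 \<and> wf_prog p)"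

definition bounded_store :: "nat \<Rightarrow> store \<Rightarrow> bool" where
  "bounded_store m s \<longleftrightarrow> (\<forall>r. length (s r) \<le> m)"

lemma exec_bounded: "exec m p s n s' \<Longrightarrow> bounded_store m s \<Longrightarrow> bounded_store m s'"
proof (induction rule: exec.induct)
  case (Pop r s)
  have "length (tl (s r)) \<le> m" using Pop[unfolded bounded_store_def, rule_format, of r] by auto
  thus ?case using Pop by (auto simp: bounded_store_def)
qed (auto simp: bounded_store_def)

section \<open>Compilation to machine code\<close>

type_synonym acts = "(nat \<times> move) list"
type_synonym instr = "nat list \<Rightarrow> nat \<times> acts"

definition still :: "nat list \<Rightarrow> acts" where
  "still ss = map (\<lambda>s. (s, Stay)) ss"

definition on_tape :: "nat \<Rightarrow> (nat \<Rightarrow> nat \<times> move) \<Rightarrow> nat list \<Rightarrow> acts" where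
  "on_tape r g ss = (still ss)[r := g (ss ! r)]"

definition bit_sym :: "bool \<Rightarrow> nat" where
  "bit_sym b = (if b then 2 else 1)"

definition opt_sym :: "bool option \<Rightarrow> nat" where
  "opt_sym c = (case c of None \<Rightarrow> 0 | Some b \<Rightarrow> bit_sym b)"

lemma opt_sym_inject: "opt_sym c = opt_sym d \<longleftrightarrow> c = d"
  by (auto simp: opt_sym_def bit_sym_def split: option.splits if_splits)

text \<open>A push takes two steps because the head of a work tape stands on the top symbol and has
  to move before writing. The head of the output tape stands on the first free cell, so there the
  bit is written before the move.\<close>

definition push1 :: "nat \<Rightarrow> bool \<Rightarrow> nat \<Rightarrow> nat \<times> move" where
  "push1 r b s = (if r = 5 then bit_sym b else s, Right_move)"

definition push2 :: "nat \<Rightarrow> bool \<Rightarrow> nat \<Rightarrow> nat \<times> move" where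
  "push2 r b s = (if r = 5 then s else bit_sym b, Stay)"

text \<open>On the input tape the head advances without erasing and stops at the first blank.
  Popping an empty work stack is harmless, as a left move on cell 0 stays.\<close>

definition pop1 :: "nat \<Rightarrow> nat \<Rightarrow> nat \<times> move" where
  "pop1 r s = (if r = 0 then (s, if s = 0 then Stay else Right_move) else (0, Left_move))"

text \<open>The first argument is the absolute address at which the code will be placed, since jumps
  are absolute. Every block is left at the address just behind it.\<close>

fun compile :: "nat \<Rightarrow> prog \<Rightarrow> instr list" where
  "compile n Skip = []"
| "compile n (Push r b) =
    [\<lambda>ss. (n + 1, on_tape r (push1 r b) ss), \<lambda>ss. (n + 2, on_tape r (push2 r b) ss)]"
| "compile n (Pop r) = [\<lambda>ss. (n + 1, on_tape r (pop1 r) ss)]"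
| "compile n (p ;; q) = compile n p @ compile (n + length (compile n p)) q"
| "compile n (Cond r c p q) =
    (let P = compile (n + 1) p; n' = n + length P + 2; Q = compile n' q in
      [\<lambda>ss. (if ss ! r = opt_sym c then n + 1 else n', still ss)] @ P @
      [\<lambda>ss. (n' + length Q, still ss)] @ Q)"
| "compile n (Loop r c p) =
    (let P = compile (n + 1) p in
      [\<lambda>ss. (if ss ! r = opt_sym c then n + length P + 2 else n + 1, still ss)] @ P @
      [\<lambda>ss. (n, still ss)])"

definition valid_reads :: "nat list \<Rightarrow> bool" where
  "valid_reads ss \<longleftrightarrow> length ss = 6 \<and> (\<forall>s \<in> set ss. s < 3)"

definition valid_acts :: "acts \<Rightarrow> bool" where
  "valid_acts as \<longleftrightarrow> length as = 6 \<and> (\<forall>(s, d) \<in> set as. s < 3)"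

lemma valid_still: "valid_reads ss \<Longrightarrow> valid_acts (still ss)"
  by (auto simp: valid_reads_def valid_acts_def still_def)

lemma valid_on_tape:
  assumes "valid_reads ss" "\<And>s. s < 3 \<Longrightarrow> fst (g s) < 3" "r < 6"
  shows "valid_acts (on_tape r g ss)"
proof -
  have "ss ! r < 3" using assms(1,3) by (auto simp: valid_reads_def)
  hence "fst (g (ss ! r)) < 3" using assms(2) by blast
  thus ?thesis using valid_still[OF assms(1)]
    by (cases "g (ss ! r)") (auto simp: valid_acts_def on_tape_def dest!: subsetD[OF set_update_subset_insert])
qed

lemma compile_valid:
  "wf_prog p \<Longrightarrow> i \<in> set (compile n p) \<Longrightarrow> valid_reads ss \<Longrightarrow>
    fst (i ss) \<le> n + length (compile n p) \<and> valid_acts (snd (i ss))"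
proof (induction p arbitrary: n)
  case (Push r b)
  thus ?case by (auto intro!: valid_on_tape simp: push1_def push2_def bit_sym_def)
next
  case (Pop r)
  thus ?case by (auto intro!: valid_on_tape simp: pop1_def)
next
  case (Seq p q)
  thus ?case by (fastforce)
next
  case (Cond r c p q)
  thus ?case by (fastforce simp: Let_def valid_still)
next
  case (Loop r c p)
  thus ?case by (fastforce simp: Let_def valid_still)
qed simp

text \<open>Code address \<open>n\<close> becomes state \<open>addr n\<close>, leaving room for the two halting states.\<close>

definition addr :: "nat \<Rightarrow> nat" where
  "addr n = (if n = 0 then 0 else n + 2)"

definition machine :: "prog \<Rightarrow> tm" where
  "machine p = \<lparr>num_tapes = 6, num_syms = 3, num_states = length (compile 0 p) + 3,
    trans = (\<lambda>q ss. let n = (if q = 0 then 0 else q - 2); code = compile 0 p in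
      if n < length code then (addr (fst ((code ! n) ss)), snd ((code ! n) ss))
      else (if ss ! 1 = 2 then 1 else 2, still ss))\<rparr>"

lemma machine_simps [simp]:
  "num_tapes (machine p) = 6" "num_syms (machine p) = 3"
  "num_states (machine p) = length (compile 0 p) + 3"
  by (simp_all add: machine_def)

lemma trans_machine:
  "trans (machine p) (addr n) ss =
    (if n < length (compile 0 p) then (addr (fst ((compile 0 p ! n) ss)), snd ((compile 0 p ! n) ss))
     else (if ss ! 1 = 2 then 1 else 2, still ss))"
  by (auto simp: machine_def addr_def Let_def)

lemma is_tm_machine:
  assumes "wf_prog p"
  shows "is_tm (machine p)"
  unfolding is_tm_def
proof (intro conjI allI impI)
  fix q and ss :: "nat list"
  assume q: "q < num_states (machine p)" and ss: "length ss = num_tapes (machine p)"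
    "\<forall>s\<in>set ss. s < num_syms (machine p)"
  hence v: "valid_reads ss" by (simp add: valid_reads_def)
  let ?n = "if q = 0 then 0 else q - 2"
  show "case trans (machine p) q ss of (q', acts) \<Rightarrow>
      q' < num_states (machine p) \<and> length acts = num_tapes (machine p) \<and>
      (\<forall>(s, d)\<in>set acts. s < num_syms (machine p))"
  proof (cases "?n < length (compile 0 p)")
    case True
    hence "compile 0 p ! ?n \<in> set (compile 0 p)" by (rule nth_mem)
    from compile_valid[OF assms this v] show ?thesis using True
      by (auto simp: machine_def Let_def valid_acts_def addr_def)
  next
    case False
    thus ?thesis using valid_still[OF v] by (auto simp: machine_def Let_def valid_acts_def)
  qed
qed auto

section \<open>Tapes representing stacks\<close>

fun tape_rep :: "nat \<Rightarrow> nat \<Rightarrow> bool list \<Rightarrow> tape \<Rightarrow> bool" where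
  "tape_rep X r l (c, h) =
    (if r = 0 then (\<forall>n. c (h + n) = tape_content l n) \<and> h + length l \<le> X
     else if r = 5 then c = tape_content (rev l) \<and> h = length l
     else h = length l \<and> c 0 = 0 \<and> (\<forall>n. c (Suc n) = tape_content (rev l) n))"

definition rep :: "nat \<Rightarrow> store \<Rightarrow> tape list \<Rightarrow> bool" where
  "rep X s ts \<longleftrightarrow> length ts = 6 \<and> (\<forall>r < 6. tape_rep X r (s r) (ts ! r))"

definition heads_below :: "nat \<Rightarrow> config \<Rightarrow> bool" where
  "heads_below H c \<longleftrightarrow> (\<forall>t \<in> set (snd c). snd t \<le> H)"

lemma tape_content_snoc: "tape_content (l @ [b]) = (tape_content l)(length l := bit_sym b)"
  by (auto simp: tape_content_def fun_eq_iff nth_append bit_sym_def)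

lemma tape_content_Cons: "tape_content (b # l) (Suc n) = tape_content l n"
  by (auto simp: tape_content_def)

lemma tape_content_Cons_0: "tape_content (b # l) 0 = bit_sym b"
  by (auto simp: tape_content_def bit_sym_def)

lemma tape_content_beyond: "length l \<le> n \<Longrightarrow> tape_content l n = 0"
  by (auto simp: tape_content_def)

lemma read_rep:
  assumes "tape_rep X r l t" "r < 5"
  shows "read_tape t = opt_sym (case l of [] \<Rightarrow> None | b # _ \<Rightarrow> Some b)"
proof (cases t)
  case (Pair c h)
  show ?thesis
  proof (cases l)
    case Nil
    thus ?thesis using assms Pair
      by (auto simp: opt_sym_def tape_content_def split: if_splits dest!: spec[of _ 0])
  next
    case (Cons b l')
    show ?thesis
    proof (cases "r = 0")
      case True
      with assms Pair have "\<forall>n. c (h + n) = tape_content l n" by auto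
      hence "c (h + 0) = tape_content l 0" by blast
      thus ?thesis using Cons Pair by (simp add: tape_content_Cons_0 opt_sym_def)
    next
      case False
      hence "c (Suc (length l')) = tape_content (rev l' @ [b]) (length l')" "h = Suc (length l')"
        using assms Pair Cons by auto
      thus ?thesis using Cons Pair by (simp add: tape_content_snoc opt_sym_def)
    qed
  qed
qed

lemma rep_pop:
  assumes "tape_rep X r l t" "r < 5"
  shows "tape_rep X r (tl l) (act_tape t (pop1 r (read_tape t)))"
proof (cases t)
  case (Pair c h)
  note rd = read_rep[OF assms]
  show ?thesis
  proof (cases l)
    case Nil
    thus ?thesis using assms Pair rd by (auto simp: pop1_def opt_sym_def tape_content_def)
  next
    case (Cons b l')
    show ?thesis
    proof (cases "r = 0")
      case True
      hence *: "\<And>n. c (h + n) = tape_content l n" "h + length l \<le> X" using assms Pair by auto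
      have "c (Suc (h + n)) = tape_content l' n" for n
        using *(1)[of "Suc n"] Cons by (simp add: tape_content_Cons)
      thus ?thesis using True Cons Pair rd *(2)
        by (auto simp: pop1_def opt_sym_def bit_sym_def fun_upd_def)
    next
      case False
      hence *: "\<And>n. c (Suc n) = tape_content (rev l' @ [b]) n" "h = Suc (length l')" "c 0 = 0"
        using assms Pair Cons by auto
      show ?thesis using False Cons Pair *
        by (auto simp: pop1_def tape_content_snoc tape_content_beyond assms)
           (use assms(2) in simp)
    qed
  qed
qed

lemma rep_push:
  fixes b :: bool
  assumes "tape_rep X r l t" "1 \<le> r" "r \<le> 5"
  defines "t1 \<equiv> act_tape t (push1 r b (read_tape t))"
  shows "tape_rep X r (b # l) (act_tape t1 (push2 r b (read_tape t1)))" "snd t1 = Suc (length l)"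
proof -
  obtain c h where t: "t = (c, h)" by (cases t)
  have e: "tape_content (rev l @ [b]) = (tape_content (rev l))(length l := bit_sym b)"
    using tape_content_snoc[of "rev l" b] by simp
  have c: "c h = read_tape t" using t by simp
  show "tape_rep X r (b # l) (act_tape t1 (push2 r b (read_tape t1)))" "snd t1 = Suc (length l)"
    using assms(1-3) t by (auto simp: push1_def push2_def e t1_def split: if_splits)
qed

lemma act_on_tape:
  assumes "length ts = 6" "r < 6"
  shows "map2 act_tape ts (on_tape r g (map read_tape ts)) = ts[r := act_tape (ts ! r) (g (read_tape (ts ! r)))]"
proof (rule nth_equalityI)
  have *: "act_tape t (read_tape t, Stay) = t" for t by (cases t) auto
  fix i assume "i < length (map2 act_tape ts (on_tape r g (map read_tape ts)))"
  hence "i < 6" using assms by simp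
  thus "map2 act_tape ts (on_tape r g (map read_tape ts)) ! i = ts[r := act_tape (ts ! r) (g (read_tape (ts ! r)))] ! i"
    using assms by (cases "i = r") (auto simp: on_tape_def still_def *)
qed (use assms in \<open>auto simp: on_tape_def still_def\<close>)

lemma act_still: "map2 act_tape ts (still (map read_tape ts)) = ts"
proof -
  have *: "act_tape t (read_tape t, Stay) = t" for t by (cases t) auto
  show ?thesis by (induction ts) (auto simp: still_def *)
qed

lemma rep_update:
  assumes "rep X s ts" "r < 6" "tape_rep X r l t"
  shows "rep X (s(r := l)) (ts[r := t])"
  using assms by (auto simp: rep_def nth_list_update)

lemma rep_heads:
  assumes "rep X s ts" "bounded_store m s"
  shows "heads_below (max X m) (q, ts)"
  unfolding heads_below_def
proof
  fix t assume "t \<in> set (snd (q, ts))"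
  then obtain r where r: "r < 6" "t = ts ! r" using assms(1) by (auto simp: rep_def in_set_conv_nth)
  with assms have "tape_rep X r (s r) t" "length (s r) \<le> m" by (auto simp: rep_def bounded_store_def)
  thus "snd t \<le> max X m" by (cases t) (auto split: if_splits)
qed

section \<open>Simulation of executions by machine steps\<close>

definition reaches :: "tm \<Rightarrow> nat \<Rightarrow> nat \<Rightarrow> config \<Rightarrow> config \<Rightarrow> bool" where
  "reaches T H n c c' \<longleftrightarrow> (step T ^^ n) c = c' \<and> (\<forall>i \<le> n. heads_below H ((step T ^^ i) c))"

lemma reaches_0: "heads_below H c \<Longrightarrow> reaches T H 0 c c"
  by (simp add: reaches_def)

lemma reaches_step: "heads_below H c \<Longrightarrow> reaches T H n (step T c) c' \<Longrightarrow> reaches T H (Suc n) c c'"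
  unfolding reaches_def
proof (intro conjI allI impI)
  fix i assume *: "heads_below H c"
    "(step T ^^ n) (step T c) = c' \<and> (\<forall>i\<le>n. heads_below H ((step T ^^ i) (step T c)))" "i \<le> Suc n"
  show "heads_below H ((step T ^^ i) c)"
    by (cases i) (use * in \<open>auto simp: funpow_swap1 simp del: funpow.simps(2) simp: funpow_Suc_right\<close>)
qed (simp add: funpow_swap1)

lemma reaches_trans:
  assumes "reaches T H n c c'" "reaches T H n' c' c''"
  shows "reaches T H (n + n') c c''"
  unfolding reaches_def
proof (intro conjI allI impI)
  show "(step T ^^ (n + n')) c = c''"
    using assms by (subst add.commute) (simp only: reaches_def funpow_add comp_apply)
  fix i assume i: "i \<le> n + n'"
  show "heads_below H ((step T ^^ i) c)"
  proof (cases "i \<le> n")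
    case False
    have "(step T ^^ (i - n + n)) c = (step T ^^ (i - n)) ((step T ^^ n) c)"
      by (simp only: funpow_add comp_apply)
    hence "(step T ^^ i) c = (step T ^^ (i - n)) c'"
      using assms(1) False by (simp add: reaches_def)
    moreover have "i - n \<le> n'" using i by simp
    ultimately show ?thesis using assms(2) by (simp add: reaches_def)
  next
    case True
    thus ?thesis using assms(1) by (simp add: reaches_def)
  qed
qed

lemma step_machine:
  assumes "n < length (compile 0 p)"
  shows "step (machine p) (addr n, ts) =
    (addr (fst ((compile 0 p ! n) (map read_tape ts))), map2 act_tape ts (snd ((compile 0 p ! n) (map read_tape ts))))"
  using assms trans_machine[of p n] by (auto simp: addr_def split: prod.splits)

lemma top_read:
  assumes "rep X s ts" "r < 5"
  shows "map read_tape ts ! r = opt_sym c \<longleftrightarrow> top_bit s r = c"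
proof -
  have "tape_rep X r (s r) (ts ! r)" "length ts = 6" using assms by (auto simp: rep_def)
  thus ?thesis using read_rep[of X r "s r" "ts ! r"] assms(2)
    by (simp add: top_bit_def opt_sym_inject)
qed

text \<open>Induction over the execution with the position of the code arbitrary, since a subprogram
  sits in the middle of the compiled whole. The head bound is a maximum because the input head is
  bounded by \<open>X\<close>, the other heads by the stack height.\<close>

lemma compile_reaches:
  assumes "exec m p s n s'" "wf_prog p" "compile 0 P = pre @ compile (length pre) p @ post"
    "rep X s ts" "bounded_store m s"
  shows "\<exists>ts'. rep X s' ts' \<and>
    reaches (machine P) (max X m) n (addr (length pre), ts) (addr (length pre + length (compile (length pre) p)), ts')"
  using assms
proof (induction arbitrary: pre post ts rule: exec.induct)
  case (Skip s)
  thus ?case by (auto intro!: exI[of _ ts] reaches_0 rep_heads)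
next
  case (Push s r b)
  let ?H = "max X m"
  define t1 where "t1 = act_tape (ts ! r) (push1 r b (read_tape (ts ! r)))"
  define t2 where "t2 = act_tape t1 (push2 r b (read_tape t1))"
  have r: "1 \<le> r" "r \<le> 5" "r < 6" using Push.prems by auto
  have len: "length ts = 6" using Push.prems(3) by (simp add: rep_def)
  have tr: "tape_rep X r (s r) (ts ! r)" using Push.prems(3) r by (auto simp: rep_def)
  note pp = rep_push[OF tr r(1,2), of b, folded t1_def, folded t2_def]
  have c: "compile 0 P ! length pre = (\<lambda>ss. (length pre + 1, on_tape r (push1 r b) ss))"
     "compile 0 P ! (length pre + 1) = (\<lambda>ss. (length pre + 2, on_tape r (push2 r b) ss))"
    "length pre + 1 < length (compile 0 P)"
    using Push.prems(2) by (auto simp: nth_append)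
  have s1: "step (machine P) (addr (length pre), ts) = (addr (length pre + 1), ts[r := t1])"
    using c(3) by (subst step_machine) (auto simp: c act_on_tape len r t1_def)
  have s2: "step (machine P) (addr (length pre + 1), ts[r := t1]) = (addr (length pre + 2), ts[r := t2])"
    unfolding step_machine[OF c(3)] c(2) fst_conv snd_conv
    by (subst act_on_tape) (simp_all add: len r t2_def)
  have hts: "heads_below ?H (addr (length pre), ts)" using rep_heads[OF Push.prems(3,4)] .
  \<comment> \<open>Half-way through a push the tapes need not represent any store, so the head
    bound is checked directly; this is where the side condition of \<open>Push\<close> is
    used.\<close>
  have h1: "heads_below ?H (addr (length pre + 1), ts[r := t1])"
    using hts pp(2) Push.hyps by (auto simp: heads_below_def dest!: subsetD[OF set_update_subset_insert])
  have r2: "rep X (s(r := b # s r)) (ts[r := t2])"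
    by (rule rep_update[OF Push.prems(3) r(3) pp(1)])
  have "bounded_store m (s(r := b # s r))"
    using Push.prems(4) Push.hyps by (auto simp: bounded_store_def)
  hence h2: "heads_below ?H (addr (length pre + 2), ts[r := t2])"
    using rep_heads[OF r2] by blast
  have "reaches (machine P) ?H (Suc (Suc 0)) (addr (length pre), ts) (addr (length pre + 2), ts[r := t2])"
    by (rule reaches_step, rule hts, subst s1, rule reaches_step, rule h1, subst s2, rule reaches_0, rule h2)
  thus ?case using r2 by (intro exI[of _ "ts[r := t2]"]) (simp add: numeral_2_eq_2 fun_upd_def)
next
  case (Pop r s)
  have len: "length ts = 6" using Pop.prems(3) by (simp add: rep_def)
  have r: "r < 5" "r < 6" using Pop.prems by auto
  have tr: "tape_rep X r (s r) (ts ! r)" using Pop.prems(3) r by (auto simp: rep_def)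
  define t1 where "t1 = act_tape (ts ! r) (pop1 r (read_tape (ts ! r)))"
  have c: "compile 0 P ! length pre = (\<lambda>ss. (length pre + 1, on_tape r (pop1 r) ss))"
    "length pre < length (compile 0 P)"
    using Pop.prems(2) by (auto simp: nth_append)
  have s1: "step (machine P) (addr (length pre), ts) = (addr (length pre + 1), ts[r := t1])"
    using c(2) by (subst step_machine) (auto simp: c act_on_tape len r t1_def)
  have r2: "rep X (s(r := tl (s r))) (ts[r := t1])"
    by (rule rep_update[OF Pop.prems(3) r(2)]) (use rep_pop[OF tr r(1)] in \<open>simp add: t1_def\<close>)
  have b2: "bounded_store m (s(r := tl (s r)))"
    using exec_bounded[OF exec.Pop Pop.prems(4)] .
  have "reaches (machine P) (max X m) (Suc 0) (addr (length pre), ts) (addr (length pre + 1), ts[r := t1])"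
    by (rule reaches_step, rule rep_heads[OF Pop.prems(3,4)], subst s1, rule reaches_0, rule rep_heads[OF r2 b2])
  thus ?case using r2 by (intro exI[of _ "ts[r := t1]"]) (simp add: fun_upd_def)
next
  case (Seq p s n s' q n' s'')
  let ?l = "length (compile (length pre) p)"
  obtain ts' where 1: "rep X s' ts'" "reaches (machine P) (max X m) n (addr (length pre), ts)
      (addr (length pre + ?l), ts')"
    using Seq.IH(1)[of pre "compile (length pre + ?l) q @ post" ts] Seq.prems by auto
  have b: "bounded_store m s'" using exec_bounded[OF Seq.hyps(1) Seq.prems(4)] .
  obtain ts'' where 2: "rep X s'' ts''" "reaches (machine P) (max X m) n' (addr (length pre + ?l), ts')
      (addr (length pre + ?l + length (compile (length pre + ?l) q)), ts'')"
    using Seq.IH(2)[of "pre @ compile (length pre) p" post ts'] Seq.prems b 1 by auto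
  show ?case using 2(1) reaches_trans[OF 1(2) 2(2)] by (auto simp: add.assoc)
next
  case (CondT s r c p n s' q)
  let ?n = "length pre"
  let ?P = "compile (?n + 1) p"
  let ?n' = "?n + length ?P + 2"
  let ?Q = "compile ?n' q"
  let ?i = "\<lambda>ss. (if ss ! r = opt_sym c then ?n + 1 else ?n', still ss)"
  let ?j = "\<lambda>ss. (?n' + length ?Q, still ss)"
  have code: "compile 0 P = pre @ [?i] @ ?P @ [?j] @ ?Q @ post"
    using CondT.prems(2) by (simp only: compile.simps Let_def append_assoc)
  hence c: "compile 0 P ! ?n = ?i" "?n < length (compile 0 P)"
    "compile 0 P ! (?n + 1 + length ?P) = ?j" "?n + 1 + length ?P < length (compile 0 P)"
    by (simp_all add: nth_append del: compile.simps)
  have r: "r < 5" using CondT.prems by simp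
  have s1: "step (machine P) (addr ?n, ts) = (addr (?n + 1), ts)"
    using CondT.hyps top_read[OF CondT.prems(3) r, of c]
    unfolding step_machine[OF c(2)] c(1) fst_conv snd_conv act_still by simp
  obtain ts' where 1: "rep X s' ts'" "reaches (machine P) (max X m) n (addr (?n + 1), ts)
      (addr (?n + 1 + length ?P), ts')"
    using CondT.IH[of "pre @ [?i]" "[?j] @ ?Q @ post" ts] CondT.prems code by auto
  have s2: "step (machine P) (addr (?n + 1 + length ?P), ts') = (addr (?n' + length ?Q), ts')"
    by (simp only: step_machine[OF c(4)] c(3) fst_conv snd_conv act_still)
  have b: "bounded_store m s'" using exec_bounded[OF CondT.hyps(2) CondT.prems(4)] .
  have e: "?n + length (compile ?n (Cond r c p q)) = ?n' + length ?Q" by (simp add: Let_def)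
  have "reaches (machine P) (max X m) (Suc n) (addr ?n, ts) (addr (?n + 1 + length ?P), ts')"
    by (rule reaches_step, rule rep_heads[OF CondT.prems(3,4)], subst s1, rule 1(2))
  moreover have "reaches (machine P) (max X m) (Suc 0) (addr (?n + 1 + length ?P), ts') (addr (?n' + length ?Q), ts')"
    by (rule reaches_step, rule rep_heads[OF 1(1) b], subst s2, rule reaches_0, rule rep_heads[OF 1(1) b])
  ultimately have "reaches (machine P) (max X m) (Suc n + Suc 0) (addr ?n, ts) (addr (?n' + length ?Q), ts')"
    by (rule reaches_trans)
  thus ?case using 1(1) unfolding e by auto
next
  case (CondF s r c q n s' p)
  let ?n = "length pre"
  let ?P = "compile (?n + 1) p"
  let ?n' = "?n + length ?P + 2"
  let ?Q = "compile ?n' q"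
  let ?i = "\<lambda>ss. (if ss ! r = opt_sym c then ?n + 1 else ?n', still ss)"
  let ?j = "\<lambda>ss. (?n' + length ?Q, still ss)"
  have code: "compile 0 P = pre @ [?i] @ ?P @ [?j] @ ?Q @ post"
    using CondF.prems(2) by (simp only: compile.simps Let_def append_assoc)
  hence c: "compile 0 P ! ?n = ?i" "?n < length (compile 0 P)"
    by (simp_all add: nth_append del: compile.simps)
  have r: "r < 5" using CondF.prems by simp
  have s1: "step (machine P) (addr ?n, ts) = (addr ?n', ts)"
    using CondF.hyps top_read[OF CondF.prems(3) r, of c]
    unfolding step_machine[OF c(2)] c(1) fst_conv snd_conv act_still by simp
  have "?n' = length (pre @ [?i] @ ?P @ [?j])" by simp
  then obtain ts' where 1: "rep X s' ts'" "reaches (machine P) (max X m) n (addr ?n', ts)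
      (addr (?n' + length ?Q), ts')"
    using CondF.IH[of "pre @ [?i] @ ?P @ [?j]" post ts] CondF.prems code by auto
  have e: "?n + length (compile ?n (Cond r c p q)) = ?n' + length ?Q" by (simp add: Let_def)
  have "reaches (machine P) (max X m) (Suc n) (addr ?n, ts) (addr (?n' + length ?Q), ts')"
    by (rule reaches_step, rule rep_heads[OF CondF.prems(3,4)], subst s1, rule 1(2))
  thus ?case using 1(1) unfolding e by auto
next
  case (LoopF s r c p)
  let ?n = "length pre"
  let ?P = "compile (?n + 1) p"
  let ?i = "\<lambda>ss. (if ss ! r = opt_sym c then ?n + length ?P + 2 else ?n + 1, still ss)"
  have code: "compile 0 P = pre @ [?i] @ ?P @ [\<lambda>ss. (?n, still ss)] @ post"
    using LoopF.prems(2) by (simp only: compile.simps Let_def append_assoc)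
  hence c: "compile 0 P ! ?n = ?i" "?n < length (compile 0 P)"
    by (simp_all add: nth_append del: compile.simps)
  have r: "r < 5" using LoopF.prems by simp
  have s1: "step (machine P) (addr ?n, ts) = (addr (?n + length ?P + 2), ts)"
    using LoopF.hyps top_read[OF LoopF.prems(3) r, of c]
    unfolding step_machine[OF c(2)] c(1) fst_conv snd_conv act_still by simp
  have "reaches (machine P) (max X m) (Suc 0) (addr ?n, ts) (addr (?n + length ?P + 2), ts)"
    by (rule reaches_step, rule rep_heads[OF LoopF.prems(3,4)], subst s1, rule reaches_0,
        rule rep_heads[OF LoopF.prems(3,4)])
  thus ?case using LoopF.prems(3) by (auto simp: Let_def)
next
  case (LoopT s r c p n s' n' s'')
  let ?n = "length pre"
  let ?P = "compile (?n + 1) p"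
  let ?i = "\<lambda>ss. (if ss ! r = opt_sym c then ?n + length ?P + 2 else ?n + 1, still ss)"
  let ?j = "\<lambda>ss. (?n, still ss)"
  have code: "compile 0 P = pre @ [?i] @ ?P @ [?j] @ post"
    using LoopT.prems(2) by (simp only: compile.simps Let_def append_assoc)
  hence c: "compile 0 P ! ?n = ?i" "?n < length (compile 0 P)"
    "compile 0 P ! (?n + 1 + length ?P) = ?j" "?n + 1 + length ?P < length (compile 0 P)"
    by (simp_all add: nth_append del: compile.simps)
  have r: "r < 5" using LoopT.prems by simp
  have s1: "step (machine P) (addr ?n, ts) = (addr (?n + 1), ts)"
    using LoopT.hyps top_read[OF LoopT.prems(3) r, of c]
    unfolding step_machine[OF c(2)] c(1) fst_conv snd_conv act_still by simp
  obtain ts' where 1: "rep X s' ts'" "reaches (machine P) (max X m) n (addr (?n + 1), ts)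
      (addr (?n + 1 + length ?P), ts')"
    using LoopT.IH(1)[of "pre @ [?i]" "[?j] @ post" ts] LoopT.prems code by auto
  have s2: "step (machine P) (addr (?n + 1 + length ?P), ts') = (addr ?n, ts')"
    by (simp only: step_machine[OF c(4)] c(3) fst_conv snd_conv act_still)
  have b: "bounded_store m s'" using exec_bounded[OF LoopT.hyps(2) LoopT.prems(4)] .
  obtain ts'' where 2: "rep X s'' ts''" "reaches (machine P) (max X m) n' (addr ?n, ts')
      (addr (?n + length (compile ?n (Loop r c p))), ts'')"
    using LoopT.IH(2)[OF LoopT.prems(1,2) 1(1) b] by blast
  have "reaches (machine P) (max X m) (Suc n) (addr ?n, ts) (addr (?n + 1 + length ?P), ts')"
    by (rule reaches_step, rule rep_heads[OF LoopT.prems(3,4)], subst s1, rule 1(2))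
  moreover have "reaches (machine P) (max X m) (Suc 0 + n') (addr (?n + 1 + length ?P), ts')
       (addr (?n + length (compile ?n (Loop r c p))), ts'')"
    unfolding add_Suc add_0 by (rule reaches_step, rule rep_heads[OF 1(1) b], subst s2, rule 2(2))
  ultimately have "reaches (machine P) (max X m) (Suc n + (Suc 0 + n')) (addr ?n, ts)
       (addr (?n + length (compile ?n (Loop r c p))), ts'')"
    by (rule reaches_trans)
  thus ?case using 2(1) by auto
qed

section \<open>Runs of compiled machines on inputs\<close>

definition init_store :: "bool list \<Rightarrow> store" where
  "init_store x = (\<lambda>_. [])(0 := x)"

lemma rep_init: "\<exists>ts. init_config (machine p) x = (addr 0, ts) \<and> rep (length x) (init_store x) ts"
  by (auto simp: init_config_def addr_def rep_def init_store_def less_Suc_eq numeral_eq_Suc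
      tape_content_def fun_eq_iff)

text \<open>After the program the machine takes one more step and accepts iff \<open>True\<close> is on top of register 1.\<close>

lemma machine_run:
  assumes "wf_prog p" "exec m p (init_store x) n s'" "length x \<le> m"
  shows "\<exists>ts. rep (length x) s' ts \<and> run (machine p) x (Suc n) = (if top_bit s' 1 = Some True then 1 else 2, ts) \<and>
    (\<forall>t. heads_below m (run (machine p) x t))"
proof -
  obtain ts0 where i: "init_config (machine p) x = (addr 0, ts0)" "rep (length x) (init_store x) ts0"
    using rep_init by blast
  have b: "bounded_store m (init_store x)" using assms(3) by (simp add: bounded_store_def init_store_def)
  obtain ts where 1: "rep (length x) s' ts"
    "reaches (machine p) (max (length x) m) n (addr 0, ts0) (addr (length (compile 0 p)), ts)"
    using compile_reaches[OF assms(2,1), of p "[]" "[]"] i(2) b by auto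
  have rd: "map read_tape ts ! 1 = opt_sym (Some True) \<longleftrightarrow> top_bit s' 1 = Some True"
    by (rule top_read[OF 1(1)]) simp
  have s: "step (machine p) (addr (length (compile 0 p)), ts) = (if top_bit s' 1 = Some True then 1 else 2, ts)"
    using trans_machine[of p "length (compile 0 p)" "map read_tape ts"] rd
    by (auto simp: addr_def act_still opt_sym_def bit_sym_def split: if_splits)
  have e: "run (machine p) x (Suc n) = (if top_bit s' 1 = Some True then 1 else 2, ts)"
    using 1(2) s i(1) by (simp add: run_def reaches_def)
  have h: "heads_below m (run (machine p) x t)" for t
  proof (cases "t \<le> n")
    case True
    thus ?thesis using 1(2) i(1) assms(3) by (auto simp: reaches_def run_def max_def)
  next
    case False
    have "run (machine p) x (Suc n + k) = run (machine p) x (Suc n)" for k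
      by (induction k) (use e in \<open>auto simp: run_def\<close>)
    from this[of "t - Suc n"] False have "run (machine p) x t = run (machine p) x (Suc n)" by simp
    moreover have "heads_below (max (length x) m) (q, ts)" for q
      using 1(2) unfolding reaches_def heads_below_def by (metis order_refl snd_conv)
    ultimately show ?thesis using e assms(3) by (auto simp: max_def split: if_splits)
  qed
  show ?thesis using 1(1) e h by blast
qed


section \<open>Functions computable within polynomial resources\<close>

datatype shape = Leaf | Node shape shape

fun flat :: "shape \<Rightarrow> bool list" where
  "flat Leaf = [False]"
| "flat (Node a b) = True # flat a @ flat b"

text \<open>
  Values are written as preorder codes of binary trees, so that the end of a value on a stack can
  be found by counting.
\<close>

class coded =
  fixes code :: "'a \<Rightarrow> bool list"
  assumes code_flat: "\<exists>t. code x = flat t"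

instantiation bool :: coded
begin
definition "code (b :: bool) = (if b then [True, False, False] else [False])"
instance proof
  fix b :: bool
  show "\<exists>t. code b = flat t"
    by (rule exI[of _ "if b then Node Leaf Leaf else Leaf"]) (simp add: code_bool_def)
qed
end

instantiation prod :: (coded, coded) coded
begin
definition "code (p :: 'a \<times> 'b) = True # code (fst p) @ code (snd p)"
instance proof
  fix p :: "'a \<times> 'b"
  obtain t u where "code (fst p) = flat t" "code (snd p) = flat u" by (meson code_flat)
  thus "\<exists>t. code p = flat t"
    by (intro exI[of _ "Node t u"]) (simp add: code_prod_def)
qed
end

instantiation list :: (coded) coded
begin
fun code_list :: "'a list \<Rightarrow> bool list" where
  "code_list [] = [False]"
| "code_list (x # xs) = True # code x @ code_list xs"
instance proof
  fix xs :: "'a list"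
  show "\<exists>t. code xs = flat t"
  proof (induction xs)
    case Nil
    show ?case by (rule exI[of _ Leaf]) simp
  next
    case (Cons x xs)
    then obtain t u where "code x = flat t" "code xs = flat u" by (meson code_flat)
    thus ?case by (intro exI[of _ "Node t u"]) simp
  qed
qed
end

lemma code_Pair [simp]: "code (a, b) = True # code a @ code b"
  by (simp add: code_prod_def)

lemma code_bool [simp]: "code True = [True, False, False]" "code False = [False]"
  by (simp_all add: code_bool_def)

abbreviation sz :: "'a::coded \<Rightarrow> nat" where
  "sz x \<equiv> length (code x)"

lemma length_flat_pos: "0 < length (flat t)"
  by (cases t) auto

lemma sz_pos: "0 < sz x"
  using code_flat[of x] length_flat_pos by metis

lemma length_le_sz: "length xs \<le> sz xs"
  by (induction xs) auto

lemma sz_append: "Suc (sz (xs @ ys)) = sz xs + sz ys"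
  by (induction xs) auto

lemma sz_mem: "x \<in> set xs \<Longrightarrow> sz x \<le> sz xs"
  by (induction xs) auto

lemma poly_nat_mono: "x \<le> y \<Longrightarrow> poly p x \<le> poly p (y :: nat)" for p :: "nat poly"
proof (induction p)
  case (pCons a p)
  thus ?case by (auto intro: mult_mono)
qed simp

subsection \<open>Stack manipulation\<close>

definition runs :: "nat \<Rightarrow> prog \<Rightarrow> store \<Rightarrow> nat \<Rightarrow> store \<Rightarrow> bool" where
  "runs m p s t s' \<longleftrightarrow> (\<exists>n \<le> t. exec m p s n s')"

lemma runs_Seq: "runs m p s t s' \<Longrightarrow> runs m q s' t' s'' \<Longrightarrow> runs m (p ;; q) s (t + t') s''"
  unfolding runs_def by (meson add_mono exec.Seq)

lemma runs_Push: "length (s r) < m \<Longrightarrow> s' = s(r := b # s r) \<Longrightarrow> runs m (Push r b) s 2 s'"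
  unfolding runs_def using exec.Push by blast

lemma runs_Pop: "s' = s(r := tl (s r)) \<Longrightarrow> runs m (Pop r) s 1 s'"
  unfolding runs_def using exec.Pop by blast

lemmas runs_Push_Seq = runs_Seq[OF runs_Push[OF _ refl]]
  and runs_Pop_Seq = runs_Seq[OF runs_Pop[OF refl]]

lemma runs_CondT: "top_bit s r = c \<Longrightarrow> runs m p s t s' \<Longrightarrow> runs m (Cond r c p q) s (t + 2) s'"
  unfolding runs_def by (meson add_le_mono1 exec.CondT)

lemma runs_CondF: "top_bit s r \<noteq> c \<Longrightarrow> runs m q s t s' \<Longrightarrow> runs m (Cond r c p q) s (t + 2) s'"
  unfolding runs_def by (meson add_le_mono exec.CondF one_le_numeral)

lemma runs_LoopF: "top_bit s r = c \<Longrightarrow> runs m (Loop r c p) s 1 s"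
  unfolding runs_def using exec.LoopF by blast

lemma runs_LoopT:
  "top_bit s r \<noteq> c \<Longrightarrow> runs m p s t s' \<Longrightarrow> runs m (Loop r c p) s' t' s'' \<Longrightarrow>
    runs m (Loop r c p) s (t + t' + 2) s''"
  unfolding runs_def by (meson add_le_mono add_le_mono1 exec.LoopT)

lemma runs_mono: "runs m p s t s' \<Longrightarrow> m \<le> m' \<Longrightarrow> t \<le> t' \<Longrightarrow> runs m' p s t' s'"
  unfolding runs_def by (meson exec_mono order_trans)

definition regs :: "bool list \<Rightarrow> bool list \<Rightarrow> bool list \<Rightarrow> bool list \<Rightarrow> store" where
  "regs a b c d = (\<lambda>_. [])(1 := a, 2 := b, 3 := c, 4 := d)"

lemma regs_simps [simp]:
  "regs a b c d 0 = []" "regs a b c d 1 = a" "regs a b c d (Suc 0) = a" "regs a b c d 2 = b" "regs a b c d 3 = c" "regs a b c d 4 = d"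
  "(regs a b c d)(1 := x) = regs x b c d" "(regs a b c d)(Suc 0 := x) = regs x b c d" "(regs a b c d)(2 := x) = regs a x c d"
  "(regs a b c d)(3 := x) = regs a b x d" "(regs a b c d)(4 := x) = regs a b c x"
  by (auto simp: regs_def fun_eq_iff)

text \<open>Register 4 counts the trees still to be moved.\<close>

definition mv_loop :: "nat \<Rightarrow> nat \<Rightarrow> prog" where
  "mv_loop r a = Loop 4 None (Pop 4 ;; Cond r (Some True)
    (Pop r ;; Push a True ;; Push 4 True ;; Push 4 True) (Pop r ;; Push a False))"

definition mv :: "nat \<Rightarrow> nat \<Rightarrow> prog" where
  "mv r a = Push 4 True ;; mv_loop r a"

text \<open>The remainder of the run is a premise: the loop does not stop between the two subtrees
  of a node, so the run for a node consists of the runs for its subtrees, each continued by the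
  next. The factor 12 is the cost of a round that reads a \<open>True\<close>.\<close>

lemma mv_loop_tree:
  assumes "distinct [r, a, 4]" "s 4 = True # k" "s r = flat t @ l"
    "length (s a) + length (flat t) \<le> m" "length k + length (flat t) \<le> m"
    "runs m (mv_loop r a) (s(4 := k, r := l, a := rev (flat t) @ s a)) n s'"
  shows "runs m (mv_loop r a) s (n + 12 * length (flat t)) s'"
  using assms
proof (induction t arbitrary: s k l n)
  case Leaf
  have "runs m (Pop 4 ;; Cond r (Some True) (Pop r ;; Push a True ;; Push 4 True ;; Push 4 True) (Pop r ;; Push a False))
     s (1 + ((1 + 2) + 2)) (s(4 := k, r := l, a := False # s a))"
    using Leaf.prems by (intro runs_Pop_Seq runs_CondF runs_Pop_Seq runs_Push)
      (auto simp: top_bit_def fun_eq_iff)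
  moreover have "runs m (mv_loop r a) (s(4 := k, r := l, a := False # s a)) n s'"
    using Leaf.prems(6) by (simp only: flat.simps rev.simps append.simps)
  ultimately have "runs m (mv_loop r a) s ((1 + ((1 + 2) + 2)) + n + 2) s'"
    unfolding mv_loop_def by (rule runs_LoopT[rotated]) (simp add: top_bit_def Leaf.prems(2))
  thus ?case by (rule runs_mono) auto
next
  case (Node t u)
  let ?s1 = "s(4 := True # True # k, r := flat t @ flat u @ l, a := True # s a)"
  let ?s2 = "?s1(4 := True # k, r := flat u @ l, a := rev (flat t) @ True # s a)"
  have "length (flat (Node t u)) = 1 + length (flat t) + length (flat u)" by simp
  \<comment> \<open>A node trades one mark on register 4 for two; the two subtrees have at least one
    bit each, which leaves room for the extra mark.\<close>
  hence k: "Suc (length k) < m" using Node.prems(5) length_flat_pos[of t] length_flat_pos[of u] by linarith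
  have 1: "runs m (Pop 4 ;; Cond r (Some True) (Pop r ;; Push a True ;; Push 4 True ;; Push 4 True) (Pop r ;; Push a False))
     s (1 + ((1 + (2 + (2 + 2))) + 2)) ?s1"
    using Node.prems k
    by (intro runs_Pop_Seq runs_CondT runs_Pop_Seq runs_Push_Seq runs_Push)
      (auto simp: top_bit_def fun_eq_iff)
  have e: "?s2(4 := k, r := l, a := rev (flat u) @ ?s2 a) =
      s(4 := k, r := l, a := rev (flat (Node t u)) @ s a)"
    using Node.prems(1) by (auto simp: fun_eq_iff)
  have "runs m (mv_loop r a) ?s2 (n + 12 * length (flat u)) s'"
  proof (rule Node.IH(2)[where k = k and l = l])
    show "runs m (mv_loop r a) (?s2(4 := k, r := l, a := rev (flat u) @ ?s2 a)) n s'"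
      using Node.prems(6) by (simp only: e)
  qed (use Node.prems in auto)
  hence "runs m (mv_loop r a) ?s1 ((n + 12 * length (flat u)) + 12 * length (flat t)) s'"
  proof (intro Node.IH(1)[where k = "True # k" and l = "flat u @ l"])
    assume *: "runs m (mv_loop r a) ?s2 (n + 12 * length (flat u)) s'"
    have "?s1 a = True # s a" using Node.prems(1) by simp
    with * show "runs m (mv_loop r a) (?s1(4 := True # k, r := flat u @ l, a := rev (flat t) @ ?s1 a))
      (n + 12 * length (flat u)) s'" by (simp only:)
  qed (use Node.prems in auto)
  hence "runs m (mv_loop r a) s ((1 + ((1 + (2 + (2 + 2))) + 2)) +
      ((n + 12 * length (flat u)) + 12 * length (flat t)) + 2) s'"
    using 1 Node.prems(2) unfolding mv_loop_def
    by (intro runs_LoopT) (auto simp: top_bit_def)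
  thus ?case by (rule runs_mono) auto
qed

lemma runs_mv:
  assumes "distinct [r, a, 4]" "s 4 = []" "s r = flat t @ l" "length (s a) + length (flat t) \<le> m"
    "s' = s(r := l, a := rev (flat t) @ s a)"
  shows "runs m (mv r a) s (12 * length (flat t) + 3) s'"
proof -
  have "0 < m" using assms(4) length_flat_pos[of t] by linarith
  have "runs m (mv_loop r a) s' 1 s'"
    unfolding mv_loop_def using assms by (intro runs_LoopF) (auto simp: top_bit_def)
  hence "runs m (mv_loop r a) (s(4 := [True])) (1 + 12 * length (flat t)) s'"
    using assms by (intro mv_loop_tree[where k = "[]" and l = l]) (auto simp: fun_upd_idem fun_upd_twist[of 4])
  hence "runs m (mv r a) s (2 + (1 + 12 * length (flat t))) s'"
    unfolding mv_def using assms(2) \<open>0 < m\<close> by (intro runs_Push_Seq) auto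
  thus ?thesis by (rule runs_mono) auto
qed

definition pour :: "nat \<Rightarrow> nat \<Rightarrow> prog" where
  "pour a r = Loop a None (Cond a (Some True) (Pop a ;; Push r True) (Pop a ;; Push r False))"

lemma runs_pour:
  assumes "a \<noteq> r" "length (s a) + length (s r) \<le> m" "s' = s(a := [], r := rev (s a) @ s r)"
  shows "runs m (pour a r) s (7 * length (s a) + 1) s'"
  using assms
proof (induction "s a" arbitrary: s)
  case Nil
  hence "s' = s" by auto
  thus ?case unfolding pour_def using Nil by (auto intro!: runs_mono[OF runs_LoopF] simp: top_bit_def)
next
  case (Cons b l)
  let ?s = "s(a := l, r := b # s r)"
  have 1: "runs m (Cond a (Some True) (Pop a ;; Push r True) (Pop a ;; Push r False)) s (1 + 2 + 2) ?s"
  proof (cases b)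
    case True
    thus ?thesis using Cons.prems Cons.hyps(2)[symmetric]
      by (intro runs_CondT runs_Pop_Seq runs_Push) (auto simp: top_bit_def fun_eq_iff)
  next
    case False
    thus ?thesis using Cons.prems Cons.hyps(2)[symmetric]
      by (intro runs_CondF runs_Pop_Seq runs_Push) (auto simp: top_bit_def fun_eq_iff)
  qed
  have "runs m (pour a r) ?s (7 * length (?s a) + 1) s'"
    using Cons.prems Cons.hyps(2)[symmetric] by (intro Cons.hyps(1)) (auto simp: fun_eq_iff)
  hence "runs m (pour a r) s (1 + 2 + 2 + (7 * length (?s a) + 1) + 2) s'"
    using 1 Cons.hyps(2)[symmetric] unfolding pour_def by (intro runs_LoopT) (auto simp: top_bit_def)
  thus ?case using Cons.prems(1) Cons.hyps(2)[symmetric] by (auto elim!: runs_mono)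
qed

definition pour2 :: "nat \<Rightarrow> nat \<Rightarrow> nat \<Rightarrow> prog" where
  "pour2 a r u = Loop a None (Cond a (Some True)
    (Pop a ;; Push r True ;; Push u True) (Pop a ;; Push r False ;; Push u False))"

lemma runs_pour2:
  assumes "distinct [a, r, u]" "length (s a) + length (s r) \<le> m" "length (s a) + length (s u) \<le> m"
    "s' = s(a := [], r := rev (s a) @ s r, u := rev (s a) @ s u)"
  shows "runs m (pour2 a r u) s (9 * length (s a) + 1) s'"
  using assms
proof (induction "s a" arbitrary: s)
  case Nil
  hence "s' = s" by auto
  thus ?case unfolding pour2_def using Nil by (auto intro!: runs_mono[OF runs_LoopF] simp: top_bit_def)
next
  case (Cons b l)
  let ?s = "s(a := l, r := b # s r, u := b # s u)"
  have 1: "runs m (Cond a (Some True)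
    (Pop a ;; Push r True ;; Push u True) (Pop a ;; Push r False ;; Push u False)) s (1 + (2 + 2) + 2) ?s"
  proof (cases b)
    case True
    thus ?thesis using Cons.prems Cons.hyps(2)[symmetric]
      by (intro runs_CondT runs_Pop_Seq runs_Push_Seq runs_Push) (auto simp: top_bit_def fun_eq_iff)
  next
    case False
    thus ?thesis using Cons.prems Cons.hyps(2)[symmetric]
      by (intro runs_CondF runs_Pop_Seq runs_Push_Seq runs_Push) (auto simp: top_bit_def fun_eq_iff)
  qed
  have "runs m (pour2 a r u) ?s (9 * length (?s a) + 1) s'"
    using Cons.prems Cons.hyps(2)[symmetric] by (intro Cons.hyps(1)) (auto simp: fun_eq_iff)
  hence "runs m (pour2 a r u) s (1 + (2 + 2) + 2 + (9 * length (?s a) + 1) + 2) s'"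
    using 1 Cons.hyps(2)[symmetric] unfolding pour2_def by (intro runs_LoopT) (auto simp: top_bit_def)
  thus ?case using Cons.prems(1) Cons.hyps(2)[symmetric] by (auto elim!: runs_mono)
qed

abbreviation mk :: "bool list \<Rightarrow> store" where
  "mk l \<equiv> regs l [] [] []"

text \<open>Each transfer reverses. \<open>pour2\<close> leaves one upright copy in place and one on
  register 3, which passes through register 2 so as to arrive upright as well.\<close>

definition dup :: prog where
  "dup = mv 1 2 ;; pour2 2 1 3 ;; pour 3 2 ;; pour 2 1"

lemma runs_dup:
  "runs (length l + 2 * sz x + 1) dup (mk (code x @ l)) (40 * sz x + 40) (mk (code x @ code x @ l))"
proof -
  obtain t where t: "code x = flat t" using code_flat by blast
  let ?r = "rev (code x)"
  let ?m = "length l + 2 * sz x + 1"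
  have 1: "runs ?m (mv 1 2) (mk (code x @ l)) (12 * sz x + 3) (regs l ?r [] [])"
    using runs_mv[of 1 2 "mk (code x @ l)" t l ?m "regs l ?r [] []"] by (simp add: t)
  have 2: "runs ?m (pour2 2 1 3) (regs l ?r [] []) (9 * sz x + 1) (regs (code x @ l) [] (code x) [])"
    using runs_pour2[of 2 1 3 "regs l ?r [] []" ?m "regs (code x @ l) [] (code x) []"] by simp
  have 3: "runs ?m (pour 3 2) (regs (code x @ l) [] (code x) []) (7 * sz x + 1) (regs (code x @ l) ?r [] [])"
    using runs_pour[of 3 2 "regs (code x @ l) [] (code x) []" ?m "regs (code x @ l) ?r [] []"] by simp
  have 4: "runs ?m (pour 2 1) (regs (code x @ l) ?r [] []) (7 * sz x + 1) (mk (code x @ code x @ l))"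
    using runs_pour[of 2 1 "regs (code x @ l) ?r [] []" ?m "mk (code x @ code x @ l)"] by simp
  show ?thesis unfolding dup_def
    by (rule runs_mono[OF runs_Seq[OF 1 runs_Seq[OF 2 runs_Seq[OF 3 4]]]]) auto
qed

definition swap :: prog where
  "swap = mv 1 2 ;; mv 1 3 ;; pour 2 1 ;; pour 3 1"

lemma runs_swap:
  "runs (length l + sz x + sz y + 1) swap (mk (code x @ code y @ l)) (20 * (sz x + sz y) + 20)
    (mk (code y @ code x @ l))"
proof -
  obtain t u where t: "code x = flat t" "code y = flat u" using code_flat by metis
  let ?m = "length l + sz x + sz y + 1" and ?x = "rev (code x)" and ?y = "rev (code y)"
  have 1: "runs ?m (mv 1 2) (mk (code x @ code y @ l)) (12 * sz x + 3) (regs (code y @ l) ?x [] [])"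
    using runs_mv[of 1 2 "mk (code x @ code y @ l)" t "code y @ l" ?m "regs (code y @ l) ?x [] []"] by (simp add: t)
  have 2: "runs ?m (mv 1 3) (regs (code y @ l) ?x [] []) (12 * sz y + 3) (regs l ?x ?y [])"
    using runs_mv[of 1 3 "regs (code y @ l) ?x [] []" u l ?m "regs l ?x ?y []"] by (simp add: t)
  have 3: "runs ?m (pour 2 1) (regs l ?x ?y []) (7 * sz x + 1) (regs (code x @ l) [] ?y [])"
    using runs_pour[of 2 1 "regs l ?x ?y []" ?m "regs (code x @ l) [] ?y []"] by simp
  have 4: "runs ?m (pour 3 1) (regs (code x @ l) [] ?y []) (7 * sz y + 1) (mk (code y @ code x @ l))"
    using runs_pour[of 3 1 "regs (code x @ l) [] ?y []" ?m "mk (code y @ code x @ l)"] by simp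
  show ?thesis unfolding swap_def
    by (rule runs_mono[OF runs_Seq[OF 1 runs_Seq[OF 2 runs_Seq[OF 3 4]]]]) auto
qed

definition drop_top :: prog where
  "drop_top = mv 1 2 ;; Loop 2 None (Pop 2)"

lemma runs_drop: "runs (length l + sz x + 1) drop_top (mk (code x @ l)) (20 * sz x + 20) (mk l)"
proof -
  have *: "runs m (Loop 2 None (Pop 2)) (regs l b [] []) (3 * length b + 1) (mk l)" for m b
  proof (induction b)
    case Nil
    show ?case by (auto intro!: runs_mono[OF runs_LoopF] simp: top_bit_def)
  next
    case (Cons c b)
    have "runs m (Loop 2 None (Pop 2)) (regs l (c # b) [] []) (1 + (3 * length b + 1) + 2) (mk l)"
      by (rule runs_LoopT[OF _ runs_Pop Cons]) (auto simp: top_bit_def)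
    thus ?case by (rule runs_mono) auto
  qed
  obtain t where t: "code x = flat t" using code_flat by blast
  let ?m = "length l + sz x + 1"
  have 1: "runs ?m (mv 1 2) (mk (code x @ l)) (12 * sz x + 3) (regs l (rev (code x)) [] [])"
    using runs_mv[of 1 2 "mk (code x @ l)" t l ?m "regs l (rev (code x)) [] []"] by (simp add: t)
  show ?thesis unfolding drop_top_def
    by (rule runs_mono[OF runs_Seq[OF 1 *]]) auto
qed

lemma wf_stack [simp]: "wf_prog dup" "wf_prog swap" "wf_prog drop_top"
  by (simp_all add: dup_def swap_def drop_top_def mv_def mv_loop_def pour_def pour2_def)

subsection \<open>Closure properties\<close>

text \<open>
  The flag \<open>tm\<close> selects between polynomial time and polynomial space; the space bound is relative
  to the part of the stack below the argument.
\<close>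

definition implements :: "bool \<Rightarrow> prog \<Rightarrow> nat poly \<Rightarrow> ('a::coded \<Rightarrow> 'b::coded) \<Rightarrow> bool" where
  "implements tm p q f \<longleftrightarrow> wf_prog p \<and> (\<forall>x l. sz x \<le> poly q (sz x) \<and> (\<exists>n.
    exec (length l + poly q (sz x)) p (mk (code x @ l)) n (mk (code (f x) @ l)) \<and>
    (tm \<longrightarrow> n \<le> poly q (sz x))))"

definition pcf :: "bool \<Rightarrow> ('a::coded \<Rightarrow> 'b::coded) \<Rightarrow> bool" where
  "pcf tm f \<longleftrightarrow> (\<exists>p q. implements tm p q f)"

named_theorems pcf_intros

text \<open>The space bound doubles as a bound on the size of the result, because the result is the
  final content of a stack whose height was bounded all along.\<close>

lemma implements_sz:
  assumes "implements tm p q f"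
  shows "sz (f x) \<le> poly q (sz x)"
proof -
  obtain n where "exec (poly q (sz x)) p (mk (code x)) n (mk (code (f x)))" "sz x \<le> poly q (sz x)"
    using assms[unfolded implements_def] by (metis add_0 append_Nil2 list.size(3))
  moreover from this(2) have "bounded_store (poly q (sz x)) (mk (code x))"
    by (auto simp: bounded_store_def regs_def)
  ultimately have "bounded_store (poly q (sz x)) (mk (code (f x)))" using exec_bounded by blast
  thus ?thesis unfolding bounded_store_def by (metis regs_simps(2))
qed

lemma pcf_sz: "pcf tm f \<Longrightarrow> \<exists>q. \<forall>x. sz (f x) \<le> poly q (sz x)"
  unfolding pcf_def using implements_sz by blast

lemma implements_exec:
  assumes "implements tm p q f" "length l + poly q (sz x) \<le> m"
  shows "\<exists>n. exec m p (mk (code x @ l)) n (mk (code (f x) @ l)) \<and> (tm \<longrightarrow> n \<le> poly q (sz x))"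
  using assms exec_mono unfolding implements_def by meson

text \<open>The common form of both resource bounds: the time clause is dropped unless
  \<open>tm\<close> holds, so every closure property is proved once.\<close>

definition xruns :: "bool \<Rightarrow> nat \<Rightarrow> prog \<Rightarrow> store \<Rightarrow> nat \<Rightarrow> store \<Rightarrow> bool" where
  "xruns tm m p s t s' \<longleftrightarrow> (\<exists>n. exec m p s n s' \<and> (tm \<longrightarrow> n \<le> t))"

lemma xruns_runs: "runs m p s t s' \<Longrightarrow> xruns tm m p s t s'"
  unfolding runs_def xruns_def by blast

lemma xruns_mono: "xruns tm m p s t s' \<Longrightarrow> m \<le> m' \<Longrightarrow> t \<le> t' \<Longrightarrow> xruns tm m' p s t' s'"
  unfolding xruns_def by (meson exec_mono order_trans)

lemma xruns_Seq: "xruns tm m p s t s' \<Longrightarrow> xruns tm m q s' t' s'' \<Longrightarrow> xruns tm m (p ;; q) s (t + t') s''"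
  unfolding xruns_def by (meson add_mono exec.Seq)

lemma xruns_CondT: "top_bit s r = c \<Longrightarrow> xruns tm m p s t s' \<Longrightarrow> xruns tm m (Cond r c p q) s (t + 2) s'"
  unfolding xruns_def by (meson add_le_mono1 exec.CondT)

lemma xruns_CondF: "top_bit s r \<noteq> c \<Longrightarrow> xruns tm m q s t s' \<Longrightarrow> xruns tm m (Cond r c p q) s (t + 2) s'"
  unfolding xruns_def by (meson add_le_mono exec.CondF one_le_numeral)

lemma xruns_LoopF: "top_bit s r = c \<Longrightarrow> xruns tm m (Loop r c p) s 1 s"
  unfolding xruns_def using exec.LoopF by blast

lemma xruns_LoopT:
  "top_bit s r \<noteq> c \<Longrightarrow> xruns tm m p s t s' \<Longrightarrow> xruns tm m (Loop r c p) s' t' s'' \<Longrightarrow>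
    xruns tm m (Loop r c p) s (t + t' + 2) s''"
  unfolding xruns_def by (meson add_le_mono add_le_mono1 exec.LoopT)

lemma xruns_impl:
  assumes "implements tm p q f" "length l + poly q (sz x) \<le> m"
  shows "xruns tm m p (mk (code x @ l)) (poly q (sz x)) (mk (code (f x) @ l))"
  using implements_exec[OF assms] unfolding xruns_def .

lemma xruns_dup: "length l + 2 * sz x + 1 \<le> m \<Longrightarrow>
    xruns tm m dup (mk (code x @ l)) (40 * sz x + 40) (mk (code x @ code x @ l))"
  by (rule xruns_mono[OF xruns_runs[OF runs_dup]]) auto

lemma xruns_swap: "length l + sz x + sz y + 1 \<le> m \<Longrightarrow>
    xruns tm m swap (mk (code x @ code y @ l)) (20 * (sz x + sz y) + 20) (mk (code y @ code x @ l))"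
  by (rule xruns_mono[OF xruns_runs[OF runs_swap]]) auto

lemma xruns_drop: "length l + sz x + 1 \<le> m \<Longrightarrow>
    xruns tm m drop_top (mk (code x @ l)) (20 * sz x + 20) (mk l)"
  by (rule xruns_mono[OF xruns_runs[OF runs_drop]]) auto

lemma xruns_Push1: "length l < m \<Longrightarrow> xruns tm m (Push 1 b) (mk l) 2 (mk (b # l))"
  by (rule xruns_runs, rule runs_Push) auto

lemma xruns_Pop1: "xruns tm m (Pop 1) (mk l) 1 (mk (tl l))"
  by (rule xruns_runs, rule runs_Pop) auto

lemma xruns_Pop_Seq: "xruns tm m p (mk l) t s \<Longrightarrow> xruns tm m (Pop 1 ;; p) (mk (b # l)) (1 + t) s"
  using xruns_Seq[OF xruns_Pop1[of tm m "b # l"]] by simp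

lemma implementsI:
  fixes f :: "'a::coded \<Rightarrow> 'b::coded"
  assumes "wf_prog p" "\<And>x :: 'a. sz x \<le> poly q (sz x)"
    "\<And>x l. xruns tm (length l + poly q (sz x)) p (mk (code x @ l)) (poly q (sz x)) (mk (code (f x) @ l))"
  shows "implements tm p q f"
  using assms by (auto simp: implements_def xruns_def)

lemma implementsD:
  fixes f :: "'a::coded \<Rightarrow> 'b::coded" and x :: 'a
  shows "implements tm p q f \<Longrightarrow> wf_prog p" "implements tm p q f \<Longrightarrow> sz x \<le> poly q (sz x)"
  unfolding implements_def by blast+

lemma pcf_id: "pcf tm (\<lambda>x. x)"
proof -
  have "implements tm Skip [:0, 1:] (\<lambda>x :: 'a. x)"
    by (rule implementsI) (auto simp: xruns_def intro: exec.Skip)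
  thus ?thesis unfolding pcf_def by blast
qed

lemma pcf_const: "pcf tm (\<lambda>x :: 'a::coded. c :: 'b::coded)"
proof -
  define pushes where "pushes = foldr (\<lambda>b p. p ;; Push 1 b) (code c) Skip"
  have *: "xruns tm m (foldr (\<lambda>b p. p ;; Push 1 b) bs Skip) (mk l) (2 * length bs) (mk (bs @ l))"
    if "length l + length bs \<le> m" for m bs l
    using that
  proof (induction bs)
    case Nil
    show ?case by (auto simp: xruns_def intro: exec.Skip)
  next
    case (Cons b bs)
    have "xruns tm m (foldr (\<lambda>b p. p ;; Push 1 b) bs Skip ;; Push 1 b) (mk l) (2 * length bs + 2) (mk (b # bs @ l))"
      using Cons by (intro xruns_Seq[OF Cons.IH xruns_Push1]) auto
    thus ?case by (simp add: add.commute)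
  qed
  have wf: "wf_prog (foldr (\<lambda>b p. p ;; Push 1 b) bs Skip)" for bs by (induction bs) auto
  have "implements tm (drop_top ;; pushes) [: 20 + 2 * sz c + 1, 20 :] (\<lambda>x :: 'a. c)"
  proof (rule implementsI)
    fix x :: 'a and l
    have "xruns tm (length l + (sz x + 2 * sz c + 1)) (drop_top ;; pushes) (mk (code x @ l))
      ((20 * sz x + 20) + 2 * length (code c)) (mk (code c @ l))"
      unfolding pushes_def by (rule xruns_Seq[OF xruns_drop *]) auto
    thus "xruns tm (length l + poly [:20 + 2 * sz c + 1, 20:] (sz x)) (drop_top ;; pushes) (mk (code x @ l))
      (poly [:20 + 2 * sz c + 1, 20:] (sz x)) (mk (code c @ l))"
      by (rule xruns_mono) auto
  qed (auto simp: pushes_def wf[simplified])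
  thus ?thesis unfolding pcf_def by blast
qed

lemma pcf_comp:
  fixes f :: "'a::coded \<Rightarrow> 'b::coded" and g :: "'b \<Rightarrow> 'c::coded"
  assumes "pcf tm f" "pcf tm g"
  shows "pcf tm (\<lambda>x. g (f x))"
proof -
  obtain p q p' q' where f: "implements tm p q f" and g: "implements tm p' q' g"
    using assms unfolding pcf_def by blast
  have "implements tm (p ;; p') (q + pcompose q' q) (\<lambda>x. g (f x))"
  proof (rule implementsI)
    fix x :: 'a and l :: "bool list"
    have le: "poly q' (sz (f x)) \<le> poly q' (poly q (sz x))"
      using implements_sz[OF f] by (rule poly_nat_mono)
    have "xruns tm (length l + (poly q (sz x) + poly q' (poly q (sz x)))) (p ;; p') (mk (code x @ l))
        (poly q (sz x) + poly q' (sz (f x))) (mk (code (g (f x)) @ l))"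
      using le by (intro xruns_Seq[OF xruns_impl[OF f] xruns_impl[OF g]]) auto
    thus "xruns tm (length l + poly (q + pcompose q' q) (sz x)) (p ;; p') (mk (code x @ l))
       (poly (q + pcompose q' q) (sz x)) (mk (code (g (f x)) @ l))"
      by (rule xruns_mono) (use le in \<open>auto simp: poly_pcompose\<close>)
  qed (use implementsD[OF f] implementsD[OF g] in \<open>auto intro: trans_le_add1\<close>)
  thus ?thesis unfolding pcf_def by blast
qed

lemma pcf_Pair [pcf_intros]:
  fixes f :: "'a::coded \<Rightarrow> 'b::coded" and g :: "'a \<Rightarrow> 'c::coded"
  assumes "pcf tm f" "pcf tm g"
  shows "pcf tm (\<lambda>x. (f x, g x))"
proof -
  obtain p q p' q' where f: "implements tm p q f" and g: "implements tm p' q' g"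
    using assms unfolding pcf_def by blast
  let ?P = "dup ;; p ;; swap ;; p' ;; swap ;; Push 1 True"
  let ?q = "smult 42 q + smult 42 q' + [:100, 62:]"
  have "implements tm ?P ?q (\<lambda>x. (f x, g x))"
  proof (rule implementsI)
    fix x :: 'a and l :: "bool list"
    let ?a = "poly q (sz x)" and ?b = "poly q' (sz x)"
    have s: "sz (f x) \<le> ?a" "sz (g x) \<le> ?b" using implements_sz[OF f] implements_sz[OF g] by auto
    have "xruns tm (length l + (2 * sz x + ?a + ?b + 1)) ?P (mk (code x @ l))
      ((40 * sz x + 40) + (?a + ((20 * (sz (f x) + sz x) + 20) + (?b + ((20 * (sz (g x) + sz (f x)) + 20) + 2)))))
      (mk (True # code (f x) @ code (g x) @ l))"
      using s by (intro xruns_Seq[OF xruns_dup xruns_Seq[OF xruns_impl[OF f] xruns_Seq[OF xruns_swap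
        xruns_Seq[OF xruns_impl[OF g] xruns_Seq[OF xruns_swap xruns_Push1]]]]]) auto
    hence "xruns tm (length l + poly ?q (sz x)) ?P (mk (code x @ l)) (poly ?q (sz x))
      (mk (True # code (f x) @ code (g x) @ l))"
      by (rule xruns_mono) (use s in auto)
    thus "xruns tm (length l + poly ?q (sz x)) ?P (mk (code x @ l)) (poly ?q (sz x)) (mk (code (f x, g x) @ l))"
      by simp
  qed (use implementsD[OF f] implementsD[OF g] in \<open>auto\<close>)
  thus ?thesis unfolding pcf_def by blast
qed

lemma pcf_fst_base: "pcf tm (fst :: 'a::coded \<times> 'b::coded \<Rightarrow> 'a)"
proof -
  have "implements tm (Pop 1 ;; swap ;; drop_top) [:100, 40:] (fst :: 'a \<times> 'b \<Rightarrow> 'a)"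
  proof (rule implementsI)
    fix x :: "'a \<times> 'b" and l :: "bool list"
    obtain a b where x: "x = (a, b)" by (cases x)
    have "xruns tm (length l + (sz a + sz b + 1)) (Pop 1 ;; swap ;; drop_top) (mk (True # code a @ code b @ l))
       (1 + ((20 * (sz a + sz b) + 20) + (20 * sz b + 20))) (mk (code a @ l))"
      by (rule xruns_Pop_Seq) (rule xruns_Seq[OF xruns_swap xruns_drop], auto)
    thus "xruns tm (length l + poly [:100, 40:] (sz x)) (Pop 1 ;; swap ;; drop_top) (mk (code x @ l))
       (poly [:100, 40:] (sz x)) (mk (code (fst x) @ l))"
      by (auto simp: x elim!: xruns_mono)
  qed auto
  thus ?thesis unfolding pcf_def by blast
qed

lemma pcf_snd_base: "pcf tm (snd :: 'a::coded \<times> 'b::coded \<Rightarrow> 'b)"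
proof -
  have "implements tm (Pop 1 ;; drop_top) [:100, 40:] (snd :: 'a \<times> 'b \<Rightarrow> 'b)"
  proof (rule implementsI)
    fix x :: "'a \<times> 'b" and l :: "bool list"
    obtain a b where x: "x = (a, b)" by (cases x)
    have "xruns tm (length l + (sz a + sz b + 1)) (Pop 1 ;; drop_top) (mk (True # code a @ code b @ l))
       (1 + (20 * sz a + 20)) (mk (code b @ l))"
      by (rule xruns_Pop_Seq) (rule xruns_drop, auto)
    thus "xruns tm (length l + poly [:100, 40:] (sz x)) (Pop 1 ;; drop_top) (mk (code x @ l))
       (poly [:100, 40:] (sz x)) (mk (code (snd x) @ l))"
      by (auto simp: x elim!: xruns_mono)
  qed auto
  thus ?thesis unfolding pcf_def by blast
qed

lemmas pcf_fst [pcf_intros] = pcf_comp[OF _ pcf_fst_base]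
  and pcf_snd [pcf_intros] = pcf_comp[OF _ pcf_snd_base]

lemma pcf_if [pcf_intros]:
  fixes c :: "'a::coded \<Rightarrow> bool" and f g :: "'a \<Rightarrow> 'b::coded"
  assumes "pcf tm c" "pcf tm f" "pcf tm g"
  shows "pcf tm (\<lambda>x. if c x then f x else g x)"
proof -
  obtain pc qc p q p' q' where c: "implements tm pc qc c"
    and f: "implements tm p q f" and g: "implements tm p' q' g"
    using assms unfolding pcf_def by blast
  \<comment> \<open>\<open>True\<close> is coded by three bits and \<open>False\<close> by one,
    whence the unequal numbers of pops.\<close>
  let ?P = "dup ;; pc ;; Cond 1 (Some True) (Pop 1 ;; Pop 1 ;; Pop 1 ;; p) (Pop 1 ;; p')"
  let ?q = "qc + q + q' + [:100, 62:]"
  have "implements tm ?P ?q (\<lambda>x. if c x then f x else g x)"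
  proof (rule implementsI)
    fix x :: 'a and l :: "bool list"
    let ?a = "poly q (sz x)" and ?b = "poly q' (sz x)" and ?c = "poly qc (sz x)"
    let ?m = "length l + (2 * sz x + ?a + ?b + ?c + 1)"
    have "xruns tm ?m (Cond 1 (Some True) (Pop 1 ;; Pop 1 ;; Pop 1 ;; p) (Pop 1 ;; p')) (mk (code (c x) @ code x @ l))
      (?a + ?b + 3 + 2) (mk (code (if c x then f x else g x) @ l))"
    proof (cases "c x")
      case True
      have "xruns tm ?m (Pop 1 ;; Pop 1 ;; Pop 1 ;; p) (mk ([True, False, False] @ code x @ l))
        (1 + (1 + (1 + ?a))) (mk (code (f x) @ l))"
        by (simp only: append.simps, rule xruns_Pop_Seq, rule xruns_Pop_Seq,
            rule xruns_Pop_Seq, rule xruns_impl[OF f]) auto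
      hence "xruns tm ?m (Pop 1 ;; Pop 1 ;; Pop 1 ;; p) (mk ([True, False, False] @ code x @ l))
        (?a + ?b + 3) (mk (code (f x) @ l))" by (rule xruns_mono) auto
      thus ?thesis using True by (intro xruns_CondT) (auto simp: top_bit_def)
    next
      case False
      have "xruns tm ?m (Pop 1 ;; p') (mk ([False] @ code x @ l)) (1 + ?b) (mk (code (g x) @ l))"
        by (simp only: append.simps, rule xruns_Pop_Seq, rule xruns_impl[OF g]) auto
      hence "xruns tm ?m (Pop 1 ;; p') (mk ([False] @ code x @ l)) (?a + ?b + 3) (mk (code (g x) @ l))"
        by (rule xruns_mono) auto
      thus ?thesis using False by (intro xruns_CondF) (auto simp: top_bit_def)
    qed
    hence "xruns tm ?m ?P (mk (code x @ l)) ((40 * sz x + 40) + (?c + (?a + ?b + 3 + 2)))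
       (mk (code (if c x then f x else g x) @ l))"
      by (intro xruns_Seq[OF xruns_dup] xruns_Seq[OF xruns_impl[OF c]]) auto
    thus "xruns tm (length l + poly ?q (sz x)) ?P (mk (code x @ l)) (poly ?q (sz x))
       (mk (code (if c x then f x else g x) @ l))"
      by (rule xruns_mono) auto
  qed (use implementsD[OF f] implementsD[OF g] implementsD[OF c] in \<open>auto\<close>)
  thus ?thesis unfolding pcf_def by blast
qed

lemma pcf_Cons [pcf_intros]:
  assumes "pcf tm f" "pcf tm g"
  shows "pcf tm (\<lambda>x. f x # g x)"
  \<comment> \<open>a list cell has the same code as a pair\<close>
  using pcf_Pair[OF assms] by (simp add: pcf_def implements_def)

lemma pcf_case_list [pcf_intros]:
  fixes xs :: "'a::coded \<Rightarrow> 'b::coded list" and a :: "'a \<Rightarrow> 'c::coded"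
  assumes "pcf tm xs" "pcf tm a" "pcf tm (\<lambda>z. b (fst z) (fst (snd z)) (snd (snd z)))"
  shows "pcf tm (\<lambda>x. case xs x of [] \<Rightarrow> a x | y # ys \<Rightarrow> b x y ys)"
proof -
  let ?g = "\<lambda>z. b (fst z) (fst (snd z)) (snd (snd z))"
  let ?h = "\<lambda>x. case xs x of [] \<Rightarrow> a x | y # ys \<Rightarrow> b x y ys"
  obtain pc qc p q p' q' where c: "implements tm pc qc xs"
    and f: "implements tm p q a" and g: "implements tm p' q' ?g"
    using assms unfolding pcf_def by blast
  \<comment> \<open>A nonempty list already has the code of the pair of its head and tail; one more
    \<open>True\<close> in front of the argument therefore forms the triple that \<open>p'\<close>
    expects.\<close>
  let ?D = "Cond 1 (Some True) (swap ;; Push 1 True ;; p') (Pop 1 ;; p)"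
  let ?P = "dup ;; pc ;; ?D"
  let ?r = "[:1, 1:] + qc"
  let ?q = "smult 21 qc + q + pcompose q' ?r + [:100, 82:]"
  have "implements tm ?P ?q ?h"
  proof (rule implementsI)
    fix x :: 'a and l :: "bool list"
    let ?a = "poly q (sz x)" and ?c = "poly qc (sz x)"
    let ?b = "poly q' (1 + sz x + ?c)"
    let ?m = "length l + (2 * sz x + ?a + ?b + ?c + 1)"
    have s: "sz (xs x) \<le> ?c" using implements_sz[OF c] .
    have "xruns tm ?m ?D (mk (code (xs x) @ code x @ l)) (?a + ?b + 20 * ?c + 20 * sz x + 22 + 2) (mk (code (?h x) @ l))"
    proof (cases "xs x")
      case Nil
      have "xruns tm ?m (Pop 1 ;; p) (mk ([False] @ code x @ l)) (1 + ?a) (mk (code (a x) @ l))"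
        by (simp only: append.simps, rule xruns_Pop_Seq, rule xruns_impl[OF f]) auto
      hence "xruns tm ?m (Pop 1 ;; p) (mk ([False] @ code x @ l)) (?a + ?b + 20 * ?c + 20 * sz x + 22) (mk (code (a x) @ l))"
        by (rule xruns_mono) auto
      thus ?thesis using Nil by (intro xruns_CondF) (auto simp: top_bit_def)
    next
      case (Cons y ys)
      have cd: "code (xs x) = code (y, ys)" using Cons by simp
      have "sz (x, (y, ys)) = 1 + sz x + sz (xs x)" using Cons by simp
      also have "\<dots> \<le> 1 + sz x + ?c" using s by simp
      finally have le: "poly q' (sz (x, (y, ys))) \<le> ?b" by (rule poly_nat_mono)
      have "xruns tm ?m p' (mk (code (x, (y, ys)) @ l)) (poly q' (sz (x, (y, ys)))) (mk (code (?g (x, (y, ys))) @ l))"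
        using le by (intro xruns_impl[OF g]) auto
      hence 1: "xruns tm ?m p' (mk (True # code x @ code (y, ys) @ l)) (poly q' (sz (x, (y, ys)))) (mk (code (b x y ys) @ l))"
        by simp
      have "xruns tm ?m (swap ;; Push 1 True ;; p') (mk (code (y, ys) @ code x @ l))
        ((20 * (sz (y, ys) + sz x) + 20) + (2 + poly q' (sz (x, (y, ys))))) (mk (code (b x y ys) @ l))"
        using s cd by (intro xruns_Seq[OF xruns_swap] xruns_Seq[OF xruns_Push1 1]) auto
      hence "xruns tm ?m (swap ;; Push 1 True ;; p') (mk (code (y, ys) @ code x @ l))
        (?a + ?b + 20 * ?c + 20 * sz x + 22) (mk (code (b x y ys) @ l))"
        by (rule xruns_mono) (use le s cd in auto)
      thus ?thesis using Cons by (intro xruns_CondT) (auto simp: top_bit_def)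
    qed
    hence "xruns tm ?m ?P (mk (code x @ l)) ((40 * sz x + 40) + (?c + (?a + ?b + 20 * ?c + 20 * sz x + 22 + 2)))
       (mk (code (?h x) @ l))"
      by (intro xruns_Seq[OF xruns_dup] xruns_Seq[OF xruns_impl[OF c]]) auto
    thus "xruns tm (length l + poly ?q (sz x)) ?P (mk (code x @ l)) (poly ?q (sz x)) (mk (code (?h x) @ l))"
      by (rule xruns_mono) (auto simp: poly_pcompose add.assoc)
  qed (use implementsD[OF f] implementsD[OF g] implementsD[OF c] in \<open>auto\<close>)
  thus ?thesis unfolding pcf_def by blast
qed

lemma pcf_while:
  fixes c :: "'a::coded \<Rightarrow> bool" and f :: "'a \<Rightarrow> 'a" and g h :: "'b::coded \<Rightarrow> 'a"
  assumes "pcf tm c" "pcf tm f" "pcf tm g"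
    and "\<And>x. \<exists>n. (\<forall>i < n. c ((f ^^ i) (g x))) \<and> \<not> c ((f ^^ n) (g x)) \<and> h x = (f ^^ n) (g x) \<and>
      (\<forall>i \<le> n. sz ((f ^^ i) (g x)) \<le> poly B (sz x)) \<and> (tm \<longrightarrow> n \<le> poly B (sz x))"
  shows "pcf tm h"
proof -
  obtain pc qc p q pg qg where c: "implements tm pc qc c" and f: "implements tm p q f"
    and g: "implements tm pg qg g"
    using assms unfolding pcf_def by blast
  let ?L = "Loop 1 (Some False) (Pop 1 ;; Pop 1 ;; Pop 1 ;; p ;; dup ;; pc)"
  let ?P = "pg ;; (dup ;; pc) ;; ?L ;; Pop 1"
  \<comment> \<open>The cost of one round in terms of the size of the current value;
    \<open>?R\<close> takes it at the largest size that occurs.\<close>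
  let ?r = "q + smult 40 q + smult 50 qc + pcompose qc q + [:100, 40:]"
  let ?R = "pcompose ?r B"
  let ?q = "qg + ?R + (B + 1) * ?R + ?R + [:1, 1:]"
  have "implements tm ?P ?q h"
  proof (rule implementsI)
    fix x0 :: 'b and l :: "bool list"
    define x where "x = g x0"
    obtain n where n: "\<forall>i < n. c ((f ^^ i) x)" "\<not> c ((f ^^ n) x)" "h x0 = (f ^^ n) x"
      "\<forall>i \<le> n. sz ((f ^^ i) x) \<le> poly B (sz x0)" "tm \<longrightarrow> n \<le> poly B (sz x0)"
      using assms(4)[of x0] unfolding x_def by blast
    let ?T = "poly ?r (poly B (sz x0))"
    let ?m = "length l + ?T"
    have B: "poly ?r (sz ((f ^^ i) x)) \<le> ?T" if "i \<le> n" for i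
      using n(4) that by (intro poly_nat_mono) auto
    have T: "40 * sz y + 40 + poly qc (sz y) + 10 \<le> poly ?r (sz y)" for y :: 'a by simp
    have C: "xruns tm ?m (dup ;; pc) (mk (code ((f ^^ i) x) @ l)) ?T
        (mk (code (c ((f ^^ i) x)) @ code ((f ^^ i) x) @ l))" if "i \<le> n" for i
    proof -
      let ?y = "(f ^^ i) x"
      have "xruns tm ?m (dup ;; pc) (mk (code ?y @ l)) ((40 * sz ?y + 40) + poly qc (sz ?y))
        (mk (code (c ?y) @ code ?y @ l))"
        using B[OF that] T[of ?y] by (intro xruns_Seq[OF xruns_dup xruns_impl[OF c]]) auto
      thus ?thesis by (rule xruns_mono) (use B[OF that] T[of ?y] in auto)
    qed
    have loop: "xruns tm ?m ?L (mk (code (c ((f ^^ i) x)) @ code ((f ^^ i) x) @ l)) ((n - i) * ?T + 1)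
        (mk (False # code (h x0) @ l))" if "i \<le> n" for i
      using that
    proof (induction rule: inc_induct)
      case base
      show ?case using n(2,3) by (auto intro!: xruns_mono[OF xruns_LoopF] simp: top_bit_def)
    next
      case (step i)
      let ?y = "(f ^^ i) x" and ?z = "(f ^^ Suc i) x"
      have z: "?z = f ?y" by simp
      have cy: "c ?y" using n(1) step by auto
      have sz: "sz ?z \<le> poly q (sz ?y)" using implements_sz[OF f] z by metis
      have qz: "poly qc (sz ?z) \<le> poly qc (poly q (sz ?y))" using sz by (rule poly_nat_mono)
      have By: "poly ?r (sz ?y) \<le> ?T" using B step by auto
      have 1: "xruns tm ?m (p ;; dup ;; pc) (mk (code ?y @ l))
         (poly q (sz ?y) + ((40 * sz ?z + 40) + poly qc (sz ?z)))
         (mk (code (c ?z) @ code ?z @ l))"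
        using By sz qz by (intro xruns_Seq[OF xruns_impl[OF f, of l ?y, folded z]] xruns_Seq[OF xruns_dup xruns_impl[OF c]])
          (auto simp: poly_pcompose)
      have "xruns tm ?m (Pop 1 ;; Pop 1 ;; Pop 1 ;; p ;; dup ;; pc) (mk (True # False # False # code ?y @ l))
         (1 + (1 + (1 + (poly q (sz ?y) + ((40 * sz ?z + 40) + poly qc (sz ?z))))))
         (mk (code (c ?z) @ code ?z @ l))"
        by (intro xruns_Pop_Seq 1)
      hence "xruns tm ?m ?L (mk ([True, False, False] @ code ?y @ l))
         ((1 + (1 + (1 + (poly q (sz ?y) + ((40 * sz ?z + 40) + poly qc (sz ?z)))))) + ((n - Suc i) * ?T + 1) + 2)
         (mk (False # code (h x0) @ l))"
        by (intro xruns_LoopT[OF _ _ step.IH]) (auto simp: top_bit_def)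
      moreover have "(1 + (1 + (1 + (poly q (sz ?y) + ((40 * sz ?z + 40) + poly qc (sz ?z)))))) + ((n - Suc i) * ?T + 1) + 2
         \<le> (n - i) * ?T + 1"
      proof -
        have "n - i = Suc (n - Suc i)" using step by simp
        moreover have "(1 + (1 + (1 + (poly q (sz ?y) + ((40 * sz ?z + 40) + poly qc (sz ?z)))))) + 2 \<le> ?T"
          using By sz qz by (auto simp: poly_pcompose)
        ultimately show ?thesis by (simp only: mult_Suc)
      qed
      ultimately have "xruns tm ?m ?L (mk ([True, False, False] @ code ?y @ l)) ((n - i) * ?T + 1) (mk (False # code (h x0) @ l))"
        by (elim xruns_mono) auto
      thus ?case using cy by simp
    qed
    have Pp: "xruns tm ?m (Pop 1) (mk (False # code (h x0) @ l)) 1 (mk (code (h x0) @ l))"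
      using xruns_Pop1[of tm ?m "False # code (h x0) @ l"] by simp
    let ?M = "?m + poly qg (sz x0)"
    have "xruns tm ?m ((dup ;; pc) ;; ?L ;; Pop 1) (mk (code x @ l)) (?T + (((n - 0) * ?T + 1) + 1)) (mk (code (h x0) @ l))"
      using C[of 0] loop[of 0] by (intro xruns_Seq[OF _ xruns_Seq[OF _ Pp]]) auto
    hence "xruns tm ?M ((dup ;; pc) ;; ?L ;; Pop 1) (mk (code x @ l)) (?T + (((n - 0) * ?T + 1) + 1)) (mk (code (h x0) @ l))"
      by (rule xruns_mono) auto
    hence "xruns tm ?M ?P (mk (code x0 @ l)) (poly qg (sz x0) + (?T + (((n - 0) * ?T + 1) + 1))) (mk (code (h x0) @ l))"
      unfolding x_def by (intro xruns_Seq[OF xruns_impl[OF g]]) auto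
    moreover have "poly qg (sz x0) + (?T + (((n - 0) * ?T + 1) + 1)) \<le> poly ?q (sz x0)" if tm
    proof -
      have "n * ?T \<le> poly B (sz x0) * ?T" using n(5) that by (intro mult_mono) auto
      moreover have "2 \<le> ?T" by (simp add: poly_pcompose)
      ultimately show ?thesis by (simp add: poly_pcompose algebra_simps)
    qed
    moreover have "?M \<le> length l + poly ?q (sz x0)" by (simp add: poly_pcompose)
    ultimately show "xruns tm (length l + poly ?q (sz x0)) ?P (mk (code x0 @ l)) (poly ?q (sz x0)) (mk (code (h x0) @ l))"
      unfolding xruns_def by (meson exec_mono order_trans)
  qed (use implementsD[OF f] implementsD[OF c] implementsD[OF g] in \<open>auto\<close>)
  thus ?thesis unfolding pcf_def by blast
qed


subsection \<open>Lists\<close>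

lemma pcf_app2:
  "pcf tm (\<lambda>z. F (fst z) (snd z)) \<Longrightarrow> pcf tm a \<Longrightarrow> pcf tm b \<Longrightarrow> pcf tm (\<lambda>x. F (a x) (b x))"
  using pcf_comp[OF pcf_Pair, of tm a b "\<lambda>z. F (fst z) (snd z)"] by simp

lemma pcf_app3:
  assumes "pcf tm (\<lambda>z. F (fst z) (fst (snd z)) (snd (snd z)))" "pcf tm a" "pcf tm b" "pcf tm c"
  shows "pcf tm (\<lambda>x. F (a x) (b x) (c x))"
  using pcf_comp[OF pcf_Pair[OF assms(2) pcf_Pair[OF assms(3,4)]] assms(1)] by simp

declare pcf_const [pcf_intros] pcf_id [pcf_intros]

lemma pcf_not [pcf_intros]:
  assumes "pcf tm a"
  shows "pcf tm (\<lambda>x. \<not> a x)"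
proof -
  have "(\<lambda>x. \<not> a x) = (\<lambda>x. if a x then False else True)" by auto
  thus ?thesis using pcf_if[OF assms pcf_const pcf_const, of False True] by simp
qed

lemma pcf_conj [pcf_intros]:
  assumes "pcf tm a" "pcf tm b"
  shows "pcf tm (\<lambda>x. a x \<and> b x)"
proof -
  have "(\<lambda>x. a x \<and> b x) = (\<lambda>x. if a x then b x else False)" by auto
  thus ?thesis using pcf_if[OF assms pcf_const, of False] by simp
qed

lemma pcf_disj [pcf_intros]:
  assumes "pcf tm a" "pcf tm b"
  shows "pcf tm (\<lambda>x. a x \<or> b x)"
proof -
  have "(\<lambda>x. a x \<or> b x) = (\<lambda>x. if a x then True else b x)" by auto
  thus ?thesis using pcf_if[OF assms(1) pcf_const assms(2), of True] by simp
qed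

lemma pcf_imp [pcf_intros]: "pcf tm a \<Longrightarrow> pcf tm b \<Longrightarrow> pcf tm (\<lambda>x. a x \<longrightarrow> b x)"
  unfolding imp_conv_disj by (rule pcf_disj[OF pcf_not])

lemma pcf_bool_eq [pcf_intros]:
  fixes a b :: "'a::coded \<Rightarrow> bool"
  assumes "pcf tm a" "pcf tm b"
  shows "pcf tm (\<lambda>x. a x = b x)"
proof -
  have "pcf tm (\<lambda>x. if a x then b x else \<not> b x)" by (intro pcf_if pcf_not assms)
  moreover have "(\<lambda>x. if a x then b x else \<not> b x) = (\<lambda>x. a x = b x)" by auto
  ultimately show ?thesis by simp
qed

lemma pcf_case_prod [pcf_intros]:
  "pcf tm (\<lambda>x. h x (fst (p x)) (snd (p x))) \<Longrightarrow> pcf tm (\<lambda>x. case p x of (a, b) \<Rightarrow> h x a b)"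
  by (simp add: case_prod_unfold)

lemma pcf_Nil_eq [pcf_intros]:
  fixes xs :: "'a::coded \<Rightarrow> 'b::coded list"
  assumes "pcf tm xs"
  shows "pcf tm (\<lambda>x. xs x = [])"
proof -
  have "pcf tm (\<lambda>x. case xs x of [] \<Rightarrow> True | y # ys \<Rightarrow> False)" by (intro pcf_intros assms)
  moreover have "(\<lambda>x. case xs x of [] \<Rightarrow> True | y # ys \<Rightarrow> False) = (\<lambda>x. xs x = [])"
    by (auto simp: fun_eq_iff split: list.splits)
  ultimately show ?thesis by simp
qed

text \<open>Iterating a polynomially bounded function may grow exponentially, so the bound is
  demanded of the accumulator after every prefix of the list.\<close>

lemma fold_bounded:
  fixes xs :: "'a::coded \<Rightarrow> 'b::coded list" and f :: "'a \<Rightarrow> 'b \<Rightarrow> 'c \<Rightarrow> 'c::coded"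
  assumes "pcf tm xs" "pcf tm a" "pcf tm (\<lambda>z. f (fst z) (fst (snd z)) (snd (snd z)))"
    and "\<And>x ys zs. xs x = ys @ zs \<Longrightarrow> sz (fold (f x) ys (a x)) \<le> poly B (sz x)"
  shows "pcf tm (\<lambda>x. fold (f x) (xs x) (a x))"
proof -
  let ?c = "\<lambda>s :: 'a \<times> 'b list \<times> 'c. \<not> fst (snd s) = []"
  let ?f = "\<lambda>s :: 'a \<times> 'b list \<times> 'c. case fst (snd s) of [] \<Rightarrow> s
    | y # ys \<Rightarrow> (fst s, ys, f (fst s) y (snd (snd s)))"
  let ?g = "\<lambda>x. (x, xs x, a x)"
  let ?h = "\<lambda>x. (x, [] :: 'b list, fold (f x) (xs x) (a x))"
  obtain q where q: "\<And>x. sz (xs x) \<le> poly q (sz x)" using pcf_sz[OF assms(1)] by blast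
  have "pcf tm ?h"
  proof (rule pcf_while[where c = ?c and f = ?f and g = ?g and B = "q + B + [:2, 1:]"])
    show "pcf tm ?f"
      by (intro pcf_intros pcf_app3[of tm f, OF assms(3)])
    fix x
    have it: "(?f ^^ i) (?g x) = (x, drop i (xs x), fold (f x) (take i (xs x)) (a x))"
      if "i \<le> length (xs x)" for i
      using that
    proof (induction i)
      case (Suc i)
      hence "drop i (xs x) = xs x ! i # drop (Suc i) (xs x)" by (simp add: Cons_nth_drop_Suc)
      thus ?case using Suc by (simp add: take_Suc_conv_app_nth)
    qed simp
    have sd: "sz (drop i (xs x)) \<le> sz (xs x)" for i
      using sz_append[of "take i (xs x)" "drop i (xs x)"] sz_pos[of "take i (xs x)"]
      unfolding append_take_drop_id by linarith
    show "\<exists>n. (\<forall>i<n. ?c ((?f ^^ i) (?g x))) \<and> \<not> ?c ((?f ^^ n) (?g x)) \<and> ?h x = (?f ^^ n) (?g x) \<and>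
        (\<forall>i\<le>n. sz ((?f ^^ i) (?g x)) \<le> poly (q + B + [:2, 1:]) (sz x)) \<and>
        (tm \<longrightarrow> n \<le> poly (q + B + [:2, 1:]) (sz x))"
    proof (intro exI[of _ "length (xs x)"] conjI allI impI)
      fix i assume i: "i \<le> length (xs x)"
      have "sz (fold (f x) (take i (xs x)) (a x)) \<le> poly B (sz x)"
        by (rule assms(4)[of x _ "drop i (xs x)"]) simp
      moreover have "sz (drop i (xs x)) \<le> poly q (sz x)" using sd q le_trans by blast
      ultimately show "sz ((?f ^^ i) (?g x)) \<le> poly (q + B + [:2, 1:]) (sz x)"
        by (subst it[OF i]) simp
    next
      fix i assume "i < length (xs x)"
      thus "?c ((?f ^^ i) (?g x))" by (subst it) auto
    next
      show "\<not> ?c ((?f ^^ length (xs x)) (?g x))" by (subst it) auto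
      show "?h x = (?f ^^ length (xs x)) (?g x)" by (subst it) auto
      show "length (xs x) \<le> poly (q + B + [:2, 1:]) (sz x)"
        using q[of x] length_le_sz[of "xs x"] by simp
    qed
  qed (intro pcf_intros assms)+
  from pcf_snd[OF pcf_snd[OF this]] show ?thesis by simp
qed

lemma fold_growth:
  assumes "\<And>y acc. y \<in> set ys \<Longrightarrow> sz (f y acc) \<le> sz acc + k"
  shows "sz (fold f ys a) \<le> sz a + length ys * k"
  using assms
proof (induction ys arbitrary: a)
  case (Cons y ys)
  have "sz (fold f ys (f y a)) \<le> sz (f y a) + length ys * k" using Cons by simp
  moreover have "sz (f y a) \<le> sz a + k" using Cons.prems by simp
  ultimately show ?case by simp
qed simp

text \<open>The increment may depend on the argument and on the list element but not on the
  accumulator, so the increments add up to a polynomial.\<close>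

lemma pcf_fold:
  fixes xs :: "'a::coded \<Rightarrow> 'b::coded list" and f :: "'a \<Rightarrow> 'b \<Rightarrow> 'c \<Rightarrow> 'c::coded"
  assumes "pcf tm xs" "pcf tm a" "pcf tm (\<lambda>z. f (fst z) (fst (snd z)) (snd (snd z)))"
    and "\<And>x y acc. y \<in> set (xs x) \<Longrightarrow> sz (f x y acc) \<le> sz acc + poly q (sz x + sz y)"
  shows "pcf tm (\<lambda>x. fold (f x) (xs x) (a x))"
proof -
  obtain qx qa where q: "\<And>x. sz (xs x) \<le> poly qx (sz x)" "\<And>x. sz (a x) \<le> poly qa (sz x)"
    using pcf_sz[OF assms(1)] pcf_sz[OF assms(2)] by blast
  show ?thesis
  proof (rule fold_bounded[OF assms(1-3), where B = "qa + qx * pcompose q ([:0, 1:] + qx)"])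
    fix x ys zs assume xs: "xs x = ys @ zs"
    have "sz (f x y acc) \<le> sz acc + poly q (sz x + poly qx (sz x))" if y: "y \<in> set ys" for y acc
    proof -
      have "sz y \<le> poly qx (sz x)" using sz_mem[of y "xs x"] q(1)[of x] y xs by simp
      hence "poly q (sz x + sz y) \<le> poly q (sz x + poly qx (sz x))" by (intro poly_nat_mono) simp
      thus ?thesis using assms(4)[of y x acc] y xs by simp
    qed
    hence "sz (fold (f x) ys (a x)) \<le> sz (a x) + length ys * poly q (sz x + poly qx (sz x))"
      by (rule fold_growth)
    also have "\<dots> \<le> poly qa (sz x) + poly qx (sz x) * poly q (sz x + poly qx (sz x))"
    proof -
      have "length ys \<le> poly qx (sz x)" using length_le_sz[of "xs x"] q(1)[of x] xs by simp
      thus ?thesis using q(2) by (intro add_mono mult_right_mono) auto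
    qed
    finally show "sz (fold (f x) ys (a x)) \<le> poly (qa + qx * pcompose q ([:0, 1:] + qx)) (sz x)"
      by (simp add: poly_pcompose)
  qed
qed

lemma pcf_rev [pcf_intros]:
  fixes xs :: "'a::coded \<Rightarrow> 'b::coded list"
  assumes "pcf tm xs"
  shows "pcf tm (\<lambda>x. rev (xs x))"
proof -
  have "pcf tm (\<lambda>x. fold (\<lambda>y acc. y # acc) (xs x) [])"
    by (rule pcf_fold[where q = "[:1, 1:]"]) (auto intro!: pcf_intros assms)
  thus ?thesis by (simp add: fold_Cons_rev)
qed

lemma pcf_foldr:
  fixes xs :: "'a::coded \<Rightarrow> 'b::coded list" and f :: "'a \<Rightarrow> 'b \<Rightarrow> 'c \<Rightarrow> 'c::coded"
  assumes "pcf tm xs" "pcf tm a" "pcf tm (\<lambda>z. f (fst z) (fst (snd z)) (snd (snd z)))"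
    and "\<And>x y acc. y \<in> set (xs x) \<Longrightarrow> sz (f x y acc) \<le> sz acc + poly q (sz x + sz y)"
  shows "pcf tm (\<lambda>x. foldr (f x) (xs x) (a x))"
  using pcf_fold[OF pcf_rev[OF assms(1)] assms(2,3), of q] assms(4) by (simp add: foldr_conv_fold)

lemma pcf_append [pcf_intros]:
  fixes xs ys :: "'a::coded \<Rightarrow> 'b::coded list"
  assumes "pcf tm xs" "pcf tm ys"
  shows "pcf tm (\<lambda>x. xs x @ ys x)"
proof -
  have "pcf tm (\<lambda>x. foldr (\<lambda>y acc. y # acc) (xs x) (ys x))"
    by (rule pcf_foldr[where q = "[:1, 1:]"]) (auto intro!: pcf_intros assms)
  moreover have "foldr (\<lambda>y acc. y # acc) us vs = us @ vs" for us vs :: "'b list"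
    by (induction us) auto
  ultimately show ?thesis by simp
qed

lemma pcf_map:
  fixes xs :: "'a::coded \<Rightarrow> 'b::coded list" and f :: "'a \<Rightarrow> 'b \<Rightarrow> 'c::coded"
  assumes "pcf tm xs" "pcf tm (\<lambda>z. f (fst z) (snd z))"
  shows "pcf tm (\<lambda>x. map (f x) (xs x))"
proof -
  obtain q where q: "\<And>z. sz (f (fst z) (snd z)) \<le> poly q (sz z)" using pcf_sz[OF assms(2)] by blast
  have "pcf tm (\<lambda>x. foldr (\<lambda>y acc. f x y # acc) (xs x) [])"
  proof (rule pcf_foldr[where q = "[:1:] + pcompose q [:1, 1:]"])
    show "pcf tm (\<lambda>z. f (fst z) (fst (snd z)) # snd (snd z))"
      by (intro pcf_intros pcf_app2[of tm f, OF assms(2)])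
    fix x y and acc :: "'c list"
    show "sz (f x y # acc) \<le> sz acc + poly ([:1:] + pcompose q [:1, 1:]) (sz x + sz y)"
      using q[of "(x, y)"] by (simp add: poly_pcompose)
  qed (intro pcf_intros assms)+
  moreover have "foldr (\<lambda>y acc. f x y # acc) us [] = map (f x) us" for x us by (induction us) auto
  ultimately show ?thesis by simp
qed

lemma pcf_concat [pcf_intros]:
  fixes xs :: "'a::coded \<Rightarrow> 'b::coded list list"
  assumes "pcf tm xs"
  shows "pcf tm (\<lambda>x. concat (xs x))"
proof -
  have "pcf tm (\<lambda>x. foldr (\<lambda>y acc. y @ acc) (xs x) [])"
  proof (rule pcf_foldr[where q = "[:0, 1:]"])
    fix x :: 'a and y acc :: "'b list"
    show "sz (y @ acc) \<le> sz acc + poly [:0, 1:] (sz x + sz y)"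
      using sz_append[of y acc] by simp
  qed (intro pcf_intros assms)+
  moreover have "foldr (\<lambda>y acc. y @ acc) us [] = concat us" for us :: "'b list list"
    by (induction us) auto
  ultimately show ?thesis by simp
qed

lemma pcf_list_all:
  fixes xs :: "'a::coded \<Rightarrow> 'b::coded list" and P :: "'a \<Rightarrow> 'b \<Rightarrow> bool"
  assumes "pcf tm xs" "pcf tm (\<lambda>z. P (fst z) (snd z))"
  shows "pcf tm (\<lambda>x. list_all (P x) (xs x))"
proof -
  have "pcf tm (\<lambda>x. foldr (\<lambda>y acc. P x y \<and> acc) (xs x) True)"
  proof (rule pcf_foldr[where q = "[:3:]"])
    show "pcf tm (\<lambda>z. P (fst z) (fst (snd z)) \<and> snd (snd z))"
      by (intro pcf_intros pcf_app2[of tm P, OF assms(2)])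
    fix x y acc
    show "sz (P x y \<and> acc) \<le> sz acc + poly [:3:] (sz x + sz y)" by (cases "P x y \<and> acc") auto
  qed (intro pcf_intros assms)+
  moreover have "foldr (\<lambda>y acc. P x y \<and> acc) us True = list_all (P x) us" for x us by (induction us) auto
  ultimately show ?thesis by simp
qed

lemma pcf_zip [pcf_intros]:
  fixes xs :: "'a::coded \<Rightarrow> 'b::coded list" and ys :: "'a \<Rightarrow> 'c::coded list"
  assumes "pcf tm xs" "pcf tm ys"
  shows "pcf tm (\<lambda>x. zip (xs x) (ys x))"
proof -
  let ?f = "\<lambda>y s :: 'c list \<times> ('b \<times> 'c) list. case fst s of [] \<Rightarrow> s | u # us \<Rightarrow> (us, (y, u) # snd s)"
  have "pcf tm (\<lambda>x. fold ?f (xs x) (ys x, []))"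
  proof (rule pcf_fold[where q = "[:2, 1:]"])
    fix x :: 'a and y :: 'b and s :: "'c list \<times> ('b \<times> 'c) list"
    show "sz (?f y s) \<le> sz s + poly [:2, 1:] (sz x + sz y)"
      by (cases s) (auto split: list.splits)
  qed (intro pcf_intros assms)+
  hence "pcf tm (\<lambda>x. rev (snd (fold ?f (xs x) (ys x, []))))" by (intro pcf_intros)
  moreover have "rev (snd (fold ?f us (vs, acc))) = rev acc @ zip us vs" for us vs acc
    by (induction us arbitrary: vs acc) (auto split: list.splits)
  ultimately show ?thesis by simp
qed

lemma pcf_bits_eq [pcf_intros]:
  fixes xs ys :: "'a::coded \<Rightarrow> bool list"
  assumes "pcf tm xs" "pcf tm ys"
  shows "pcf tm (\<lambda>x. xs x = ys x)"
proof -
  let ?f = "\<lambda>y s :: bool list \<times> bool. case fst s of [] \<Rightarrow> ([], False) | u # us \<Rightarrow> (us, snd s \<and> y = u)"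
  have "pcf tm (\<lambda>x. fold ?f (xs x) (ys x, True))"
  proof (rule pcf_fold[where q = "[:5:]"])
    fix x :: 'a and y :: bool and s :: "bool list \<times> bool"
    show "sz (?f y s) \<le> sz s + poly [:5:] (sz x + sz y)"
      by (cases s) (auto simp: code_bool_def split: list.splits)
  qed (intro pcf_intros assms)+
  hence "pcf tm (\<lambda>x. fst (fold ?f (xs x) (ys x, True)) = [] \<and> snd (fold ?f (xs x) (ys x, True)))"
    by (intro pcf_intros)
  moreover have "(fst (fold ?f us (vs, b)) = [] \<and> snd (fold ?f us (vs, b))) = (b \<and> us = vs)" for us vs b
  proof (induction us arbitrary: vs b)
    case (Cons u us)
    have F: "\<not> snd (fold ?f us (ws, False))" for ws
      using Cons.IH[of ws False] by (induction us arbitrary: ws) (auto split: list.splits)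
    show ?case using Cons.IH F by (auto split: list.splits)
  qed auto
  ultimately show ?thesis by simp
qed

text \<open>Numbers are handled in unary, as lengths of lists; this is the form in which positions
  inside a vertex are computed.\<close>

lemma pcf_split:
  fixes n :: "'a::coded \<Rightarrow> 'b::coded list" and xs :: "'a \<Rightarrow> 'c::coded list"
  assumes "pcf tm n" "pcf tm xs"
  shows "pcf tm (\<lambda>x. take (length (n x)) (xs x))" "pcf tm (\<lambda>x. drop (length (n x)) (xs x))"
proof -
  let ?f = "\<lambda>y :: 'b. \<lambda>s :: 'c list \<times> 'c list. case fst s of [] \<Rightarrow> s | u # us \<Rightarrow> (us, u # snd s)"
  have f: "pcf tm (\<lambda>x. fold ?f (n x) (xs x, []))"
  proof (rule pcf_fold[where q = "[:5:]"])
    fix x :: 'a and y :: 'b and s :: "'c list \<times> 'c list"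
    show "sz (?f y s) \<le> sz s + poly [:5:] (sz x + sz y)" by (cases s) (auto split: list.splits)
  qed (intro pcf_intros assms)+
  have *: "fold ?f k (us, acc) = (drop (length k) us, rev (take (length k) us) @ acc)" for k us acc
    by (induction k arbitrary: us acc) (auto split: list.splits)
  show "pcf tm (\<lambda>x. drop (length (n x)) (xs x))" using pcf_fst[OF f] by (simp add: *)
  show "pcf tm (\<lambda>x. take (length (n x)) (xs x))" using pcf_rev[OF pcf_snd[OF f]] by (simp add: *)
qed

subsection \<open>Machines from computable functions\<close>

text \<open>The code of a list has to be pushed from its end. Pouring the input into register 2
  brings its last bit to the top, so that the bits come in the required order.\<close>

definition load :: prog where
  "load = pour 0 2 ;; Push 1 False ;; Loop 2 None (Cond 2 (Some True)
    (Pop 2 ;; Push 1 False ;; Push 1 False ;; Push 1 True ;; Push 1 True)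
    (Pop 2 ;; Push 1 False ;; Push 1 True))"

lemma sz_bits: "sz (x :: bool list) \<le> 4 * length x + 1"
  by (induction x) (auto simp: code_bool_def)

lemma xruns_load: "xruns tm (4 * length x + 2) load (init_store x) (30 * length x + 30) (mk (code x))"
proof -
  let ?m = "4 * length x + 2"
  let ?L = "Loop 2 None (Cond 2 (Some True)
    (Pop 2 ;; Push 1 False ;; Push 1 False ;; Push 1 True ;; Push 1 True)
    (Pop 2 ;; Push 1 False ;; Push 1 True))"
  have L: "runs ?m ?L (regs (code y) (rev z) [] []) (15 * length z + 1) (mk (code (z @ y)))"
    if "length y + length z = length x" for y z
    using that
  proof (induction z arbitrary: y rule: rev_induct)
    case Nil
    show ?case by (auto intro!: runs_mono[OF runs_LoopF] simp: top_bit_def)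
  next
    case (snoc b z)
    have s: "sz y + 3 < ?m" using sz_bits[of y] snoc.prems by simp
    have 1: "runs ?m (Cond 2 (Some True)
      (Pop 2 ;; Push 1 False ;; Push 1 False ;; Push 1 True ;; Push 1 True)
      (Pop 2 ;; Push 1 False ;; Push 1 True)) (regs (code y) (b # rev z) [] []) 11
      (regs (code (b # y)) (rev z) [] [])"
    proof (cases b)
      case True
      have "runs ?m (Pop 2 ;; Push 1 False ;; Push 1 False ;; Push 1 True ;; Push 1 True)
        (regs (code y) (b # rev z) [] []) (1 + (2 + (2 + (2 + 2)))) (regs (code (b # y)) (rev z) [] [])"
        using s True by (intro runs_Pop_Seq runs_Push_Seq runs_Push) auto
      thus ?thesis using True
        by (intro runs_mono[OF runs_CondT[where t = "1 + (2 + (2 + (2 + 2)))"] order_refl]) (auto simp: top_bit_def)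
    next
      case False
      have "runs ?m (Pop 2 ;; Push 1 False ;; Push 1 True)
        (regs (code y) (b # rev z) [] []) (1 + (2 + 2)) (regs (code (b # y)) (rev z) [] [])"
        using s False by (intro runs_Pop_Seq runs_Push_Seq runs_Push) auto
      hence "runs ?m (Pop 2 ;; Push 1 False ;; Push 1 True)
        (regs (code y) (b # rev z) [] []) 9 (regs (code (b # y)) (rev z) [] [])" by (rule runs_mono) auto
      thus ?thesis using False
        by (intro runs_mono[OF runs_CondF[where t = 9] order_refl]) (auto simp: top_bit_def)
    qed
    have "runs ?m ?L (regs (code (b # y)) (rev z) [] []) (15 * length z + 1) (mk (code (z @ b # y)))"
      using snoc.prems by (intro snoc.IH) auto
    hence "runs ?m ?L (regs (code y) (b # rev z) [] []) (11 + (15 * length z + 1) + 2) (mk (code (z @ b # y)))"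
      by (intro runs_LoopT[OF _ 1]) (auto simp: top_bit_def)
    thus ?case by (auto elim: runs_mono)
  qed
  have P: "runs ?m (pour 0 2) (init_store x) (7 * length x + 1) (regs [] (rev x) [] [])"
    using runs_pour[of 0 2 "init_store x" ?m "regs [] (rev x) [] []"]
    by (auto simp: init_store_def fun_eq_iff regs_def)
  have "runs ?m load (init_store x) ((7 * length x + 1) + (2 + (15 * length x + 1))) (mk (code x))"
    unfolding load_def using L[of "[]" x] by (intro runs_Seq[OF P] runs_Push_Seq) auto
  thus ?thesis by (intro xruns_runs) (auto elim: runs_mono)
qed

lemma wf_load [simp]: "wf_prog load" by (simp add: load_def pour_def)

text \<open>The composition with \<open>[:1, 4:]\<close> reflects that an input of length n has a
  list code of at most 4 n + 1 bits; the summand \<open>[:40, 40:]\<close> pays for loading.\<close>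

lemma implements_load:
  fixes f :: "bool list \<Rightarrow> 'b::coded"
  assumes "implements tm p q f"
  defines "r \<equiv> pcompose q [:1, 4:] + [:40, 40:]"
  shows "xruns tm (poly r (length x)) (load ;; p) (init_store x) (poly r (length x)) (mk (code (f x)))"
proof -
  have le: "poly q (sz x) \<le> poly q (1 + 4 * length x)" using sz_bits[of x] by (intro poly_nat_mono) auto
  have "xruns tm (poly r (length x)) (load ;; p) (init_store x) ((30 * length x + 30) + poly q (sz x)) (mk (code (f x)))"
    using le by (intro xruns_Seq[OF xruns_mono[OF xruns_load] xruns_impl[OF assms(1), of "[]", simplified]])
      (auto simp: r_def poly_pcompose mult.commute)
  thus ?thesis by (rule xruns_mono) (use le in \<open>auto simp: r_def poly_pcompose mult.commute\<close>)
qed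

theorem pcf_PSPACE:
  assumes "pcf False (P :: bool list \<Rightarrow> bool)"
  shows "{x. P x} \<in> PSPACE"
proof -
  obtain p q where p: "implements False p q P" using assms unfolding pcf_def by blast
  define r where "r = pcompose q [:1, 4:] + [:40, 40:]"
  have wf: "wf_prog (load ;; p)" using implementsD(1)[OF p] by simp
  have run: "\<exists>n. fst (run (machine (load ;; p)) x n) = (if P x then 1 else 2) \<and>
      (\<forall>t. heads_below (poly r (length x)) (run (machine (load ;; p)) x t))" for x
  proof -
    obtain n where n: "exec (poly r (length x)) (load ;; p) (init_store x) n (mk (code (P x)))"
      using implements_load[OF p, of x] unfolding xruns_def r_def by blast
    have "length x \<le> poly r (length x)" by (simp add: r_def)
    from machine_run[OF wf n this] show ?thesis
      by (intro exI[of _ "Suc n"]) (auto simp: top_bit_def code_bool_def)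
  qed
  show ?thesis unfolding PSPACE_def
  proof (intro CollectI exI[of _ "machine (load ;; p)"] exI[of _ "r + 1"] conjI)
    show "is_tm (machine (load ;; p))" by (rule is_tm_machine[OF wf])
    show "decides (machine (load ;; p)) {x. P x}" unfolding decides_def using run by fastforce
    \<comment> \<open>\<open>heads_below\<close> admits its bound while \<open>runs_in_space\<close>
      is strict, hence the summand 1.\<close>
    show "runs_in_space (machine (load ;; p)) (poly (r + 1))"
      unfolding runs_in_space_def
    proof (intro allI ballI)
      fix x t ch assume "ch \<in> set (snd (run (machine (load ;; p)) x t))"
      thus "case ch of (c, h) \<Rightarrow> h < poly (r + 1) (length x)"
        using run[of x] by (fastforce simp: heads_below_def)
    qed
  qed
qed

text \<open>The loop writes the bits from left to right as they come off the stack. The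
  \<open>True\<close> left on register 1 makes the machine halt in the accepting state, which is
  required of a machine that computes a function.\<close>

definition store_prog :: prog where
  "store_prog = Loop 1 (Some False) (Pop 1 ;; Cond 1 (Some True)
     (Pop 1 ;; Pop 1 ;; Pop 1 ;; Push 5 True) (Pop 1 ;; Push 5 False)) ;; Pop 1 ;; Push 1 True"

lemma runs_store: "runs (sz y + 1) store_prog (mk (code y)) (20 * sz y + 20) ((\<lambda>_. [])(1 := [True], 5 := rev y))"
proof -
  let ?L = "Loop 1 (Some False) (Pop 1 ;; Cond 1 (Some True)
     (Pop 1 ;; Pop 1 ;; Pop 1 ;; Push 5 True) (Pop 1 ;; Push 5 False))"
  have L: "runs (length z + sz y + 1) ?L ((mk (code y))(5 := z)) (12 * length y + 1) ((mk [False])(5 := rev y @ z))" for z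
  proof (induction y arbitrary: z)
    case Nil
    show ?case by (auto intro!: runs_mono[OF runs_LoopF] simp: top_bit_def)
  next
    case (Cons b y)
    let ?m = "length z + sz (b # y) + 1"
    have 1: "runs ?m (Pop 1 ;; Cond 1 (Some True)
       (Pop 1 ;; Pop 1 ;; Pop 1 ;; Push 5 True) (Pop 1 ;; Push 5 False)) ((mk (code (b # y)))(5 := z)) 10
       ((mk (code y))(5 := b # z))"
    proof (cases b)
      case True
      have "runs ?m (Pop 1 ;; Cond 1 (Some True)
       (Pop 1 ;; Pop 1 ;; Pop 1 ;; Push 5 True) (Pop 1 ;; Push 5 False)) ((mk (code (b # y)))(5 := z))
       (1 + (1 + (1 + (1 + 2)) + 2)) ((mk (code y))(5 := b # z))"
        using True by (intro runs_Pop_Seq runs_CondT runs_Push) (auto simp: top_bit_def regs_def fun_eq_iff)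
      thus ?thesis by (rule runs_mono) auto
    next
      case False
      have "runs ?m (Pop 1 ;; Cond 1 (Some True)
       (Pop 1 ;; Pop 1 ;; Pop 1 ;; Push 5 True) (Pop 1 ;; Push 5 False)) ((mk (code (b # y)))(5 := z))
       (1 + ((1 + 2) + 2)) ((mk (code y))(5 := b # z))"
        using False by (intro runs_Pop_Seq runs_CondF runs_Push) (auto simp: top_bit_def regs_def fun_eq_iff)
      thus ?thesis by (rule runs_mono) auto
    qed
    have "rev y @ b # z = rev (b # y) @ z" by simp
    note IH = Cons[of "b # z", unfolded this]
    have "runs ?m ?L ((mk (code y))(5 := b # z)) (12 * length y + 1) ((mk [False])(5 := rev (b # y) @ z))"
      using sz_pos[of b] by (intro runs_mono[OF IH]) auto
    hence "runs ?m ?L ((mk (code (b # y)))(5 := z)) (10 + (12 * length y + 1) + 2) ((mk [False])(5 := rev (b # y) @ z))"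
      by (intro runs_LoopT[OF _ 1]) (auto simp: top_bit_def)
    thus ?case by (rule runs_mono) auto
  qed
  have e: "(mk (code y))(5 := []) = mk (code y)" by (auto simp: regs_def fun_eq_iff)
  have "runs (sz y + 1) store_prog (mk (code y)) ((12 * length y + 1) + (1 + 2)) ((\<lambda>_. [])(1 := [True], 5 := rev y))"
    unfolding store_prog_def
  proof (rule runs_Seq)
    show "runs (sz y + 1) ?L (mk (code y)) (12 * length y + 1) ((mk [False])(5 := rev y))"
      using L[of "[]"] by (simp only: e append_Nil2 list.size add_0)
    show "runs (sz y + 1) (Pop 1 ;; Push 1 True) ((mk [False])(5 := rev y)) (1 + 2) ((\<lambda>_. [])(1 := [True], 5 := rev y))"
      by (intro runs_Pop_Seq runs_Push) (auto simp: regs_def fun_eq_iff)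
  qed
  thus ?thesis by (rule runs_mono) (use length_le_sz[of y] in auto)
qed

theorem pcf_poly_time_computable:
  assumes "pcf True (f :: bool list \<Rightarrow> bool list)"
  shows "poly_time_computable f"
proof -
  obtain p q where p: "implements True p q f" using assms unfolding pcf_def by blast
  define r where "r = pcompose q [:1, 4:] + [:40, 40:]"
  define r' where "r' = smult 20 (pcompose q [:1, 4:]) + r + [:30:]"
  let ?P = "(load ;; p) ;; store_prog"
  have wf: "wf_prog ?P" using implementsD(1)[OF p] by (simp add: store_prog_def)
  have run: "\<exists>t \<le> poly (r' + 1) (length x). fst (run (machine ?P) x t) = 1 \<and>
      fst (last (snd (run (machine ?P) x t))) = tape_content (f x)" for x
  proof -
    have "poly q (sz x) \<le> poly q (1 + 4 * length x)" using sz_bits[of x] by (intro poly_nat_mono) auto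
    hence fx: "sz (f x) \<le> poly q (1 + 4 * length x)" using implements_sz[OF p, of x] by simp
    have "xruns True (poly r' (length x)) ?P (init_store x) (poly r (length x) + (20 * sz (f x) + 20))
      ((\<lambda>_. [])(1 := [True], 5 := rev (f x)))"
      by (rule xruns_Seq[OF xruns_mono[OF implements_load[OF p]] xruns_mono[OF xruns_runs[OF runs_store]]])
        (use fx in \<open>auto simp: r_def r'_def poly_pcompose mult.commute\<close>)
    then obtain n where n: "exec (poly r' (length x)) ?P (init_store x) n ((\<lambda>_. [])(1 := [True], 5 := rev (f x)))"
      "n \<le> poly r (length x) + (20 * sz (f x) + 20)"
      unfolding xruns_def by auto
    have "length x \<le> poly r' (length x)" by (simp add: r'_def r_def)
    from machine_run[OF wf n(1) this] obtain ts where
      ts: "rep (length x) ((\<lambda>_. [])(1 := [True], 5 := rev (f x))) ts"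
      "run (machine ?P) x (Suc n) = (1, ts)" by (auto simp: top_bit_def)
    have "tape_rep (length x) 5 (rev (f x)) (ts ! 5)" "length ts = 6"
      using ts(1) unfolding rep_def by (auto dest!: spec[of _ 5])
    moreover from this(2) have "last ts = ts ! 5" by (subst last_conv_nth) auto
    ultimately have "fst (last ts) = tape_content (f x)" by (cases "ts ! 5") auto
    \<comment> \<open>The summand 1 is the step in which the verdict is read after the
      program.\<close>
    moreover have "Suc n \<le> poly (r' + 1) (length x)"
      using n(2) fx by (simp add: r'_def poly_pcompose mult.commute)
    ultimately show ?thesis using ts(2) by fastforce
  qed
  show ?thesis unfolding poly_time_computable_def computes_in_time_def
    using is_tm_machine[OF wf] run by blast
qed


section \<open>Games and reachability in polynomial space\<close>

text \<open>
  In a string of quantifiers \<open>True\<close> stands for a universal and \<open>False\<close> for an existential bit. The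
  bits chosen so far, each with its quantifier, are kept latest first.
\<close>

fun ev :: "((bool \<times> bool) list \<Rightarrow> bool) \<Rightarrow> bool list \<Rightarrow> (bool \<times> bool) list \<Rightarrow> bool" where
  "ev R [] st = R st"
| "ev R (q # qs) st =
    (if q then ev R qs ((q, False) # st) \<and> ev R qs ((q, True) # st)
     else ev R qs ((q, False) # st) \<or> ev R qs ((q, True) # st))"

type_synonym 'a game = "'a \<times> bool list \<times> (bool \<times> bool) list \<times> bool \<times> bool"

text \<open>
  Depth-first evaluation. With short-circuiting, the stack of chosen bits is all that has to be
  remembered: the second branch is visited only if the first one returned the neutral value.
\<close>

definition gstep :: "('a \<Rightarrow> (bool \<times> bool) list \<Rightarrow> bool) \<Rightarrow> 'a game \<Rightarrow> 'a game" where
  "gstep R s = (case s of (x, qs, st, r, v) \<Rightarrow>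
    if r then (case st of [] \<Rightarrow> s
      | p # st' \<Rightarrow> if \<not> snd p \<and> v = fst p then (x, qs, (fst p, True) # st', False, v)
                  else (x, fst p # qs, st', True, v))
    else (case qs of [] \<Rightarrow> (x, [], st, True, R x st)
      | q # qs' \<Rightarrow> (x, qs', (q, False) # st, False, v)))"

definition gcont :: "'a game \<Rightarrow> bool" where
  "gcont s = (case s of (x, qs, st, r, v) \<Rightarrow> \<not> (r \<and> st = []))"

definition ginv :: "'a \<Rightarrow> nat \<Rightarrow> 'a game \<Rightarrow> bool" where
  "ginv x M s = (case s of (y, qs, st, r, v) \<Rightarrow> y = x \<and> length qs + length st \<le> M)"

inductive gpath :: "('a \<Rightarrow> (bool \<times> bool) list \<Rightarrow> bool) \<Rightarrow> 'a \<Rightarrow> nat \<Rightarrow> 'a game \<Rightarrow> 'a game \<Rightarrow> bool"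
  for R x M where
  refl: "ginv x M s \<Longrightarrow> gpath R x M s s"
| step: "ginv x M s \<Longrightarrow> gcont s \<Longrightarrow> gpath R x M (gstep R s) s' \<Longrightarrow> gpath R x M s s'"

lemma gpath_trans: "gpath R x M s s' \<Longrightarrow> gpath R x M s' s'' \<Longrightarrow> gpath R x M s s''"
  by (induction rule: gpath.induct) (auto intro: gpath.step)

lemma gpath_step: "ginv x M s \<Longrightarrow> gcont s \<Longrightarrow> gstep R s = s1 \<Longrightarrow> gpath R x M s1 s' \<Longrightarrow> gpath R x M s s'"
  by (simp add: gpath.step)

text \<open>Induction on the remaining quantifiers: evaluating a suffix returns with the stack as it
  was found. For either quantifier the value that leaves the outcome open equals the quantifier bit
  itself, so a single comparison decides whether the second branch is visited.\<close>

lemma gpath_ev: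
  "length qs + length st \<le> M \<Longrightarrow> gpath R x M (x, qs, st, False, v) (x, qs, st, True, ev (R x) qs st)"
proof (induction qs arbitrary: st v)
  case Nil
  show ?case
    by (rule gpath_step[OF _ _ _ gpath.refl]) (use Nil in \<open>auto simp: ginv_def gcont_def gstep_def\<close>)
next
  case (Cons q qs)
  let ?v = "ev (R x) qs ((q, False) # st)" and ?w = "ev (R x) qs ((q, True) # st)"
  have 1: "gpath R x M (x, q # qs, st, False, v) (x, qs, (q, False) # st, True, ?v)"
    by (rule gpath_step[OF _ _ _ Cons.IH[of "(q, False) # st"]])
      (use Cons.prems in \<open>auto simp: ginv_def gcont_def gstep_def\<close>)
  show ?case
  proof (cases "?v = q")
    case True
    have 2: "gpath R x M (x, qs, (q, False) # st, True, ?v) (x, qs, (q, True) # st, True, ?w)"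
      by (rule gpath_step[OF _ _ _ Cons.IH[of "(q, True) # st" ?v]])
        (use Cons.prems True in \<open>auto simp: ginv_def gcont_def gstep_def\<close>)
    have 3: "gpath R x M (x, qs, (q, True) # st, True, ?w) (x, q # qs, st, True, ?w)"
      by (rule gpath_step[OF _ _ _ gpath.refl])
        (use Cons.prems in \<open>auto simp: ginv_def gcont_def gstep_def\<close>)
    have e: "ev (R x) (q # qs) st = ?w" using True by auto
    show ?thesis unfolding e by (rule gpath_trans[OF 1 gpath_trans[OF 2 3]])
  next
    case False
    have 2: "gpath R x M (x, qs, (q, False) # st, True, ?v) (x, q # qs, st, True, ?v)"
      by (rule gpath_step[OF _ _ _ gpath.refl])
        (use Cons.prems False in \<open>auto simp: ginv_def gcont_def gstep_def\<close>)
    have e: "ev (R x) (q # qs) st = ?v" using False by auto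
    show ?thesis unfolding e by (rule gpath_trans[OF 1 2])
  qed
qed

lemma gpath_funpow:
  "gpath R x M s s' \<Longrightarrow> \<exists>n. (\<forall>i<n. gcont ((gstep R ^^ i) s)) \<and> s' = (gstep R ^^ n) s \<and>
    (\<forall>i\<le>n. ginv x M ((gstep R ^^ i) s))"
proof (induction rule: gpath.induct)
  case (refl s)
  thus ?case by (intro exI[of _ 0]) auto
next
  case (step s s')
  then obtain n where n: "\<forall>i<n. gcont ((gstep R ^^ i) (gstep R s))" "s' = (gstep R ^^ n) (gstep R s)"
    "\<forall>i\<le>n. ginv x M ((gstep R ^^ i) (gstep R s))" by blast
  have sw: "(gstep R ^^ Suc i) s = (gstep R ^^ i) (gstep R s)" for i by (simp add: funpow_swap1)
  show ?case
  proof (intro exI[of _ "Suc n"] conjI allI impI)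
    fix i assume "i < Suc n"
    thus "gcont ((gstep R ^^ i) s)" using n(1) step(2) by (cases i) (auto simp: sw simp del: funpow.simps(2))
  next
    fix i assume "i \<le> Suc n"
    thus "ginv x M ((gstep R ^^ i) s)" using n(3) step(1) by (cases i) (auto simp: sw simp del: funpow.simps(2))
  qed (use n(2) sw in simp)
qed

lemma sz_bit: "sz (b :: bool) \<le> 3"
  by (cases b) auto

lemma sz_choices: "sz (st :: (bool \<times> bool) list) \<le> 8 * length st + 1"
proof (induction st)
  case (Cons p st)
  have "sz p \<le> 7" using sz_bit[of "fst p"] sz_bit[of "snd p"] by (simp add: code_prod_def)
  thus ?case using Cons by simp
qed simp

text \<open>The evaluation may take exponentially many rounds, but \<open>ginv\<close> keeps the
  pending and the decided quantifiers together no longer than the quantifier string.\<close>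

theorem pcf_game:
  fixes R :: "'a::coded \<Rightarrow> (bool \<times> bool) list \<Rightarrow> bool"
  assumes "pcf False (\<lambda>z. R (fst z) (snd z))" "pcf False qs"
  shows "pcf False (\<lambda>x. ev (R x) (qs x) [])"
proof -
  obtain q where q: "\<And>x. sz (qs x) \<le> poly q (sz x)" using pcf_sz[OF assms(2)] by blast
  have "pcf False (\<lambda>x. (x, qs x, [] :: (bool \<times> bool) list, True, ev (R x) (qs x) []))"
  proof (rule pcf_while[where c = gcont and f = "gstep R" and g = "\<lambda>x. (x, qs x, [], False, False)"
        and B = "smult 8 q + [:20, 1:]"])
    show "pcf False (gcont :: 'a game \<Rightarrow> bool)" unfolding gcont_def by (intro pcf_intros)
    show "pcf False (gstep R)" unfolding gstep_def by (intro pcf_intros pcf_app2[OF assms(1)])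
    show "pcf False (\<lambda>x. (x, qs x, [] :: (bool \<times> bool) list, False, False))" by (intro pcf_intros assms)
    fix x
    have "gpath R x (length (qs x)) (x, qs x, [], False, False) (x, qs x, [], True, ev (R x) (qs x) [])"
      by (rule gpath_ev) simp
    from gpath_funpow[OF this] obtain n where
      n: "\<forall>i<n. gcont ((gstep R ^^ i) (x, qs x, [], False, False))"
      "(x, qs x, [], True, ev (R x) (qs x) []) = (gstep R ^^ n) (x, qs x, [], False, False)"
      "\<forall>i\<le>n. ginv x (length (qs x)) ((gstep R ^^ i) (x, qs x, [], False, False))" by blast
    have size: "sz s \<le> poly (smult 8 q + [:20, 1:]) (sz x)" if inv: "ginv x (length (qs x)) s" for s :: "'a game"
    proof -
      obtain us st r v where s: "s = (x, us, st, r, v)" "length us + length st \<le> length (qs x)"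
        using inv by (cases s) (auto simp: ginv_def)
      have "length (qs x) \<le> poly q (sz x)" using length_le_sz[of "qs x"] q[of x] by simp
      thus ?thesis using s sz_bits[of us] sz_choices[of st] sz_bit[of r] sz_bit[of v] by simp
    qed
    show "\<exists>n. (\<forall>i<n. gcont ((gstep R ^^ i) (x, qs x, [], False, False))) \<and>
      \<not> gcont ((gstep R ^^ n) (x, qs x, [], False, False)) \<and>
      (x, qs x, [], True, ev (R x) (qs x) []) = (gstep R ^^ n) (x, qs x, [], False, False) \<and>
      (\<forall>i\<le>n. sz ((gstep R ^^ i) (x, qs x, [], False, False)) \<le> poly (smult 8 q + [:20, 1:]) (sz x)) \<and>
      (False \<longrightarrow> n \<le> poly (smult 8 q + [:20, 1:]) (sz x))"
      using n size by (intro exI[of _ n]) (auto simp: n(2)[symmetric] gcont_def)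
  qed
  from pcf_snd[OF pcf_snd[OF pcf_snd[OF pcf_snd[OF this]]]] show ?thesis by simp
qed

text \<open>
  Savitch's theorem as a game: the existential player names a midpoint as a block of \<open>w\<close> bits, the
  universal player picks one half.
\<close>

fun midpoint :: "bool \<times> bool \<Rightarrow> bool list \<times> bool list \<times> bool list \<Rightarrow> bool list \<times> bool list \<times> bool list" where
  "midpoint (q, b) (P, Q, M) = (if q then (if b then (M, Q, []) else (P, M, [])) else (P, Q, b # M))"

fun reach_in :: "(bool list \<Rightarrow> bool list \<Rightarrow> bool) \<Rightarrow> nat \<Rightarrow> nat \<Rightarrow> bool list \<Rightarrow> bool list \<Rightarrow> bool" where
  "reach_in E w 0 P Q \<longleftrightarrow> P = Q \<or> E P Q"
| "reach_in E w (Suc d) P Q \<longleftrightarrow> (\<exists>M. length M = w \<and> reach_in E w d P M \<and> reach_in E w d M Q)"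

text \<open>The bit chosen first lies deepest, so it is the last one of the word
  \<open>M\<close>.\<close>

lemma ev_exists:
  "ev R (replicate k False @ qs) st = (\<exists>M. length M = k \<and> ev R qs (map (Pair False) M @ st))"
proof (induction k arbitrary: st)
  case (Suc k)
  have "(\<exists>b M. length M = k \<and> ev R qs (map (Pair False) M @ (False, b) # st)) =
    (\<exists>M. length M = Suc k \<and> ev R qs (map (Pair False) M @ st))" (is "?L = ?R")
  proof
    assume ?L
    then obtain b M where "length M = k" "ev R qs (map (Pair False) M @ (False, b) # st)" by blast
    thus ?R by (intro exI[of _ "M @ [b]"]) auto
  next
    assume ?R
    then obtain M where M: "length M = Suc k" "ev R qs (map (Pair False) M @ st)" by blast
    moreover from M(1) obtain b M' where "M = M' @ [b]" by (cases M rule: rev_cases) auto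
    ultimately show ?L by (intro exI[of _ b] exI[of _ M']) auto
  qed
  moreover have "ev R (replicate (Suc k) False @ qs) st =
    (\<exists>b M. length M = k \<and> ev R qs (map (Pair False) M @ (False, b) # st))"
    by (auto simp: Suc ex_bool_eq)
  ultimately show ?case by simp
qed simp

lemma foldr_midpoint:
  "foldr midpoint st init = (P, Q, []) \<Longrightarrow> foldr midpoint (map (Pair False) M @ st) init = (P, Q, M)"
  by (induction M) auto

lemma ev_reach_in:
  assumes "foldr midpoint st init = (P, Q, [])"
  shows "ev (\<lambda>st. case foldr midpoint st init of (P, Q, _) \<Rightarrow> P = Q \<or> E P Q)
    (concat (replicate d (replicate w False @ [True]))) st = reach_in E w d P Q"
  using assms
proof (induction d arbitrary: st P Q)
  case (Suc d)
  let ?R = "\<lambda>st. case foldr midpoint st init of (P, Q, _) \<Rightarrow> P = Q \<or> E P Q"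
  let ?qs = "concat (replicate d (replicate w False @ [True]))"
  have "foldr midpoint ((True, False) # map (Pair False) M @ st) init = (P, M, [])"
    "foldr midpoint ((True, True) # map (Pair False) M @ st) init = (M, Q, [])" for M
    using foldr_midpoint[OF Suc.prems, of M] by auto
  from this[THEN Suc.IH]
  have "ev ?R (True # ?qs) (map (Pair False) M @ st) = (reach_in E w d P M \<and> reach_in E w d M Q)" for M
    by simp
  moreover have "concat (replicate (Suc d) (replicate w False @ [True])) = replicate w False @ True # ?qs" by simp
  ultimately show ?case by (simp only: ev_exists reach_in.simps)
qed simp

definition graph :: "nat \<Rightarrow> (bool list \<Rightarrow> bool list \<Rightarrow> bool) \<Rightarrow> (bool list \<times> bool list) set" where
  "graph w E = {(P, Q). length P = w \<and> length Q = w \<and> E P Q}"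

lemma graph_relpow_length: "(P, Q) \<in> graph w E ^^ n \<Longrightarrow> length P = w \<Longrightarrow> length Q = w"
  by (cases n) (auto simp: graph_def)

lemma reach_in_iff:
  assumes "length P = w" "length Q = w"
  shows "reach_in E w d P Q \<longleftrightarrow> (\<exists>n \<le> 2 ^ d. (P, Q) \<in> graph w E ^^ n)"
  using assms
proof (induction d arbitrary: P Q)
  case 0
  have "reach_in E w 0 P Q \<longleftrightarrow> (P, Q) \<in> graph w E ^^ 0 \<or> (P, Q) \<in> graph w E ^^ 1"
    using 0 by (auto simp: graph_def)
  thus ?case by (auto simp: le_Suc_eq)
next
  case (Suc d)
  show ?case
  proof
    assume "reach_in E w (Suc d) P Q"
    then obtain M where M: "length M = w" "reach_in E w d P M" "reach_in E w d M Q" by auto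
    then obtain a b where "a \<le> 2 ^ d" "(P, M) \<in> graph w E ^^ a" "b \<le> 2 ^ d" "(M, Q) \<in> graph w E ^^ b"
      using Suc by blast
    thus "\<exists>n\<le>2 ^ Suc d. (P, Q) \<in> graph w E ^^ n"
      by (intro exI[of _ "a + b"]) (auto simp: relpow_add)
  next
    assume "\<exists>n\<le>2 ^ Suc d. (P, Q) \<in> graph w E ^^ n"
    then obtain n where n: "n \<le> 2 ^ Suc d" "(P, Q) \<in> graph w E ^^ n" by blast
    \<comment> \<open>This cut leaves both parts within the bound \<open>2 ^ d\<close> even for a
      path that is itself shorter than that.\<close>
    define a where "a = min n (2 ^ d)"
    have a: "a \<le> 2 ^ d" "n - a \<le> 2 ^ d" "a + (n - a) = n" using n(1) by (auto simp: a_def)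
    have "(P, Q) \<in> graph w E ^^ a O graph w E ^^ (n - a)"
      unfolding relpow_add[symmetric] a(3) by (rule n(2))
    then obtain M where M: "(P, M) \<in> graph w E ^^ a" "(M, Q) \<in> graph w E ^^ (n - a)" by blast
    have "length M = w" using graph_relpow_length[OF M(1)] Suc.prems by simp
    moreover from this have "reach_in E w d P M" "reach_in E w d M Q" using Suc M a by blast+
    ultimately show "reach_in E w (Suc d) P Q" by auto
  qed
qed

text \<open>The depth \<open>2 * w\<close> comes from counting edges instead of vertices: no path
  has to be longer than the number of edges, which is at most \<open>2 ^ (2 * w)\<close>.\<close>

lemma reach_in_rtrancl:
  assumes "length P = w" "length Q = w"
  shows "reach_in E w (2 * w) P Q \<longleftrightarrow> (P, Q) \<in> (graph w E)\<^sup>*"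
proof -
  let ?L = "{xs :: bool list. length xs = w}"
  have L: "finite ?L" "card ?L = 2 ^ w"
    using finite_lists_length_eq[of "UNIV :: bool set" w] card_lists_length_eq[of "UNIV :: bool set" w] by auto
  have sub: "graph w E \<subseteq> ?L \<times> ?L" by (auto simp: graph_def)
  hence fin: "finite (graph w E)" using L(1) finite_subset by blast
  have "card (graph w E) \<le> card (?L \<times> ?L)" using sub L(1) by (intro card_mono) auto
  also have "\<dots> = 2 ^ (2 * w)" by (simp add: card_cartesian_product L(2) power_add mult_2)
  finally have c: "card (graph w E) \<le> 2 ^ (2 * w)" .
  have "(graph w E)\<^sup>* = (\<Union>n\<in>{n. n \<le> card (graph w E)}. graph w E ^^ n)"
    by (rule rtrancl_finite_eq_relpow[OF fin])
  hence "(P, Q) \<in> (graph w E)\<^sup>* \<longleftrightarrow> (\<exists>n \<le> 2 ^ (2 * w). (P, Q) \<in> graph w E ^^ n)"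
    using c by (auto intro: order_trans relpow_imp_rtrancl)
  thus ?thesis using reach_in_iff[OF assms] by simp
qed

text \<open>The width is given in unary, so the quantifier string, \<open>2 * w\<close> blocks of
  \<open>w + 1\<close> bits for width \<open>w\<close>, has polynomial length. The edge relation is
  evaluated only once all quantifiers are decided.\<close>

theorem pcf_reachable:
  fixes E :: "'a::coded \<Rightarrow> bool list \<Rightarrow> bool list \<Rightarrow> bool" and w src dst :: "'a \<Rightarrow> bool list"
  assumes "pcf False w" "pcf False src" "pcf False dst"
    and "pcf False (\<lambda>z. E (fst z) (fst (snd z)) (snd (snd z)))"
    and "\<And>x. length (src x) = length (w x)" "\<And>x. length (dst x) = length (w x)"
  shows "pcf False (\<lambda>x. (src x, dst x) \<in> (graph (length (w x)) (E x))\<^sup>*)"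
proof -
  let ?R = "\<lambda>x st. case foldr midpoint st (src x, dst x, []) of (P, Q, _) \<Rightarrow> P = Q \<or> E x P Q"
  let ?qs = "\<lambda>x. concat (map (\<lambda>_. map (\<lambda>_. False) (w x) @ [True]) (w x @ w x))"
  have mid: "pcf False (\<lambda>z. midpoint (a z) (b z))" if "pcf False a" "pcf False b"
    for a :: "'c::coded \<Rightarrow> bool \<times> bool" and b
  proof -
    have "midpoint p t = (if fst p then (if snd p then (snd (snd t), fst (snd t), []) else (fst t, snd (snd t), []))
      else (fst t, fst (snd t), snd p # snd (snd t)))" for p t
      by (cases "(p, t)" rule: midpoint.cases) auto
    thus ?thesis by simp (intro pcf_intros that)
  qed
  have "pcf False (\<lambda>z :: 'a \<times> (bool \<times> bool) list. foldr midpoint (snd z) (src (fst z), dst (fst z), []))"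
  proof (rule pcf_foldr[where q = "[:5:]"])
    fix x :: "'a \<times> (bool \<times> bool) list" and y :: "bool \<times> bool" and acc
    show "sz (midpoint y acc) \<le> sz acc + poly [:5:] (sz x + sz y)"
      using sz_bit[of "snd y"] by (cases "(y, acc)" rule: midpoint.cases) auto
  qed (intro pcf_intros mid pcf_comp[OF pcf_fst_base assms(2)] pcf_comp[OF pcf_fst_base assms(3)])+
  hence R: "pcf False (\<lambda>z. ?R (fst z) (snd z))"
    by (intro pcf_intros pcf_app3[of False E, OF assms(4)])
  have "pcf False ?qs" by (intro pcf_intros pcf_map assms pcf_comp[OF pcf_fst_base assms(1)])
  from pcf_game[OF R this] have "pcf False (\<lambda>x. ev (?R x) (?qs x) [])" .
  moreover have "ev (?R x) (?qs x) [] = ((src x, dst x) \<in> (graph (length (w x)) (E x))\<^sup>*)" for x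
  proof -
    have "?qs x = concat (replicate (2 * length (w x)) (replicate (length (w x)) False @ [True]))"
      by (simp only: map_replicate_const length_append mult_2)
    thus ?thesis using reach_in_rtrancl[where P = "src x" and Q = "dst x" and w = "length (w x)" and E = "E x", OF assms(5,6)] by (simp add: ev_reach_in)
  qed
  ultimately show ?thesis by simp
qed


section \<open>Satisfiability on sequences\<close>

text \<open>
  Both operators are read as \<open>Until\<close> along a sequence of assignments: \<open>Since\<close> looks backwards from
  a state, and the finite past becomes a sequence by repeating the initial state forever.
\<close>

fun hs :: "(nat \<Rightarrow> nat \<Rightarrow> bool) \<Rightarrow> nat \<Rightarrow> formula \<Rightarrow> bool" where
  "hs v i (Var x) \<longleftrightarrow> v i x"
| "hs v i (Conn f \<phi>s) \<longleftrightarrow> app f (map (hs v i) \<phi>s)"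
| "hs v i (Temp op \<phi> \<psi>) \<longleftrightarrow> (\<exists>k\<ge>i. hs v k \<psi> \<and> (\<forall>j. i \<le> j \<and> j < k \<longrightarrow> hs v j \<phi>))"

definition seq_ok :: "temporal_op \<Rightarrow> (nat \<Rightarrow> 'a) \<Rightarrow> bool" where
  "seq_ok op v \<longleftrightarrow> (op = Since \<longrightarrow> (\<exists>K. \<forall>j\<ge>K. v j = v K))"

definition sat_seq :: "temporal_op \<Rightarrow> formula \<Rightarrow> bool" where
  "sat_seq op \<phi> \<longleftrightarrow> (\<exists>v. seq_ok op v \<and> hs v 0 \<phi>)"

lemma is_formula_ConnD: "is_formula M B (Conn f \<phi>s) \<Longrightarrow>
    f \<in> B \<and> length \<phi>s = arity f \<and> (\<forall>\<phi> \<in> set \<phi>s. is_formula M B \<phi>)"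
  by (auto elim: is_formula.cases)

lemma is_formula_TempD: "is_formula M B (Temp op \<phi> \<psi>) \<Longrightarrow> op \<in> M \<and> is_formula M B \<phi> \<and> is_formula M B \<psi>"
  by (auto elim: is_formula.cases)

lemma holds_Until_iff:
  "is_formula {Until} B \<phi> \<Longrightarrow> holds S (i0 + i) \<phi> = hs (\<lambda>j x. x \<in> assignment S (state_at S (i0 + j))) i \<phi>"
proof (induction \<phi> arbitrary: i)
  case (Conn f \<phi>s)
  hence "map (holds S (i0 + i)) \<phi>s = map (hs (\<lambda>j x. x \<in> assignment S (state_at S (i0 + j))) i) \<phi>s"
    by (auto dest: is_formula_ConnD)
  thus ?case by (simp only: holds.simps hs.simps)
next
  case (Temp op \<phi> \<psi>)
  hence op: "op = Until" "is_formula {Until} B \<phi>" "is_formula {Until} B \<psi>" by (auto dest: is_formula_TempD)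
  let ?v = "\<lambda>j x. x \<in> assignment S (state_at S (i0 + j))"
  have "holds S (i0 + i) (Temp op \<phi> \<psi>) \<longleftrightarrow>
     (\<exists>k\<ge>i0 + i. holds S k \<psi> \<and> (\<forall>j. i0 + i \<le> j \<and> j < k \<longrightarrow> holds S j \<phi>))" using op by simp
  also have "\<dots> \<longleftrightarrow> (\<exists>k\<ge>i. holds S (i0 + k) \<psi> \<and> (\<forall>j. i \<le> j \<and> j < k \<longrightarrow> holds S (i0 + j) \<phi>))"
  proof safe
    fix k assume k: "i0 + i \<le> k" "holds S k \<psi>" "\<forall>j. i0 + i \<le> j \<and> j < k \<longrightarrow> holds S j \<phi>"
    thus "\<exists>k\<ge>i. holds S (i0 + k) \<psi> \<and> (\<forall>j. i \<le> j \<and> j < k \<longrightarrow> holds S (i0 + j) \<phi>)"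
      by (intro exI[of _ "k - i0"]) auto
  next
    fix k assume k: "i \<le> k" "holds S (i0 + k) \<psi>" "\<forall>j. i \<le> j \<and> j < k \<longrightarrow> holds S (i0 + j) \<phi>"
    have "holds S j \<phi>" if "i0 + i \<le> j" "j < i0 + k" for j
    proof -
      have "i \<le> j - i0" "j - i0 < k" "i0 + (j - i0) = j" using that by auto
      thus ?thesis using k(3)[rule_format, of "j - i0"] by simp
    qed
    thus "\<exists>k\<ge>i0 + i. holds S k \<psi> \<and> (\<forall>j. i0 + i \<le> j \<and> j < k \<longrightarrow> holds S j \<phi>)"
      using k by (intro exI[of _ "i0 + k"]) auto
  qed
  finally show ?case using Temp.IH op by simp
qed simp

text \<open>Truncated subtraction is what repeats the initial state: \<open>i0 - j\<close> stays at
  0 for all \<open>j\<close> beyond \<open>i0\<close>.\<close>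

lemma holds_Since_iff:
  "is_formula {Since} B \<phi> \<Longrightarrow> holds S (i0 - i) \<phi> = hs (\<lambda>j x. x \<in> assignment S (state_at S (i0 - j))) i \<phi>"
proof (induction \<phi> arbitrary: i)
  case (Conn f \<phi>s)
  hence "map (holds S (i0 - i)) \<phi>s = map (hs (\<lambda>j x. x \<in> assignment S (state_at S (i0 - j))) i) \<phi>s"
    by (auto dest: is_formula_ConnD)
  thus ?case by (simp only: holds.simps hs.simps)
next
  case (Temp op \<phi> \<psi>)
  hence op: "op = Since" "is_formula {Since} B \<phi>" "is_formula {Since} B \<psi>" by (auto dest: is_formula_TempD)
  let ?v = "\<lambda>j x. x \<in> assignment S (state_at S (i0 - j))"
  have "holds S (i0 - i) (Temp op \<phi> \<psi>) \<longleftrightarrow>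
     (\<exists>k\<le>i0 - i. holds S k \<psi> \<and> (\<forall>j. k < j \<and> j \<le> i0 - i \<longrightarrow> holds S j \<phi>))" using op by simp
  also have "\<dots> \<longleftrightarrow> (\<exists>k\<ge>i. holds S (i0 - k) \<psi> \<and> (\<forall>j. i \<le> j \<and> j < k \<longrightarrow> holds S (i0 - j) \<phi>))"
  proof safe
    fix k assume k: "k \<le> i0 - i" "holds S k \<psi>" "\<forall>j. k < j \<and> j \<le> i0 - i \<longrightarrow> holds S j \<phi>"
    \<comment> \<open>The maximum differs from \<open>i0 - k\<close> only for \<open>i\<close>
      beyond \<open>i0\<close>, where \<open>k\<close> is 0 and the witness must not lie before
      \<open>i\<close>.\<close>
    have "i0 - max i (i0 - k) = k" using k(1) by auto
    thus "\<exists>k\<ge>i. holds S (i0 - k) \<psi> \<and> (\<forall>j. i \<le> j \<and> j < k \<longrightarrow> holds S (i0 - j) \<phi>)"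
    proof (intro exI[of _ "max i (i0 - k)"] conjI allI impI)
      fix j assume "i \<le> j \<and> j < max i (i0 - k)"
      hence "k < i0 - j" "i0 - j \<le> i0 - i" by auto
      thus "holds S (i0 - j) \<phi>" using k(3) by blast
    qed (use k \<open>i0 - max i (i0 - k) = k\<close> in auto)
  next
    fix k assume k: "i \<le> k" "holds S (i0 - k) \<psi>" "\<forall>j. i \<le> j \<and> j < k \<longrightarrow> holds S (i0 - j) \<phi>"
    have "holds S j \<phi>" if "i0 - k < j" "j \<le> i0 - i" for j
    proof -
      have "i0 - (i0 - j) = j" "i \<le> i0 - j" "i0 - j < k" using that by auto
      thus ?thesis using k(3)[rule_format, of "i0 - j"] by simp
    qed
    thus "\<exists>k\<le>i0 - i. holds S k \<psi> \<and> (\<forall>j. k < j \<and> j \<le> i0 - i \<longrightarrow> holds S j \<phi>)"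
      using k by (intro exI[of _ "i0 - k"]) auto
  qed
  finally show ?case using Temp.IH op by simp
qed simp

lemma satisfiable_iff_sat_seq:
  assumes "is_formula {op} B \<phi>"
  shows "satisfiable \<phi> \<longleftrightarrow> sat_seq op \<phi>"
proof
  assume "satisfiable \<phi>"
  then obtain S :: "nat temporal_structure" and i where S: "holds S i \<phi>" unfolding satisfiable_def by blast
  show "sat_seq op \<phi>"
  proof (cases op)
    case Until
    thus ?thesis using holds_Until_iff[of B \<phi> S i 0] assms S by (auto simp: sat_seq_def seq_ok_def)
  next
    case Since
    have "hs (\<lambda>j x. x \<in> assignment S (state_at S (i - j))) 0 \<phi>"
      using holds_Since_iff[of B \<phi> S i 0] assms S Since by simp
    thus ?thesis unfolding sat_seq_def seq_ok_def by (intro exI conjI) (auto intro!: exI[of _ i])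
  qed
next
  assume "sat_seq op \<phi>"
  then obtain v where v: "seq_ok op v" "hs v 0 \<phi>" unfolding sat_seq_def by blast
  show "satisfiable \<phi>"
  proof (cases op)
    case Until
    let ?S = "\<lparr>state_at = id, variables = UNIV, assignment = (\<lambda>i. {x. v i x})\<rparr> :: nat temporal_structure"
    have "holds ?S 0 \<phi>" using holds_Until_iff[of B \<phi> ?S 0 0] assms v(2) Until by simp
    thus ?thesis by (intro satisfiableI[of ?S]) (auto simp: is_structure_def)
  next
    case Since
    then obtain K where K: "\<forall>j\<ge>K. v j = v K" using v(1) unfolding seq_ok_def by blast
    \<comment> \<open>The sequence is reversed: the value from which on it is constant becomes the
      initial state, and its beginning becomes the state \<open>K\<close> at which the formula is
      evaluated.\<close>
    let ?S = "\<lparr>state_at = id, variables = UNIV, assignment = (\<lambda>i. {x. v (K - i) x})\<rparr> :: nat temporal_structure"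
    have "(\<lambda>j x. x \<in> assignment ?S (state_at ?S (K - j))) = v"
    proof (intro ext)
      fix j x
      show "(x \<in> assignment ?S (state_at ?S (K - j))) = v j x"
        by (cases "j \<le> K") (use K[rule_format, of j] in auto)
    qed
    hence "holds ?S K \<phi>" using holds_Since_iff[of B \<phi> ?S K 0] assms v(2) Since by simp
    thus ?thesis by (intro satisfiableI[of ?S]) (auto simp: is_structure_def)
  qed
qed

lemma hs_shift: "hs v (i + d) \<phi> = hs (\<lambda>j. v (j + d)) i \<phi>"
proof (induction \<phi> arbitrary: i)
  case (Conn f \<phi>s)
  hence "map (hs v (i + d)) \<phi>s = map (hs (\<lambda>j. v (j + d)) i) \<phi>s" by simp
  thus ?case by (simp only: hs.simps)
next
  case (Temp op \<phi> \<psi>)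
  have "hs v (i + d) (Temp op \<phi> \<psi>) \<longleftrightarrow>
    (\<exists>k\<ge>i. hs v (k + d) \<psi> \<and> (\<forall>j. i \<le> j \<and> j < k \<longrightarrow> hs v (j + d) \<phi>))" (is "?L = ?R")
  proof
    assume ?L
    then obtain k where k: "i + d \<le> k" "hs v k \<psi>" "\<forall>j. i + d \<le> j \<and> j < k \<longrightarrow> hs v j \<phi>" by auto
    thus ?R by (intro exI[of _ "k - d"]) auto
  next
    assume ?R
    then obtain k where k: "i \<le> k" "hs v (k + d) \<psi>" "\<forall>j. i \<le> j \<and> j < k \<longrightarrow> hs v (j + d) \<phi>" by blast
    have "hs v j \<phi>" if "i + d \<le> j" "j < k + d" for j
    proof -
      have "i \<le> j - d" "j - d < k" "j - d + d = j" using that by auto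
      thus ?thesis using k(3)[rule_format, of "j - d"] by simp
    qed
    thus ?L using k by (auto intro!: exI[of _ "k + d"])
  qed
  thus ?case using Temp by simp
qed simp

lemma hs_eventually_const:
  assumes "\<forall>j\<ge>K. v j = v K" "K \<le> i"
  shows "hs v i \<phi> = hs v K \<phi>"
proof -
  have "v (j + i) = v (j + K)" for j using assms by (metis le_add2 trans_le_add2)
  thus ?thesis using hs_shift[of v 0 i] hs_shift[of v 0 K] by simp
qed

text \<open>The unfolding equation alone also admits the solution that stays true while postponing
  \<open>y\<close> forever. The second hypothesis, fulfilment again and again, excludes it.\<close>

lemma until_unique:
  assumes "\<And>i. a i = (y i \<or> (x i \<and> a (Suc i)))" "\<And>i. \<exists>k\<ge>i. \<not> a k \<or> y k"
  shows "a i \<longleftrightarrow> (\<exists>k\<ge>i. y k \<and> (\<forall>j. i \<le> j \<and> j < k \<longrightarrow> x j))"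
proof
  assume ai: "a i"
  define k where "k = (LEAST k. i \<le> k \<and> (\<not> a k \<or> y k))"
  have k: "i \<le> k" "\<not> a k \<or> y k" unfolding k_def using LeastI_ex[OF assms(2)[of i, unfolded Bex_def]] by auto
  have min: "a j \<and> \<not> y j" if "i \<le> j" "j < k" for j
    using not_less_Least[of j "\<lambda>k. i \<le> k \<and> (\<not> a k \<or> y k)"] that unfolding k_def by blast
  have ak: "a k"
  proof (cases "k = i")
    case False
    then obtain l where l: "k = Suc l" "i \<le> l" using k(1) by (cases k) auto
    thus ?thesis using min[of l] assms(1)[of l] by auto
  qed (use ai in simp)
  have "x j" if "i \<le> j" "j < k" for j using min[OF that] assms(1)[of j] by blast
  thus "\<exists>k\<ge>i. y k \<and> (\<forall>j. i \<le> j \<and> j < k \<longrightarrow> x j)" using k ak by blast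
next
  assume "\<exists>k\<ge>i. y k \<and> (\<forall>j. i \<le> j \<and> j < k \<longrightarrow> x j)"
  then obtain k where k: "i \<le> k" "y k" "\<forall>j. i \<le> j \<and> j < k \<longrightarrow> x j" by blast
  show "a i"
    using k
  proof (induction rule: inc_induct)
    case base
    thus ?case using assms(1)[of k] by simp
  next
    case (step n)
    thus ?case using assms(1)[of n] by auto
  qed
qed

section \<open>Tokens\<close>

text \<open>
  A token is the two-bit tag of a node together with its variable index or truth table (empty for
  temporal operators).
\<close>

type_synonym tok = "(bool \<times> bool) \<times> bool list"

fun tok_code :: "tok \<Rightarrow> bool list" where
  "tok_code ((a, b), p) = a # b # (if a then [] else delimited p)"

text \<open>A one-pass scanner: \<open>pre\<close> holds the tag bits read so far and possibly a
  \<open>True\<close> that announces a payload bit, \<open>cur\<close> the payload in reverse,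
  \<open>ts\<close> the finished tokens in reverse.\<close>

fun lex_step :: "bool \<Rightarrow> bool list \<times> bool list \<times> tok list \<Rightarrow> bool list \<times> bool list \<times> tok list" where
  "lex_step c (pre, cur, ts) = (case pre of
      [] \<Rightarrow> ([c], [], ts)
    | a # pre' \<Rightarrow> (case pre' of
        [] \<Rightarrow> if a then ([], [], ((True, c), []) # ts) else ([False, c], [], ts)
      | b # pre'' \<Rightarrow> (case pre'' of
          [] \<Rightarrow> if c then ([a, b, True], cur, ts) else ([], [], ((a, b), rev cur) # ts)
        | d # pre''' \<Rightarrow> ([a, b], c # cur, ts))))"

definition lex :: "bool list \<Rightarrow> bool list \<times> bool list \<times> tok list" where
  "lex x = fold lex_step x ([], [], [])"

lemma lex_payload:
  "fold lex_step (delimited p) ([False, b], cur, ts) = ([], [], ((False, b), rev cur @ p) # ts)"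
  by (induction p arbitrary: cur) auto

definition lexical :: "tok \<Rightarrow> bool" where
  "lexical t \<longleftrightarrow> (fst (fst t) \<longrightarrow> snd t = [])"

lemma lex_complete:
  assumes "\<forall>t \<in> set ts. lexical t"
  shows "lex (concat (map tok_code ts)) = ([], [], rev ts)"
proof -
  have tok: "fold lex_step (tok_code t) ([], [], us) = ([], [], t # us)" if "lexical t" for t us
    using that by (cases t rule: tok_code.cases) (auto simp: lexical_def lex_payload)
  have "fold lex_step (concat (map tok_code ts)) ([], [], us) = ([], [], rev ts @ us)" for us
    using assms by (induction ts arbitrary: us) (auto simp: tok)
  thus ?thesis by (simp add: lex_def)
qed

definition delim_open :: "bool list \<Rightarrow> bool list" where
  "delim_open p = concat (map (\<lambda>b. [True, b]) p)"

lemma delimited_eq: "delimited p = delim_open p @ [False]"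
  by (induction p) (auto simp: delim_open_def)

lemma delimited_append: "delimited (p @ q) = delim_open p @ delimited q"
  by (simp add: delimited_eq delim_open_def)

text \<open>Scanning can stop between tokens, after one tag bit, inside a payload, or behind the bit
  that announces the next payload bit. Only the first of these leaves \<open>pre\<close>
  empty.\<close>

lemma lex_sound:
  assumes "lex x = ([], cur, us)"
  shows "x = concat (map tok_code (rev us))"
proof -
  have "\<exists>pre cur us. lex x = (pre, cur, us) \<and>
    (x = concat (map tok_code (rev us)) \<and> pre = [] \<or>
     (\<exists>a. x = concat (map tok_code (rev us)) @ [a] \<and> pre = [a]) \<or>
     (\<exists>b. x = concat (map tok_code (rev us)) @ [False, b] @ delim_open (rev cur) \<and> pre = [False, b]) \<or>
     (\<exists>b. x = concat (map tok_code (rev us)) @ [False, b] @ delim_open (rev cur) @ [True] \<and> pre = [False, b, True]))" for x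
  proof (induction x rule: rev_induct)
    case Nil
    show ?case by (simp add: lex_def)
  next
    case (snoc c x)
    obtain pre cur us where l: "lex x = (pre, cur, us)" by (cases "lex x") auto
    hence l': "lex (x @ [c]) = lex_step c (pre, cur, us)" by (simp add: lex_def)
    from snoc.IH l show ?case unfolding l'
      by (elim exE conjE disjE) (auto simp: delimited_eq delim_open_def)
  qed
  from this[of x] assms show ?thesis by auto
qed

section \<open>Binary numerals and their canonical words\<close>

fun unbin :: "bool list \<Rightarrow> nat" where
  "unbin [] = 0"
| "unbin (b # bs) = of_bool b + 2 * unbin bs"

text \<open>The range of \<open>binary\<close>: the most significant bit, which comes last, is not
  zero. Restricted to such words, equality of variable indices is equality of words and needs no
  arithmetic.\<close>

definition canonical :: "bool list \<Rightarrow> bool" where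
  "canonical p \<longleftrightarrow> p = [] \<or> last p"

lemma unbin_pos: "p \<noteq> [] \<Longrightarrow> last p \<Longrightarrow> 0 < unbin p"
  by (induction p) (auto split: if_splits)

lemma binary_unbin: "canonical p \<Longrightarrow> binary (unbin p) = p"
proof (induction p)
  case Nil
  show ?case by (simp add: binary.simps)
next
  case (Cons b p)
  have "0 < unbin (b # p)" using Cons.prems unbin_pos[of "b # p"] by (simp add: canonical_def del: unbin.simps)
  moreover have "canonical p" using Cons.prems by (auto simp: canonical_def split: if_splits)
  ultimately show ?case using Cons.IH binary.simps[of "unbin (b # p)"] by auto
qed

lemma canonical_binary: "canonical (binary n)"
proof (induction n rule: less_induct)
  case (less n)
  show ?case
  proof (cases "n \<le> 1")
    case True
    thus ?thesis using binary.simps[of n] binary.simps[of 0] by (auto simp: canonical_def le_Suc_eq)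
  next
    case False
    hence "n div 2 \<noteq> 0" "n div 2 < n" by auto
    hence "binary (n div 2) \<noteq> []" "canonical (binary (n div 2))"
      using less.IH[of "n div 2"] by (simp_all add: binary.simps[of "n div 2"])
    thus ?thesis using False binary.simps[of n] by (auto simp: canonical_def)
  qed
qed

lemma unbin_binary: "unbin (binary n) = n"
  using binary_unbin[OF canonical_binary] binary_inject by blast

lemma unbin_inject: "canonical p \<Longrightarrow> canonical q \<Longrightarrow> unbin p = unbin q \<Longrightarrow> p = q"
  using binary_unbin by metis

definition op_bit :: "temporal_op \<Rightarrow> bool" where
  "op_bit op = (op = Since)"

lemma encode_Temp: "encode (Temp op \<phi> \<psi>) = True # op_bit op # encode \<phi> @ encode \<psi>"
  by (cases op) (auto simp: op_bit_def)

text \<open>Tokens are read from right to left, which turns the prefix notation into a stack machine.\<close>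

context
  fixes fs :: "boolfun list" and op :: temporal_op
begin

definition lookup :: "bool list \<Rightarrow> boolfun option" where
  "lookup p = find (\<lambda>f. truth_table f = p) fs"

fun shift_reduce :: "tok \<Rightarrow> formula list \<Rightarrow> formula list option" where
  "shift_reduce ((False, False), p) Fs = (if canonical p then Some (Var (unbin p) # Fs) else None)"
| "shift_reduce ((False, True), p) Fs = (case lookup p of None \<Rightarrow> None | Some f \<Rightarrow>
    if arity f \<le> length Fs then Some (Conn f (take (arity f) Fs) # drop (arity f) Fs) else None)"
| "shift_reduce ((True, b), p) Fs = (if b = op_bit op \<and> p = [] then
     (case Fs of \<phi> # \<psi> # Fs' \<Rightarrow> Some (Temp op \<phi> \<psi> # Fs') | _ \<Rightarrow> None) else None)"

fun build :: "tok list \<Rightarrow> formula list option" where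
  "build [] = Some []"
| "build (t # ts) = (case build ts of None \<Rightarrow> None | Some Fs \<Rightarrow> shift_reduce t Fs)"

lemma lookup_Some: "lookup p = Some f \<Longrightarrow> f \<in> set fs \<and> truth_table f = p"
  by (auto simp: lookup_def find_Some_iff)

lemma lookup_truth_table: "f \<in> set fs \<Longrightarrow> lookup (truth_table f) = Some f"
proof -
  assume "f \<in> set fs"
  hence "lookup (truth_table f) \<noteq> None" by (auto simp: lookup_def find_None_iff)
  then obtain g where "lookup (truth_table f) = Some g" by blast
  thus ?thesis using lookup_Some truth_table_inject by metis
qed

lemma build_sound:
  "build ts = Some Fs \<Longrightarrow> concat (map tok_code ts) = concat (map encode Fs) \<and>
    (\<forall>\<phi> \<in> set Fs. is_formula {op} (set fs) \<phi>) \<and> (\<forall>t \<in> set ts. lexical t)"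
proof (induction ts arbitrary: Fs)
  case (Cons t ts)
  then obtain Gs where G: "build ts = Some Gs" "shift_reduce t Gs = Some Fs" by (auto split: option.splits)
  note IH = Cons.IH[OF G(1)]
  show ?case
  proof (cases "(t, Gs)" rule: shift_reduce.cases)
    case (1 p Fs')
    thus ?thesis using IH G by (auto simp: lexical_def binary_unbin intro: is_formula.intros split: if_splits)
  next
    case (2 p Fs')
    then obtain f where f: "lookup p = Some f" "arity f \<le> length Gs" "Fs = Conn f (take (arity f) Gs) # drop (arity f) Gs"
      using G(2) by (auto split: option.splits if_splits)
    have "concat (map encode Gs) = concat (map encode (take (arity f) Gs)) @ concat (map encode (drop (arity f) Gs))"
      by (metis append_take_drop_id concat_append map_append)
    thus ?thesis using IH f lookup_Some[OF f(1)] 2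
      by (auto simp: lexical_def intro!: is_formula.intros dest: in_set_takeD in_set_dropD)
  next
    case (3 b p Fs')
    then obtain \<phi> \<psi> Hs where "Gs = \<phi> # \<psi> # Hs" "Fs = Temp op \<phi> \<psi> # Hs" "b = op_bit op" "p = []"
      using G(2) by (auto split: list.splits if_splits)
    thus ?thesis using IH 3
      by (auto simp: lexical_def encode_Temp intro!: is_formula.intros)
  qed
qed auto

text \<open>The tokens are required to work in front of any suffix \<open>us\<close>, because the
  arguments of a connective are parsed on top of those to their right.\<close>

lemma build_complete:
  "is_formula {op} (set fs) \<phi> \<Longrightarrow> \<exists>ts. concat (map tok_code ts) = encode \<phi> \<and>
    (\<forall>us Fs. build us = Some Fs \<longrightarrow> build (ts @ us) = Some (\<phi> # Fs))"
proof (induction rule: is_formula.induct)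
  case (1 x)
  show ?case
    by (rule exI[of _ "[((False, False), binary x)]"]) (auto simp: canonical_binary unbin_binary)
next
  case (2 f \<phi>s)
  have *: "\<exists>ts. concat (map tok_code ts) = concat (map encode \<psi>s) \<and>
    (\<forall>us Fs. build us = Some Fs \<longrightarrow> build (ts @ us) = Some (\<psi>s @ Fs))" if "set \<psi>s \<subseteq> set \<phi>s" for \<psi>s
    using that
  proof (induction \<psi>s)
    case Nil
    show ?case by (rule exI[of _ "[]"]) auto
  next
    case (Cons \<psi> \<psi>s)
    obtain ts where ts: "concat (map tok_code ts) = concat (map encode \<psi>s)"
      "\<forall>us Fs. build us = Some Fs \<longrightarrow> build (ts @ us) = Some (\<psi>s @ Fs)" using Cons by auto
    obtain ts' where ts': "concat (map tok_code ts') = encode \<psi>"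
      "\<forall>us Fs. build us = Some Fs \<longrightarrow> build (ts' @ us) = Some (\<psi> # Fs)" using Cons.prems "2.IH"[of \<psi>] by auto
    show ?case by (rule exI[of _ "ts' @ ts"]) (use ts ts' in auto)
  qed
  obtain ts where ts: "concat (map tok_code ts) = concat (map encode \<phi>s)"
      "\<forall>us Fs. build us = Some Fs \<longrightarrow> build (ts @ us) = Some (\<phi>s @ Fs)" using *[of \<phi>s] by auto
  show ?case
    by (rule exI[of _ "((False, True), truth_table f) # ts"])
      (use ts lookup_truth_table[OF 2(1)] 2(2) in auto)
next
  case (3 op' \<phi> \<psi>)
  then obtain ts ts' where ts: "concat (map tok_code ts) = encode \<phi>"
      "\<forall>us Fs. build us = Some Fs \<longrightarrow> build (ts @ us) = Some (\<phi> # Fs)"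
      "concat (map tok_code ts') = encode \<psi>"
      "\<forall>us Fs. build us = Some Fs \<longrightarrow> build (ts' @ us) = Some (\<psi> # Fs)" by blast
  show ?case
    by (rule exI[of _ "((True, op_bit op), []) # ts @ ts'"])
      (use ts 3(1) in \<open>auto simp: encode_Temp\<close>)
qed

section \<open>Runs of types\<close>

text \<open>
  A type assigns a truth value to every token. \<open>check_step\<close> tests two consecutive types for local
  consistency and reports for every token whether it is fulfilled; an \<open>Until\<close> node is, if it is
  false or its second argument is true.
\<close>

fun check_step :: "tok \<times> bool \<times> bool \<Rightarrow> bool \<times> bool list \<times> bool list \<Rightarrow> bool \<times> bool list \<times> bool list" where
  "check_step (t, a, a') (ok, vs, fl) =
    (if fst (fst t) then
       (case vs of [] \<Rightarrow> (False, [], True # fl) | x # ws \<Rightarrow>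
         (case ws of [] \<Rightarrow> (False, [], True # fl) | y # us \<Rightarrow>
           (ok \<and> snd (fst t) = op_bit op \<and> snd t = [] \<and> a = (y \<or> (x \<and> a')), a # us, (\<not> a \<or> y) # fl)))
     else if snd (fst t) then
       (case lookup (snd t) of None \<Rightarrow> (False, [], True # fl)
        | Some f \<Rightarrow> (ok \<and> arity f \<le> length vs \<and> a = app f (take (arity f) vs), a # drop (arity f) vs, True # fl))
     else (ok \<and> canonical (snd t), a # vs, True # fl))"

definition check :: "tok list \<Rightarrow> bool list \<Rightarrow> bool list \<Rightarrow> bool \<times> bool list \<times> bool list" where
  "check ts A A' = foldr check_step (zip ts (zip A A')) (True, [], [])"

lemma check_Cons: "check (t # ts) (a # A) (a' # A') = check_step (t, a, a') (check ts A A')"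
  by (simp add: check_def)

lemma check_Nil: "check [] [] [] = (True, [], [])"
  by (simp add: check_def)

lemma check_step_fl: "\<exists>b. snd (snd (check_step (t, a, a') (ok, vs, fl))) = b # fl"
  by (auto split: list.splits option.splits)

lemma check_step_ok: "fst (check_step (t, a, a') (ok, vs, fl)) \<Longrightarrow> ok"
  by (auto split: if_splits list.splits option.splits)

text \<open>The stack of truth values has the shape of the parser's stack, so a successful check
  also shows that the tokens parse. At temporal nodes \<open>until_unique\<close> turns local
  consistency and fulfilment into truth.\<close>

lemma check_build:
  assumes "\<And>i. length (\<beta> i) = length ts" "\<And>i. check ts (\<beta> i) (\<beta> (Suc i)) = (True, vs i, fl i)"
    and "\<And>u i. u < length ts \<Longrightarrow> \<exists>k\<ge>i. fl k ! u"
    and "\<And>u i p. u < length ts \<Longrightarrow> ts ! u = ((False, False), p) \<Longrightarrow> \<beta> i ! u = v i (unbin p)"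
  shows "\<exists>Fs. build ts = Some Fs \<and> (\<forall>i. vs i = map (hs v i) Fs)"
  using assms
proof (induction ts arbitrary: \<beta> vs fl)
  case Nil
  thus ?case by (auto simp: check_Nil)
next
  case (Cons t ts)
  define a \<beta>' where "a i = hd (\<beta> i)" and "\<beta>' i = tl (\<beta> i)" for i
  have \<beta>: "\<beta> i = a i # \<beta>' i" "length (\<beta>' i) = length ts" for i
    using Cons.prems(1)[of i] by (cases "\<beta> i"; simp add: a_def \<beta>'_def)+
  define vs' fl' where "vs' i = fst (snd (check ts (\<beta>' i) (\<beta>' (Suc i))))"
    and "fl' i = snd (snd (check ts (\<beta>' i) (\<beta>' (Suc i))))" for i
  define ok where "ok i = fst (check ts (\<beta>' i) (\<beta>' (Suc i)))" for i
  have c: "check ts (\<beta>' i) (\<beta>' (Suc i)) = (ok i, vs' i, fl' i)" for i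
    by (simp add: vs'_def fl'_def ok_def)
  have st: "check_step (t, a i, a (Suc i)) (ok i, vs' i, fl' i) = (True, vs i, fl i)" for i
    using Cons.prems(2)[of i] by (simp only: \<beta> check_Cons c)
  have ok: "ok i" for i by (rule check_step_ok) (subst st, simp)
  have fl: "\<exists>b. fl i = b # fl' i" for i
    using check_step_fl[of t "a i" "a (Suc i)" "ok i" "vs' i" "fl' i"] unfolding st by simp
  have inf: "\<exists>k\<ge>i. fl' k ! u" if "u < length ts" for u i
    using Cons.prems(3)[of "Suc u" i] that fl by (metis Suc_less_eq length_Cons nth_Cons_Suc)
  have var: "\<beta>' i ! u = v i (unbin p)" if "u < length ts" "ts ! u = ((False, False), p)" for u i p
    using Cons.prems(4)[of "Suc u" p i] that \<beta>(1)[of i] by simp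
  obtain Gs where G: "build ts = Some Gs" "\<And>i. vs' i = map (hs v i) Gs"
    using Cons.IH[OF \<beta>(2) _ inf var] c ok by metis
  show ?case
  proof (cases "(t, Gs)" rule: shift_reduce.cases)
    case (1 p Fs)
    have "a i = v i (unbin p)" for i using Cons.prems(4)[of 0 p i] 1 \<beta>(1)[of i] by simp
    thus ?thesis using 1 G st by auto
  next
    case (2 p Fs)
    have "lookup p \<noteq> None" using st[of 0] 2 by (auto split: option.splits)
    then obtain f where f: "lookup p = Some f" by blast
    have "arity f \<le> length Gs \<and> a i = app f (map (hs v i) (take (arity f) Gs)) \<and>
      vs i = a i # map (hs v i) (drop (arity f) Gs)" for i
      using st[of i] 2 f G(2)[of i] by (auto simp: take_map drop_map)
    thus ?thesis using 2 G(1) f by auto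
  next
    case (3 b p Fs)
    have t: "t = ((True, b), p)" using 3 by simp
    have "\<exists>\<phi> \<psi> Hs. Gs = \<phi> # \<psi> # Hs" using st[of 0] 3 G(2)[of 0] by (auto split: list.splits)
    then obtain \<phi> \<psi> Hs where Gs: "Gs = \<phi> # \<psi> # Hs" by blast
    have s: "b = op_bit op" "p = []" "a i = (hs v i \<psi> \<or> (hs v i \<phi> \<and> a (Suc i)))"
      "vs i = a i # map (hs v i) Hs" "fl i = (\<not> a i \<or> hs v i \<psi>) # fl' i" for i
    proof -
      have "(ok i \<and> b = op_bit op \<and> p = [] \<and> a i = (hs v i \<psi> \<or> (hs v i \<phi> \<and> a (Suc i))),
          a i # map (hs v i) Hs, (\<not> a i \<or> hs v i \<psi>) # fl' i) = (True, vs i, fl i)"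
        using t G(2)[of i] Gs ok[of i] unfolding st[of i, symmetric] by simp
      thus "b = op_bit op" "p = []" "a i = (hs v i \<psi> \<or> (hs v i \<phi> \<and> a (Suc i)))"
        "vs i = a i # map (hs v i) Hs" "fl i = (\<not> a i \<or> hs v i \<psi>) # fl' i"
        unfolding prod.inject by (blast, blast, blast, metis, metis)
    qed
    have "\<exists>k\<ge>i. \<not> a k \<or> hs v k \<psi>" for i using Cons.prems(3)[of 0 i] s(5) by auto
    from until_unique[of a "\<lambda>i. hs v i \<psi>" "\<lambda>i. hs v i \<phi>", OF s(3) this]
    have "a i = hs v i (Temp op \<phi> \<psi>)" for i by simp
    thus ?thesis using G(1) t Gs s(1,2,4) by (auto simp del: hs.simps(3))
  qed
qed

text \<open>Once \<open>t\<close> has been read, the top of the parser's stack is the subformula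
  rooted at this token.\<close>

fun bits :: "(nat \<Rightarrow> nat \<Rightarrow> bool) \<Rightarrow> nat \<Rightarrow> tok list \<Rightarrow> bool list" where
  "bits v i [] = []"
| "bits v i (t # ts) = hs v i (hd (the (build (t # ts)))) # bits v i ts"

lemma length_bits [simp]: "length (bits v i ts) = length ts"
  by (induction ts) auto

lemma hs_Temp_unfold: "hs v i (Temp op \<phi> \<psi>) = (hs v i \<psi> \<or> (hs v i \<phi> \<and> hs v (Suc i) (Temp op \<phi> \<psi>)))"
proof
  assume "hs v i (Temp op \<phi> \<psi>)"
  then obtain k where k: "i \<le> k" "hs v k \<psi>" "\<forall>j. i \<le> j \<and> j < k \<longrightarrow> hs v j \<phi>" by auto
  show "hs v i \<psi> \<or> (hs v i \<phi> \<and> hs v (Suc i) (Temp op \<phi> \<psi>))"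
  proof (cases "k = i")
    case False
    hence "Suc i \<le> k" "hs v i \<phi>" using k by auto
    thus ?thesis using k by auto
  qed (use k in simp)
next
  assume *: "hs v i \<psi> \<or> (hs v i \<phi> \<and> hs v (Suc i) (Temp op \<phi> \<psi>))"
  show "hs v i (Temp op \<phi> \<psi>)"
  proof (cases "hs v i \<psi>")
    case False
    then obtain k where "Suc i \<le> k" "hs v k \<psi>" "\<forall>j. Suc i \<le> j \<and> j < k \<longrightarrow> hs v j \<phi>" "hs v i \<phi>" using * by auto
    thus ?thesis by (auto intro!: exI[of _ k]) (metis Suc_leI le_neq_implies_less)
  qed auto
qed

lemma check_bits:
  assumes "build ts = Some Fs"
  shows "\<exists>fl. (\<forall>i. check ts (bits v i ts) (bits v (Suc i) ts) = (True, map (hs v i) Fs, fl i)) \<and>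
    (\<forall>u < length ts. \<forall>i. \<exists>k\<ge>i. fl k ! u)"
  using assms
proof (induction ts arbitrary: Fs)
  case Nil
  thus ?case by (auto simp: check_Nil)
next
  case (Cons t ts)
  then obtain Gs where G: "build ts = Some Gs" "shift_reduce t Gs = Some Fs" by (auto split: option.splits)
  obtain fl where fl: "\<And>i. check ts (bits v i ts) (bits v (Suc i) ts) = (True, map (hs v i) Gs, fl i)"
    "\<forall>u < length ts. \<forall>i. \<exists>k\<ge>i. fl k ! u" using Cons.IH[OF G(1)] by blast
  have "\<exists>g. (\<forall>i. check_step (t, hs v i (hd Fs), hs v (Suc i) (hd Fs)) (True, map (hs v i) Gs, fl i) =
      (True, map (hs v i) Fs, g i # fl i)) \<and> (\<forall>i. \<exists>k\<ge>i. g k)"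
  proof (cases "(t, Gs)" rule: shift_reduce.cases)
    case (1 p Fs')
    thus ?thesis using G(2) by (intro exI[of _ "\<lambda>_. True"]) (auto split: if_splits)
  next
    case (2 p Fs')
    then obtain f where f: "lookup p = Some f" "arity f \<le> length Gs" "Fs = Conn f (take (arity f) Gs) # drop (arity f) Gs"
      using G(2) by (auto split: option.splits if_splits)
    thus ?thesis using 2 by (intro exI[of _ "\<lambda>_. True"]) (auto simp: take_map drop_map)
  next
    case (3 b p Fs')
    then obtain \<phi> \<psi> Hs where s: "Gs = \<phi> # \<psi> # Hs" "Fs = Temp op \<phi> \<psi> # Hs" "b = op_bit op" "p = []"
      using G(2) by (auto split: list.splits if_splits)
    define A where "A i = hs v i (Temp op \<phi> \<psi>)" for i
    have "\<exists>k\<ge>i. \<not> A k \<or> hs v k \<psi>" for i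
      by (cases "A i") (auto simp: A_def)
    moreover have "check_step (t, A i, A (Suc i)) (True, map (hs v i) Gs, fl i) =
        (True, A i # map (hs v i) Hs, (\<not> A i \<or> hs v i \<psi>) # fl i)" for i
    proof -
      have "A i = (hs v i \<psi> \<or> (hs v i \<phi> \<and> A (Suc i)))" unfolding A_def by (rule hs_Temp_unfold)
      moreover have "t = ((True, b), p)" using 3 by simp
      ultimately show ?thesis using s by simp
    qed
    moreover have "map (hs v i) Fs = A i # map (hs v i) Hs" "hs v i (hd Fs) = A i" for i
      by (simp_all add: s(2) A_def)
    ultimately show ?thesis
      by (intro exI[of _ "\<lambda>i. \<not> A i \<or> hs v i \<psi>"]) (simp del: check_step.simps)
  qed
  then obtain g where g: "\<And>i. check_step (t, hs v i (hd Fs), hs v (Suc i) (hd Fs)) (True, map (hs v i) Gs, fl i) =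
      (True, map (hs v i) Fs, g i # fl i)" "\<forall>i. \<exists>k\<ge>i. g k" by blast
  have "check (t # ts) (bits v i (t # ts)) (bits v (Suc i) (t # ts)) = (True, map (hs v i) Fs, g i # fl i)" for i
    using Cons.prems by (simp only: bits.simps check_Cons fl(1) option.sel g(1))
  moreover have "\<exists>k\<ge>i. (g k # fl k) ! u" if "u < length (t # ts)" for u i
    using that g(2) fl(2) by (cases u) auto
  ultimately show ?case by (intro exI[of _ "\<lambda>i. g i # fl i"]) blast
qed

lemma bits_var:
  assumes "build ts = Some Fs" "u < length ts" "ts ! u = ((False, False), p)"
  shows "bits v i ts ! u = v i (unbin p)"
  using assms
proof (induction ts arbitrary: Fs u)
  case (Cons t ts)
  then obtain Gs where G: "build ts = Some Gs" "shift_reduce t Gs = Some Fs" by (auto split: option.splits)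
  show ?case
  proof (cases u)
    case 0
    thus ?thesis using Cons.prems G by (auto split: if_splits)
  next
    case (Suc w)
    thus ?thesis using Cons.IH[OF G(1)] Cons.prems by simp
  qed
qed simp

definition var_consistent :: "tok list \<Rightarrow> bool list \<Rightarrow> bool" where
  "var_consistent ts A \<longleftrightarrow> list_all (\<lambda>(t, a). list_all (\<lambda>(t', a').
    \<not> fst (fst t) \<and> \<not> snd (fst t) \<and> \<not> fst (fst t') \<and> \<not> snd (fst t') \<and> snd t = snd t' \<longrightarrow> a = a')
    (zip ts A)) (zip ts A)"

lemma var_consistent_iff:
  assumes "length A = length ts"
  shows "var_consistent ts A \<longleftrightarrow> (\<forall>u < length ts. \<forall>w < length ts. \<forall>p. ts ! u = ((False, False), p) \<longrightarrow>
    ts ! w = ((False, False), p) \<longrightarrow> A ! u = A ! w)"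
  using assms by (auto simp: var_consistent_def list_all_length prod_eq_iff split_beta)

text \<open>Exactly one value left on the stack means that the tokens form a single formula.\<close>

definition good :: "tok list \<Rightarrow> bool list \<Rightarrow> bool list \<Rightarrow> bool" where
  "good ts A A' \<longleftrightarrow> fst (check ts A A') \<and> fst (snd (check ts A A')) \<noteq> [] \<and>
    tl (fst (snd (check ts A A'))) = [] \<and> var_consistent ts A"

definition fulfilled :: "tok list \<Rightarrow> bool list \<Rightarrow> bool list \<Rightarrow> bool list" where
  "fulfilled ts A A' = snd (snd (check ts A A'))"

fun first :: "bool list \<Rightarrow> bool" where
  "first [] = False"
| "first (b # bs) = b"

definition type_run :: "tok list \<Rightarrow> (nat \<Rightarrow> bool list) \<Rightarrow> bool" where
  "type_run ts \<beta> \<longleftrightarrow> first (\<beta> 0) \<and> (\<forall>i. length (\<beta> i) = length ts) \<and> (\<forall>i. good ts (\<beta> i) (\<beta> (Suc i))) \<and>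
    (\<forall>u < length ts. \<forall>i. \<exists>k\<ge>i. fulfilled ts (\<beta> k) (\<beta> (Suc k)) ! u) \<and> seq_ok op \<beta>"

lemma check_canonical:
  "length A = length ts \<Longrightarrow> length A' = length ts \<Longrightarrow> fst (check ts A A') \<Longrightarrow> u < length ts \<Longrightarrow>
    ts ! u = ((False, False), p) \<Longrightarrow> canonical p"
proof (induction ts arbitrary: A A' u)
  case (Cons t ts)
  obtain a B a' B' where A: "A = a # B" "A' = a' # B'" using Cons.prems by (cases A; cases A') auto
  obtain ok vs fl where c: "check ts B B' = (ok, vs, fl)" by (cases "check ts B B'") auto
  have "fst (check_step (t, a, a') (ok, vs, fl))" using Cons.prems(3) by (simp only: A check_Cons c)
  hence "ok" "u = 0 \<Longrightarrow> canonical p" using Cons.prems(5) by (auto split: if_splits list.splits option.splits)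
  thus ?case using Cons A c by (cases u) auto
qed simp

lemma check_lengths:
  "length A = length ts \<Longrightarrow> length A' = length ts \<Longrightarrow> length (snd (snd (check ts A A'))) = length ts"
proof (induction ts arbitrary: A A')
  case (Cons t ts)
  obtain a B a' B' where A: "A = a # B" "A' = a' # B'" using Cons.prems by (cases A; cases A') auto
  obtain ok vs fl where c: "check ts B B' = (ok, vs, fl)" by (cases "check ts B B'") auto
  have "length fl = length ts" using Cons A c by (metis Suc_inject length_Cons snd_conv)
  hence "length (snd (snd (check_step (t, a, a') (ok, vs, fl)))) = length (t # ts)"
    by (auto split: list.splits option.splits)
  thus ?case by (simp only: A check_Cons c)
qed (simp add: check_Nil)

lemma check_first:
  assumes "length A = length ts" "length A' = length ts" "ts \<noteq> []" "fst (check ts A A')"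
  shows "first A = first (fst (snd (check ts A A')))"
proof -
  obtain t us where t: "ts = t # us" using assms by (cases ts) auto
  obtain a B a' B' where A: "A = a # B" "A' = a' # B'" using assms t by (cases A; cases A') auto
  obtain ok vs fl where c: "check us B B' = (ok, vs, fl)" by (cases "check us B B'") auto
  have "fst (check_step (t, a, a') (ok, vs, fl)) \<Longrightarrow> first (fst (snd (check_step (t, a, a') (ok, vs, fl)))) = a"
    by (auto split: if_splits list.splits option.splits)
  thus ?thesis using assms(4) by (simp add: t A check_Cons c del: check_step.simps)
qed

lemma type_run_iff: "(\<exists>\<beta>. type_run ts \<beta>) \<longleftrightarrow> (\<exists>\<phi>. build ts = Some [\<phi>] \<and> sat_seq op \<phi>)"
proof
  assume "\<exists>\<beta>. type_run ts \<beta>"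
  then obtain \<beta> where \<beta>: "first (\<beta> 0)" "\<And>i. length (\<beta> i) = length ts" "\<And>i. good ts (\<beta> i) (\<beta> (Suc i))"
    "\<And>u i. u < length ts \<Longrightarrow> \<exists>k\<ge>i. fulfilled ts (\<beta> k) (\<beta> (Suc k)) ! u" "seq_ok op \<beta>"
    unfolding type_run_def by blast
  \<comment> \<open>A variable is true if some token with its index is. Canonical words with the
    same index coincide, and \<open>var_consistent\<close> makes all these tokens agree.\<close>
  define v where "v i x = (\<exists>u < length ts. \<exists>p. ts ! u = ((False, False), p) \<and> unbin p = x \<and> \<beta> i ! u)" for i x
  define vs where "vs i = fst (snd (check ts (\<beta> i) (\<beta> (Suc i))))" for i
  have c: "check ts (\<beta> i) (\<beta> (Suc i)) = (True, vs i, fulfilled ts (\<beta> i) (\<beta> (Suc i)))" for i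
    using \<beta>(3)[of i] by (simp add: good_def vs_def fulfilled_def prod_eq_iff)
  have var: "\<beta> i ! u = v i (unbin p)" if u: "u < length ts" "ts ! u = ((False, False), p)" for u i p
  proof
    assume "\<beta> i ! u" thus "v i (unbin p)" using u unfolding v_def by blast
  next
    assume "v i (unbin p)"
    then obtain w q where w: "w < length ts" "ts ! w = ((False, False), q)" "unbin q = unbin p" "\<beta> i ! w"
      unfolding v_def by blast
    have "canonical p" "canonical q"
      using check_canonical[OF \<beta>(2) \<beta>(2), of i "Suc i"] c[of i] u w by auto
    hence "q = p" using w(3) unbin_inject by blast
    moreover have "var_consistent ts (\<beta> i)" using \<beta>(3)[of i] by (simp add: good_def)
    ultimately show "\<beta> i ! u" using w u var_consistent_iff[OF \<beta>(2)] by blast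
  qed
  obtain Fs where F: "build ts = Some Fs" "\<And>i. vs i = map (hs v i) Fs"
    
    using check_build[where \<beta> = \<beta> and vs = vs and v = v and
      fl = "\<lambda>i. fulfilled ts (\<beta> i) (\<beta> (Suc i))", OF \<beta>(2) c \<beta>(4) var] by blast
  have "vs 0 \<noteq> []" "tl (vs 0) = []" using \<beta>(3)[of 0] by (auto simp: good_def vs_def)
  hence "length Fs = 1" using F(2)[of 0] by (cases "vs 0") auto
  then obtain \<phi> where \<phi>: "Fs = [\<phi>]" by (cases Fs) auto
  have "ts \<noteq> []" using F \<phi> by auto
  hence "first (\<beta> 0) = first (vs 0)" using check_first[OF \<beta>(2) \<beta>(2), of 0 "Suc 0"] c[of 0] by simp
  hence "hs v 0 \<phi>" using F(2)[of 0] \<phi> \<beta>(1) by simp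
  moreover have "seq_ok op v"
  proof -
    have "v j = v k" if "\<beta> j = \<beta> k" for j k using that by (simp add: v_def fun_eq_iff)
    thus ?thesis using \<beta>(5) unfolding seq_ok_def by metis
  qed
  ultimately show "\<exists>\<phi>. build ts = Some [\<phi>] \<and> sat_seq op \<phi>" using F \<phi> unfolding sat_seq_def by blast
next
  assume "\<exists>\<phi>. build ts = Some [\<phi>] \<and> sat_seq op \<phi>"
  then obtain \<phi> v where b: "build ts = Some [\<phi>]" and v: "seq_ok op v" "hs v 0 \<phi>"
    unfolding sat_seq_def by blast
  obtain fl where fl: "\<And>i. check ts (bits v i ts) (bits v (Suc i) ts) = (True, map (hs v i) [\<phi>], fl i)"
    "\<forall>u < length ts. \<forall>i. \<exists>k\<ge>i. fl k ! u" using check_bits[OF b, of v] by blast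
  have ne: "ts \<noteq> []" using b by auto
  have "first (bits v 0 ts)" using check_first[OF _ _ ne, of "bits v 0 ts" "bits v (Suc 0) ts"] fl(1)[of 0] v(2) by simp
  moreover have "good ts (bits v i ts) (bits v (Suc i) ts)" for i
    unfolding good_def using fl(1)[of i] bits_var[OF b]
    by (auto simp: var_consistent_iff)
  moreover have "seq_ok op (\<lambda>i. bits v i ts)"
  proof -
    have "bits v j ts = bits v K ts" if "\<forall>j\<ge>K. v j = v K" "K \<le> j" for j K ts
      by (induction ts) (simp_all add: hs_eventually_const[OF that])
    thus ?thesis using v(1) unfolding seq_ok_def by blast
  qed
  ultimately show "\<exists>\<beta>. type_run ts \<beta>"
    unfolding type_run_def using fl by (intro exI[of _ "\<lambda>i. bits v i ts"]) (auto simp: fulfilled_def)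
qed

end


subsection \<open>Lassos\<close>

context
  fixes fs :: "boolfun list" and op :: temporal_op
begin

text \<open>For \<open>Since\<close> the loop has to be constant, as it stands for the repeated
  initial state.\<close>

definition lasso :: "tok list \<Rightarrow> (nat \<Rightarrow> bool list) \<Rightarrow> nat \<Rightarrow> nat \<Rightarrow> bool" where
  "lasso ts \<alpha> n m \<longleftrightarrow> n < m \<and> first (\<alpha> 0) \<and> (\<forall>i\<le>m. length (\<alpha> i) = length ts) \<and>
    (\<forall>i<m. good fs op ts (\<alpha> i) (\<alpha> (Suc i))) \<and> \<alpha> n = \<alpha> m \<and>
    (\<forall>u < length ts. \<exists>i\<ge>n. i < m \<and> fulfilled fs op ts (\<alpha> i) (\<alpha> (Suc i)) ! u) \<and>
    (op = Since \<longrightarrow> (\<forall>i. n \<le> i \<and> i \<le> m \<longrightarrow> \<alpha> i = \<alpha> n))"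

lemma type_run_of_lasso:
  assumes "lasso ts \<alpha> n m"
  shows "\<exists>\<beta>. type_run fs op ts \<beta>"
proof -
  have l: "n < m" "first (\<alpha> 0)" "\<And>i. i \<le> m \<Longrightarrow> length (\<alpha> i) = length ts"
    "\<And>i. i < m \<Longrightarrow> good fs op ts (\<alpha> i) (\<alpha> (Suc i))" "\<alpha> n = \<alpha> m"
    "\<And>u. u < length ts \<Longrightarrow> \<exists>i\<ge>n. i < m \<and> fulfilled fs op ts (\<alpha> i) (\<alpha> (Suc i)) ! u"
    "\<And>i. op = Since \<Longrightarrow> n \<le> i \<Longrightarrow> i \<le> m \<Longrightarrow> \<alpha> i = \<alpha> n"
    using assms unfolding lasso_def by blast+
  \<comment> \<open>Runs through the stem once and then round the loop.\<close>
  define idx where "idx i = (if i < n then i else n + (i - n) mod (m - n))" for i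
  have idx_less: "idx i < m" for i
    using l(1) by (auto simp: idx_def) (metis add.commute less_diff_conv mod_less_divisor zero_less_diff)
  have idx_Suc: "\<alpha> (idx (Suc i)) = \<alpha> (Suc (idx i))" for i
  proof (cases "Suc i \<le> n")
    case True
    thus ?thesis by (cases "Suc i = n") (auto simp: idx_def)
  next
    case False
    have e: "Suc i - n = Suc (i - n)" using False by simp
    show ?thesis
    proof (cases "Suc ((i - n) mod (m - n)) = m - n")
      case True
      hence "idx (Suc i) = n" "Suc (idx i) = m"
        using False l(1) by (simp_all add: idx_def e mod_Suc)
      thus ?thesis using l(5) by simp
    next
      case neq: False
      hence "idx (Suc i) = Suc (idx i)" using False by (simp add: idx_def e mod_Suc)
      thus ?thesis by simp
    qed
  qed
  have fair: "\<exists>k\<ge>i. fulfilled fs op ts (\<alpha> (idx k)) (\<alpha> (idx (Suc k))) ! u" if u: "u < length ts" for u i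
  proof -
    obtain i0 where i0: "n \<le> i0" "i0 < m" "fulfilled fs op ts (\<alpha> i0) (\<alpha> (Suc i0)) ! u" using l(6)[OF u] by blast
    \<comment> \<open>The copy of position \<open>i0\<close> after \<open>i\<close> further rounds,
      hence not before \<open>i\<close>.\<close>
    define k where "k = i0 + (m - n) * i"
    have k: "k - n = (i0 - n) + (m - n) * i" "n \<le> k" using i0(1) by (auto simp: k_def)
    have "(k - n) mod (m - n) = i0 - n" unfolding k(1) mod_mult_self2 using i0 by simp
    hence "idx k = i0" using i0 k(2) by (simp add: idx_def)
    moreover have "1 * i \<le> (m - n) * i" using l(1) by (intro mult_le_mono1) auto
    hence "i \<le> k" unfolding k_def by linarith
    ultimately show ?thesis using i0(3) idx_Suc[of k] by (intro exI[of _ k]) simp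
  qed
  have "seq_ok op (\<lambda>i. \<alpha> (idx i))" unfolding seq_ok_def
  proof (intro impI exI[of _ n] allI)
    fix j assume "op = Since" "n \<le> j"
    thus "\<alpha> (idx j) = \<alpha> (idx n)" using l(7)[of "idx j"] idx_less[of j] by (simp add: idx_def)
  qed
  moreover have "idx 0 = 0" using l(1) by (simp add: idx_def)
  moreover have "good fs op ts (\<alpha> (idx i)) (\<alpha> (idx (Suc i)))" for i
    unfolding idx_Suc using l(4) idx_less by blast
  moreover have "length (\<alpha> (idx i)) = length ts" for i using l(3)[of "idx i"] idx_less[of i] by simp
  ultimately have "type_run fs op ts (\<lambda>i. \<alpha> (idx i))"
    unfolding type_run_def using l(2) fair by simp
  thus ?thesis by blast
qed

text \<open>There are only finitely many types of a given length, so one recurs infinitely often; it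
  is entered at \<open>n\<close>, and the loop is closed at a recurrence after each node has been
  fulfilled at least once since \<open>n\<close>.\<close>

lemma lasso_of_type_run:
  assumes "type_run fs op ts \<beta>"
  shows "\<exists>n m. lasso ts \<beta> n m"
proof -
  have r: "first (\<beta> 0)" "\<And>i. length (\<beta> i) = length ts" "\<And>i. good fs op ts (\<beta> i) (\<beta> (Suc i))"
    "\<And>u i. u < length ts \<Longrightarrow> \<exists>k\<ge>i. fulfilled fs op ts (\<beta> k) (\<beta> (Suc k)) ! u" "seq_ok op \<beta>"
    using assms unfolding type_run_def by blast+
  obtain n where n: "infinite {i. \<beta> i = \<beta> n}" "op = Since \<Longrightarrow> \<forall>i\<ge>n. \<beta> i = \<beta> n"
  proof (cases "op = Since")
    case True
    then obtain K where K: "\<forall>j\<ge>K. \<beta> j = \<beta> K" using r(5) unfolding seq_ok_def by blast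
    hence "{K..} \<subseteq> {i. \<beta> i = \<beta> K}" by blast
    hence "infinite {i. \<beta> i = \<beta> K}" using infinite_Ici infinite_super by blast
    thus ?thesis using that K by blast
  next
    case False
    have "range \<beta> \<subseteq> {xs. set xs \<subseteq> UNIV \<and> length xs = length ts}" using r(2) by auto
    hence "finite (range \<beta>)"
      by (rule finite_subset) (rule finite_lists_length_eq, simp)
    from pigeonhole_infinite[OF infinite_UNIV_nat this] obtain n where "infinite {i. \<beta> i = \<beta> n}" by auto
    thus ?thesis using that False by blast
  qed
  have "\<exists>M. \<forall>u < length ts. \<exists>i\<ge>n. i < M \<and> fulfilled fs op ts (\<beta> i) (\<beta> (Suc i)) ! u"
  proof -
    define k where "k u = (SOME k. n \<le> k \<and> fulfilled fs op ts (\<beta> k) (\<beta> (Suc k)) ! u)" for u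
    have k: "n \<le> k u \<and> fulfilled fs op ts (\<beta> (k u)) (\<beta> (Suc (k u))) ! u" if "u < length ts" for u
      unfolding k_def by (rule someI_ex) (use r(4)[OF that, of n] in blast)
    have "k u < Suc (\<Sum>u<length ts. k u)" if "u < length ts" for u
      using member_le_sum[of u "{..<length ts}" k] that by simp
    thus ?thesis using k by blast
  qed
  then obtain M where M: "\<forall>u < length ts. \<exists>i\<ge>n. i < M \<and> fulfilled fs op ts (\<beta> i) (\<beta> (Suc i)) ! u" by blast
  obtain m where m: "max n M < m" "\<beta> m = \<beta> n"
    using n(1) unfolding infinite_nat_iff_unbounded by blast
  have "\<exists>i\<ge>n. i < m \<and> fulfilled fs op ts (\<beta> i) (\<beta> (Suc i)) ! u" if "u < length ts" for u
    using M that m(1) by (meson less_trans max_less_iff_conj)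
  moreover have "n < m" using m(1) by simp
  ultimately have "lasso ts \<beta> n m"
    unfolding lasso_def using r(1,2,3) m(2)[symmetric] n(2) by blast
  thus ?thesis by blast
qed

text \<open>
  A vertex consists of two phase bits and three types: the current one, the one at which the loop
  was entered, and the nodes fulfilled since then. The phases are \<open>00\<close> (source), \<open>01\<close> (stem),
  \<open>10\<close> (loop) and \<open>11\<close> (target).
\<close>

definition phase1 :: "bool list \<Rightarrow> bool" where "phase1 P = first P"
definition phase2 :: "bool list \<Rightarrow> bool" where "phase2 P = first (tl P)"
definition cur :: "tok list \<Rightarrow> bool list \<Rightarrow> bool list" where
  "cur ts P = take (length ts) (tl (tl P))"
definition entry :: "tok list \<Rightarrow> bool list \<Rightarrow> bool list" where
  "entry ts P = take (length ts) (drop (length ts) (tl (tl P)))"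
definition achieved :: "tok list \<Rightarrow> bool list \<Rightarrow> bool list" where
  "achieved ts P = drop (length ts) (drop (length ts) (tl (tl P)))"

text \<open>The disjuncts are starting, advancing on the stem, entering the loop, advancing in it,
  and closing it. Source and target are recognised by their phase bits alone, so they can be
  constant words.\<close>

definition edge :: "tok list \<Rightarrow> bool list \<Rightarrow> bool list \<Rightarrow> bool" where
  "edge ts P Q \<longleftrightarrow>
    (\<not> phase1 P \<and> \<not> phase2 P \<and> \<not> phase1 Q \<and> phase2 Q \<and> first (cur ts Q)) \<or>
    (\<not> phase1 P \<and> phase2 P \<and> \<not> phase1 Q \<and> phase2 Q \<and> good fs op ts (cur ts P) (cur ts Q)) \<or>
    (\<not> phase1 P \<and> phase2 P \<and> phase1 Q \<and> \<not> phase2 Q \<and> cur ts Q = cur ts P \<and> entry ts Q = cur ts P \<and>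
      list_all Not (achieved ts Q)) \<or>
    (phase1 P \<and> \<not> phase2 P \<and> phase1 Q \<and> \<not> phase2 Q \<and> good fs op ts (cur ts P) (cur ts Q) \<and>
      entry ts Q = entry ts P \<and>
      achieved ts Q = map2 (\<or>) (achieved ts P) (fulfilled fs op ts (cur ts P) (cur ts Q)) \<and>
      (op = Since \<longrightarrow> cur ts Q = cur ts P)) \<or>
    (phase1 P \<and> \<not> phase2 P \<and> phase1 Q \<and> phase2 Q \<and> cur ts P = entry ts P \<and> list_all (\<lambda>b. b) (achieved ts P))"

definition vertex :: "bool \<Rightarrow> bool \<Rightarrow> bool list \<Rightarrow> bool list \<Rightarrow> bool list \<Rightarrow> bool list" where
  "vertex p q A S F = p # q # A @ S @ F"

lemma vertex_simps [simp]:
  "phase1 (vertex p q A S F) = p" "phase2 (vertex p q A S F) = q"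
  "length A = length ts \<Longrightarrow> cur ts (vertex p q A S F) = A"
  "length A = length ts \<Longrightarrow> length S = length ts \<Longrightarrow> entry ts (vertex p q A S F) = S"
  "length A = length ts \<Longrightarrow> length S = length ts \<Longrightarrow> achieved ts (vertex p q A S F) = F"
  by (auto simp: vertex_def phase1_def phase2_def cur_def entry_def achieved_def)

definition width :: "tok list \<Rightarrow> nat" where
  "width ts = 2 + 3 * length ts"

lemma length_parts:
  "length P = width ts \<Longrightarrow> length (cur ts P) = length ts"
  "length P = width ts \<Longrightarrow> length (entry ts P) = length ts"
  "length P = width ts \<Longrightarrow> length (achieved ts P) = length ts"
  by (auto simp: width_def cur_def entry_def achieved_def)

lemma length_fulfilled:
  "length A = length ts \<Longrightarrow> length A' = length ts \<Longrightarrow> length (fulfilled fs op ts A A') = length ts"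
  unfolding fulfilled_def by (rule check_lengths)

definition loop_inv :: "tok list \<Rightarrow> bool list \<Rightarrow> bool list \<Rightarrow> bool list \<Rightarrow> bool" where
  "loop_inv ts A S F \<longleftrightarrow> (\<exists>\<alpha> n m. n \<le> m \<and> first (\<alpha> 0) \<and> (\<forall>i\<le>m. length (\<alpha> i) = length ts) \<and>
    (\<forall>i<m. good fs op ts (\<alpha> i) (\<alpha> (Suc i))) \<and> \<alpha> n = S \<and> \<alpha> m = A \<and>
    (\<forall>u < length ts. F ! u \<longrightarrow> (\<exists>i\<ge>n. i < m \<and> fulfilled fs op ts (\<alpha> i) (\<alpha> (Suc i)) ! u)) \<and>
    (op = Since \<longrightarrow> (\<forall>i. n \<le> i \<and> i \<le> m \<longrightarrow> \<alpha> i = S)))"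

definition stem_inv :: "tok list \<Rightarrow> bool list \<Rightarrow> bool" where
  "stem_inv ts A \<longleftrightarrow> (\<exists>\<alpha> n. first (\<alpha> 0) \<and> (\<forall>i\<le>n. length (\<alpha> i) = length ts) \<and>
    (\<forall>i<n. good fs op ts (\<alpha> i) (\<alpha> (Suc i))) \<and> \<alpha> n = A)"

definition vertex_inv :: "tok list \<Rightarrow> bool list \<Rightarrow> bool" where
  "vertex_inv ts P \<longleftrightarrow> (\<not> phase1 P \<and> phase2 P \<longrightarrow> stem_inv ts (cur ts P)) \<and>
    (phase1 P \<and> \<not> phase2 P \<longrightarrow> loop_inv ts (cur ts P) (entry ts P) (achieved ts P)) \<and>
    (phase1 P \<and> phase2 P \<longrightarrow> (\<exists>\<alpha> n m. lasso ts \<alpha> n m))"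

lemma loop_inv_step:
  assumes "loop_inv ts A S F" "good fs op ts A A'" "length A' = length ts" "length F = length ts"
    "op = Since \<longrightarrow> A' = A"
  shows "loop_inv ts A' S (map2 (\<or>) F (fulfilled fs op ts A A'))"
proof -
  obtain \<alpha> n m where l: "n \<le> m" "first (\<alpha> 0)" "\<forall>i\<le>m. length (\<alpha> i) = length ts"
    "\<forall>i<m. good fs op ts (\<alpha> i) (\<alpha> (Suc i))" "\<alpha> n = S" "\<alpha> m = A"
    "\<forall>u < length ts. F ! u \<longrightarrow> (\<exists>i\<ge>n. i < m \<and> fulfilled fs op ts (\<alpha> i) (\<alpha> (Suc i)) ! u)"
    "op = Since \<longrightarrow> (\<forall>i. n \<le> i \<and> i \<le> m \<longrightarrow> \<alpha> i = S)"
    using assms(1) unfolding loop_inv_def by blast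
  define \<alpha>' where "\<alpha>' = \<alpha>(Suc m := A')"
  have \<alpha>': "\<alpha>' i = \<alpha> i" if "i \<le> m" for i using that by (simp add: \<alpha>'_def)
  have last: "\<alpha>' (Suc m) = A'" by (simp add: \<alpha>'_def)
  have "length A = length ts" using l(3,6) by auto
  note lf = length_fulfilled[OF this assms(3)]
  show ?thesis unfolding loop_inv_def
  proof (rule exI[of _ \<alpha>'], rule exI[of _ n], rule exI[of _ "Suc m"], intro conjI allI impI)
    fix i assume "i < Suc m"
    thus "good fs op ts (\<alpha>' i) (\<alpha>' (Suc i))"
      using l(4,6) assms(2) \<alpha>'[of i] \<alpha>'[of "Suc i"] last by (cases "i = m") auto
  next
    fix u assume u: "u < length ts" "map2 (\<or>) F (fulfilled fs op ts A A') ! u"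
    hence "F ! u \<or> fulfilled fs op ts A A' ! u" using assms(4) lf by simp
    thus "\<exists>i\<ge>n. i < Suc m \<and> fulfilled fs op ts (\<alpha>' i) (\<alpha>' (Suc i)) ! u"
    proof
      assume "F ! u"
      then obtain i where "n \<le> i" "i < m" "fulfilled fs op ts (\<alpha> i) (\<alpha> (Suc i)) ! u" using l(7) u(1) by blast
      thus ?thesis using \<alpha>'[of i] \<alpha>'[of "Suc i"] by (intro exI[of _ i]) auto
    next
      assume "fulfilled fs op ts A A' ! u"
      thus ?thesis using l(1,6) \<alpha>'[of m] last by (intro exI[of _ m]) auto
    qed
  next
    fix i assume "op = Since" "n \<le> i \<and> i \<le> Suc m"
    thus "\<alpha>' i = S" using l(1,6,8) assms(5) \<alpha>'[of i] last by (cases "i = Suc m") auto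
  next
    fix i assume "i \<le> Suc m"
    thus "length (\<alpha>' i) = length ts" using l(3) assms(3) \<alpha>'[of i] last by (cases "i = Suc m") auto
  qed (use l \<alpha>' last in auto)
qed

lemma stem_inv_step:
  assumes "stem_inv ts A" "good fs op ts A A'" "length A' = length ts"
  shows "stem_inv ts A'"
proof -
  obtain \<alpha> n where l: "first (\<alpha> 0)" "\<forall>i\<le>n. length (\<alpha> i) = length ts"
    "\<forall>i<n. good fs op ts (\<alpha> i) (\<alpha> (Suc i))" "\<alpha> n = A"
    using assms(1) unfolding stem_inv_def by blast
  define \<alpha>' where "\<alpha>' = \<alpha>(Suc n := A')"
  have \<alpha>': "\<alpha>' i = \<alpha> i" if "i \<le> n" for i using that by (simp add: \<alpha>'_def)
  have last: "\<alpha>' (Suc n) = A'" by (simp add: \<alpha>'_def)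
  show ?thesis unfolding stem_inv_def
  proof (rule exI[of _ \<alpha>'], rule exI[of _ "Suc n"], intro conjI allI impI)
    fix i assume "i < Suc n"
    thus "good fs op ts (\<alpha>' i) (\<alpha>' (Suc i))"
      using l(3,4) assms(2) \<alpha>'[of i] \<alpha>'[of "Suc i"] last by (cases "i = n") auto
  next
    fix i assume "i \<le> Suc n"
    thus "length (\<alpha>' i) = length ts" using l(2) assms(3) \<alpha>'[of i] last by (cases "i = Suc n") auto
  qed (use l \<alpha>' last in auto)
qed

lemma lasso_of_loop_inv:
  assumes "loop_inv ts A A F" "length F = length ts" "list_all (\<lambda>b. b) F"
  shows "\<exists>\<alpha> n m. lasso ts \<alpha> n m"
proof -
  obtain \<alpha> n m where l: "n \<le> m" "first (\<alpha> 0)" "\<forall>i\<le>m. length (\<alpha> i) = length ts"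
    "\<forall>i<m. good fs op ts (\<alpha> i) (\<alpha> (Suc i))" "\<alpha> n = A" "\<alpha> m = A"
    "\<forall>u < length ts. F ! u \<longrightarrow> (\<exists>i\<ge>n. i < m \<and> fulfilled fs op ts (\<alpha> i) (\<alpha> (Suc i)) ! u)"
    "op = Since \<longrightarrow> (\<forall>i. n \<le> i \<and> i \<le> m \<longrightarrow> \<alpha> i = A)"
    using assms(1) unfolding loop_inv_def by blast
  have F: "F ! u" if "u < length ts" for u using assms(2,3) that by (simp add: list_all_length)
  \<comment> \<open>A type whose first bit is true is not empty, so there is a node that has been
    fulfilled since \<open>n\<close>; this is what makes the loop proper.\<close>
  have "0 < length ts" using l(2,3) by (cases "\<alpha> 0") auto
  hence "n < m" using l(7) F by (meson le_less_trans)
  hence "lasso ts \<alpha> n m" unfolding lasso_def using l F by auto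
  thus ?thesis by blast
qed

lemma edge_inv:
  assumes "vertex_inv ts P" "edge ts P Q" "length P = width ts" "length Q = width ts"
  shows "vertex_inv ts Q"
proof -
  note len = length_parts[OF assms(3)] length_parts[OF assms(4)]
  consider "\<not> phase1 Q" "phase2 Q" "first (cur ts Q)" |
    "\<not> phase1 P" "phase2 P" "\<not> phase1 Q" "phase2 Q" "good fs op ts (cur ts P) (cur ts Q)" |
    "\<not> phase1 P" "phase2 P" "phase1 Q" "\<not> phase2 Q" "cur ts Q = cur ts P" "entry ts Q = cur ts P"
      "list_all Not (achieved ts Q)" |
    "phase1 P" "\<not> phase2 P" "phase1 Q" "\<not> phase2 Q" "good fs op ts (cur ts P) (cur ts Q)"
      "entry ts Q = entry ts P"
      "achieved ts Q = map2 (\<or>) (achieved ts P) (fulfilled fs op ts (cur ts P) (cur ts Q))"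
      "op = Since \<longrightarrow> cur ts Q = cur ts P" |
    "phase1 P" "\<not> phase2 P" "phase1 Q" "phase2 Q" "cur ts P = entry ts P" "list_all (\<lambda>b. b) (achieved ts P)"
    using assms(2) unfolding edge_def by blast
  thus ?thesis
  proof cases
    case 1
    have "stem_inv ts (cur ts Q)" unfolding stem_inv_def
      by (rule exI[of _ "\<lambda>_. cur ts Q"], rule exI[of _ 0]) (use 1 len in auto)
    thus ?thesis using 1 by (simp add: vertex_inv_def)
  next
    case 2
    thus ?thesis using stem_inv_step[of ts "cur ts P" "cur ts Q"] assms(1) len by (simp add: vertex_inv_def)
  next
    case 3
    hence "stem_inv ts (cur ts P)" using assms(1) by (simp add: vertex_inv_def)
    then obtain \<alpha> n where l: "first (\<alpha> 0)" "\<forall>i\<le>n. length (\<alpha> i) = length ts"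
      "\<forall>i<n. good fs op ts (\<alpha> i) (\<alpha> (Suc i))" "\<alpha> n = cur ts P" unfolding stem_inv_def by blast
    have "loop_inv ts (cur ts Q) (entry ts Q) (achieved ts Q)"
      unfolding loop_inv_def
      by (rule exI[of _ \<alpha>], rule exI[of _ n], rule exI[of _ n])
        (use l 3(5-7) len in \<open>auto simp: list_all_length\<close>)
    thus ?thesis using 3 by (simp add: vertex_inv_def)
  next
    case 4
    thus ?thesis using loop_inv_step[of ts "cur ts P" "entry ts P" "achieved ts P" "cur ts Q"] assms(1) len
      by (simp add: vertex_inv_def)
  next
    case 5
    hence "loop_inv ts (cur ts P) (cur ts P) (achieved ts P)" using assms(1) by (simp add: vertex_inv_def)
    from lasso_of_loop_inv[OF this] show ?thesis using 5 len by (simp add: vertex_inv_def)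
  qed
qed

definition source :: "tok list \<Rightarrow> bool list" where
  "source ts = replicate (width ts) False"

definition target :: "tok list \<Rightarrow> bool list" where
  "target ts = replicate (width ts) True"

lemma phase_source: "\<not> phase1 (source ts)" "\<not> phase2 (source ts)"
  by (auto simp: source_def width_def phase1_def phase2_def)

lemma phase_target: "phase1 (target ts)" "phase2 (target ts)"
  by (auto simp: target_def width_def phase1_def phase2_def)

lemma lasso_of_path:
  assumes "(source ts, target ts) \<in> (graph (width ts) (edge ts))\<^sup>*"
  shows "\<exists>\<alpha> n m. lasso ts \<alpha> n m"
proof -
  from assms have "vertex_inv ts (target ts)"
  proof (induction rule: rtrancl_induct)
    case base
    show ?case using phase_source by (simp add: vertex_inv_def)
  next
    case (step P Q)
    thus ?case using edge_inv by (auto simp: graph_def)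
  qed
  thus ?thesis using phase_target by (simp add: vertex_inv_def)
qed

lemma path_of_lasso:
  assumes "lasso ts \<alpha> n m"
  shows "(source ts, target ts) \<in> (graph (width ts) (edge ts))\<^sup>*"
proof -
  let ?G = "graph (width ts) (edge ts)"
  let ?Z = "replicate (length ts) False"
  have l: "n < m" "first (\<alpha> 0)" "\<And>i. i \<le> m \<Longrightarrow> length (\<alpha> i) = length ts"
    "\<And>i. i < m \<Longrightarrow> good fs op ts (\<alpha> i) (\<alpha> (Suc i))" "\<alpha> n = \<alpha> m"
    "\<And>u. u < length ts \<Longrightarrow> \<exists>i\<ge>n. i < m \<and> fulfilled fs op ts (\<alpha> i) (\<alpha> (Suc i)) ! u"
    "\<And>i. op = Since \<Longrightarrow> n \<le> i \<Longrightarrow> i \<le> m \<Longrightarrow> \<alpha> i = \<alpha> n"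
    using assms unfolding lasso_def by blast+
  define F where "F k = map (\<lambda>u. \<exists>i\<ge>n. i < k \<and> fulfilled fs op ts (\<alpha> i) (\<alpha> (Suc i)) ! u) [0..<length ts]" for k
  have [simp]: "length (F k) = length ts" for k by (simp add: F_def)
  have G: "(vertex p q A S H, vertex p' q' A' S' H') \<in> ?G"
    if "edge ts (vertex p q A S H) (vertex p' q' A' S' H')"
      "length A = length ts" "length S = length ts" "length H = length ts"
      "length A' = length ts" "length S' = length ts" "length H' = length ts"
    for p q A S H p' q' A' S' H' using that by (simp add: graph_def vertex_def width_def)
  have src: "source ts = vertex False False ?Z ?Z ?Z"
    by (simp add: source_def vertex_def width_def numeral_eq_Suc replicate_add)
  have dst: "target ts = vertex True True (replicate (length ts) True) (replicate (length ts) True) (replicate (length ts) True)"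
    by (simp add: target_def vertex_def width_def numeral_eq_Suc replicate_add)
  have stem: "(source ts, vertex False True (\<alpha> i) ?Z ?Z) \<in> ?G\<^sup>*" if "i \<le> n" for i
    using that
  proof (induction i)
    case 0
    have "(source ts, vertex False True (\<alpha> 0) ?Z ?Z) \<in> ?G"
      unfolding src using l(2,3) by (intro G) (auto simp: edge_def)
    thus ?case by blast
  next
    case (Suc i)
    have "(vertex False True (\<alpha> i) ?Z ?Z, vertex False True (\<alpha> (Suc i)) ?Z ?Z) \<in> ?G"
      using l(1,3,4) Suc.prems by (intro G) (auto simp: edge_def)
    thus ?case using Suc by (meson Suc_leD rtrancl.rtrancl_into_rtrancl)
  qed
  have loop: "(source ts, vertex True False (\<alpha> k) (\<alpha> n) (F k)) \<in> ?G\<^sup>*" if "n \<le> k" "k \<le> m" for k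
    using that
  proof (induction k rule: dec_induct)
    case base
    have "(vertex False True (\<alpha> n) ?Z ?Z, vertex True False (\<alpha> n) (\<alpha> n) (F n)) \<in> ?G"
      using l(1,3) by (intro G) (auto simp: edge_def list_all_length F_def)
    thus ?case using stem[of n] by (meson order_refl rtrancl.rtrancl_into_rtrancl)
  next
    case (step k)
    have lf: "length (fulfilled fs op ts (\<alpha> k) (\<alpha> (Suc k))) = length ts"
      using l(3) step.prems by (intro length_fulfilled) auto
    have "F (Suc k) = map2 (\<or>) (F k) (fulfilled fs op ts (\<alpha> k) (\<alpha> (Suc k)))"
    proof (rule nth_equalityI)
      show "length (F (Suc k)) = length (map2 (\<or>) (F k) (fulfilled fs op ts (\<alpha> k) (\<alpha> (Suc k))))"
        using lf by simp
      fix u assume "u < length (F (Suc k))"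
      hence u: "u < length ts" by simp
      have "map2 (\<or>) (F k) (fulfilled fs op ts (\<alpha> k) (\<alpha> (Suc k))) ! u =
        (F k ! u \<or> fulfilled fs op ts (\<alpha> k) (\<alpha> (Suc k)) ! u)" using u lf by simp
      thus "F (Suc k) ! u = map2 (\<or>) (F k) (fulfilled fs op ts (\<alpha> k) (\<alpha> (Suc k))) ! u"
        using u \<open>n \<le> k\<close> by (auto simp: F_def less_Suc_eq)
    qed
    hence "(vertex True False (\<alpha> k) (\<alpha> n) (F k), vertex True False (\<alpha> (Suc k)) (\<alpha> n) (F (Suc k))) \<in> ?G"
      using l(1,3,4) l(7)[of k] l(7)[of "Suc k"] step.prems \<open>n \<le> k\<close> lf by (intro G) (auto simp: edge_def)
    thus ?case using step by (meson Suc_leD rtrancl.rtrancl_into_rtrancl)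
  qed
  have "list_all (\<lambda>b. b) (F m)" using l(6) by (simp add: list_all_length F_def)
  hence "(vertex True False (\<alpha> m) (\<alpha> n) (F m), target ts) \<in> ?G"
    unfolding dst using l(1,3,5) by (intro G) (auto simp: edge_def)
  thus ?thesis using loop[of m] l(1) by (meson less_imp_le order_refl rtrancl.rtrancl_into_rtrancl)
qed

lemma reach_iff:
  "(source ts, target ts) \<in> (graph (width ts) (edge ts))\<^sup>* \<longleftrightarrow>
    (\<exists>\<phi>. build fs op ts = Some [\<phi>] \<and> sat_seq op \<phi>)"
  unfolding type_run_iff[symmetric]
  using lasso_of_path path_of_lasso type_run_of_lasso lasso_of_type_run by meson

text \<open>Beyond the absence of an unfinished token there is no test for well-formedness: a path
  to the target already shows that the tokens form a single formula.\<close>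

lemma SAT_iff:
  "x \<in> SAT {op} (set fs) \<longleftrightarrow> fst (lex x) = [] \<and>
    (source (rev (snd (snd (lex x)))), target (rev (snd (snd (lex x))))) \<in>
      (graph (width (rev (snd (snd (lex x))))) (edge (rev (snd (snd (lex x))))))\<^sup>*"
proof
  assume "x \<in> SAT {op} (set fs)"
  then obtain \<phi> where \<phi>: "x = encode \<phi>" "is_formula {op} (set fs) \<phi>" "satisfiable \<phi>" by (auto simp: SAT_def)
  obtain ts where ts: "concat (map tok_code ts) = encode \<phi>"
    "\<forall>us Fs. build fs op us = Some Fs \<longrightarrow> build fs op (ts @ us) = Some (\<phi> # Fs)"
    using build_complete[OF \<phi>(2)] by blast
  hence b: "build fs op ts = Some [\<phi>]" by (metis append_Nil2 build.simps(1))
  have "lex x = ([], [], rev ts)"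
    using lex_complete[of ts] build_sound[OF b] ts(1) \<phi>(1) by simp
  moreover have "sat_seq op \<phi>" using satisfiable_iff_sat_seq[OF \<phi>(2)] \<phi>(3) by simp
  ultimately show "fst (lex x) = [] \<and>
    (source (rev (snd (snd (lex x)))), target (rev (snd (snd (lex x))))) \<in>
      (graph (width (rev (snd (snd (lex x))))) (edge (rev (snd (snd (lex x))))))\<^sup>*"
    using reach_iff b by auto
next
  assume *: "fst (lex x) = [] \<and>
    (source (rev (snd (snd (lex x)))), target (rev (snd (snd (lex x))))) \<in>
      (graph (width (rev (snd (snd (lex x))))) (edge (rev (snd (snd (lex x))))))\<^sup>*"
  obtain cur us where l: "lex x = ([], cur, us)" using * by (cases "lex x") auto
  hence "\<exists>\<phi>. build fs op (rev us) = Some [\<phi>] \<and> sat_seq op \<phi>" using * reach_iff by simp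
  then obtain \<phi> where \<phi>: "build fs op (rev us) = Some [\<phi>]" "sat_seq op \<phi>" by blast
  have "x = encode \<phi>" "is_formula {op} (set fs) \<phi>"
    using build_sound[OF \<phi>(1)] lex_sound[OF l] by auto
  thus "x \<in> SAT {op} (set fs)" using \<phi>(2) satisfiable_iff_sat_seq by (auto simp: SAT_def)
qed

subsection \<open>Computability of the check\<close>

text \<open>For a fixed \<open>n\<close> any function of the first \<open>n\<close> bits is a finite
  decision tree. In particular each connective can be applied to its arguments on the stack.\<close>

lemma pcf_take_const:
  fixes xs :: "'a::coded \<Rightarrow> bool list" and H :: "bool list \<Rightarrow> 'b::coded"
  assumes "pcf tm xs"
  shows "pcf tm (\<lambda>x. H (take n (xs x)))"
proof -
  have "pcf tm (\<lambda>l :: bool list. H (take n l))"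
  proof (induction n arbitrary: H)
    case (Suc n)
    have 1: "pcf tm (\<lambda>l :: bool list. case l of [] \<Rightarrow> H [] | b # bs \<Rightarrow>
      if b then H (True # take n bs) else H (False # take n bs))"
      by (intro pcf_intros pcf_comp[OF pcf_snd[OF pcf_snd_base] Suc.IH[of "\<lambda>l. H (c # l)" for c]])
    have 2: "(\<lambda>l. case l of [] \<Rightarrow> H [] | b # bs \<Rightarrow>
      if b then H (True # take n bs) else H (False # take n bs)) = (\<lambda>l. H (take (Suc n) l))"
      by (auto simp: fun_eq_iff split: list.splits)
    show ?case using 1 unfolding 2 .
  qed (simp add: pcf_const)
  from pcf_comp[OF assms this] show ?thesis .
qed

lemma pcf_length_ge:
  assumes "pcf tm (xs :: 'a::coded \<Rightarrow> bool list)"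
  shows "pcf tm (\<lambda>x. n \<le> length (xs x))"
proof -
  have "(\<lambda>x. n \<le> length (xs x)) = (\<lambda>x. length (take n (xs x)) = n)" by auto
  thus ?thesis using pcf_take_const[OF assms, of "\<lambda>l. length l = n" n] by simp
qed

lemma pcf_drop_const: "pcf tm (xs :: 'a::coded \<Rightarrow> bool list) \<Longrightarrow> pcf tm (\<lambda>x. drop n (xs x))"
  using pcf_split(2)[OF pcf_const, of tm xs "replicate n True"] by simp

lemma pcf_first: "pcf tm xs \<Longrightarrow> pcf tm (\<lambda>x. first (xs x))"
proof -
  have "first l = (case l of [] \<Rightarrow> False | b # bs \<Rightarrow> b)" for l by (cases l) auto
  thus "pcf tm xs \<Longrightarrow> pcf tm (\<lambda>x. first (xs x))" by simp (intro pcf_intros)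
qed

lemma pcf_tl:
  fixes xs :: "'a::coded \<Rightarrow> 'b::coded list"
  shows "pcf tm xs \<Longrightarrow> pcf tm (\<lambda>x. tl (xs x))"
proof -
  have "tl l = (case l of [] \<Rightarrow> [] | b # bs \<Rightarrow> bs)" for l :: "'b list" by (cases l) auto
  thus "pcf tm xs \<Longrightarrow> pcf tm (\<lambda>x. tl (xs x))" by simp (intro pcf_intros)
qed

lemma pcf_canonical: "pcf tm xs \<Longrightarrow> pcf tm (\<lambda>x. canonical (xs x))"
proof -
  have "canonical l = (l = [] \<or> first (rev l))" for l by (cases l rule: rev_cases) (auto simp: canonical_def)
  thus "pcf tm xs \<Longrightarrow> pcf tm (\<lambda>x. canonical (xs x))" by simp (intro pcf_intros pcf_first)
qed

text \<open>Here finiteness of the set of connectives enters: the lookup is a fixed cascade of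
  comparisons, one for each connective.\<close>

lemma pcf_lookup:
  fixes p :: "'a::coded \<Rightarrow> bool list" and d :: "'a \<Rightarrow> 'b::coded"
  assumes "pcf tm p" "pcf tm d" "\<And>f. pcf tm (g f)"
  shows "pcf tm (\<lambda>x. case lookup gs (p x) of None \<Rightarrow> d x | Some f \<Rightarrow> g f x)"
proof (induction gs)
  case Nil
  show ?case using assms(2) by (simp add: lookup_def)
next
  case (Cons f gs)
  have "pcf tm (\<lambda>x. if p x = truth_table f then g f x else
    (case lookup gs (p x) of None \<Rightarrow> d x | Some f \<Rightarrow> g f x))"
    by (intro pcf_intros assms Cons)
  moreover have "(case lookup (f # gs) (p x) of None \<Rightarrow> d x | Some f \<Rightarrow> g f x) =
    (if p x = truth_table f then g f x else (case lookup gs (p x) of None \<Rightarrow> d x | Some f \<Rightarrow> g f x))" for x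
    by (auto simp: lookup_def)
  ultimately show ?case by simp
qed

lemma check_step_eq:
  "check_step fs op p s =
    (if fst (fst (fst p)) then
       (case fst (snd s) of [] \<Rightarrow> (False, [], True # snd (snd s)) | x # ws \<Rightarrow>
         (case ws of [] \<Rightarrow> (False, [], True # snd (snd s)) | y # us \<Rightarrow>
           (fst s \<and> snd (fst (fst p)) = op_bit op \<and> snd (fst p) = [] \<and>
            fst (snd p) = (y \<or> (x \<and> snd (snd p))), fst (snd p) # us, (\<not> fst (snd p) \<or> y) # snd (snd s))))
     else if snd (fst (fst p)) then
       (case lookup fs (snd (fst p)) of None \<Rightarrow> (False, [], True # snd (snd s))
        | Some f \<Rightarrow> (fst s \<and> arity f \<le> length (fst (snd s)) \<and>
           fst (snd p) = app f (take (arity f) (fst (snd s))),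
           fst (snd p) # drop (arity f) (fst (snd s)), True # snd (snd s)))
     else (fst s \<and> canonical (snd (fst p)), fst (snd p) # fst (snd s), True # snd (snd s)))"
proof -
  obtain t a a' ok vs fl where "p = (t, a, a')" "s = (ok, vs, fl)" by (metis prod.collapse)
  thus ?thesis by (simp only: check_step.simps fst_conv snd_conv)
qed

lemma sz_drop: "sz (drop n xs) \<le> sz (xs :: 'a::coded list)"
  using sz_append[of "take n xs" "drop n xs"] sz_pos[of "take n xs"]
  unfolding append_take_drop_id by linarith

text \<open>The growth is additive and independent of the size of the token, which is what allows
  the step to be iterated along the token list.\<close>

lemma check_step_sz: "sz (check_step fs op p s) \<le> sz s + 20"
proof -
  obtain b c pl a a' where p: "p = (((b, c), pl), a, a')" by (metis prod.collapse)
  obtain ok vs fl where s: "s = (ok, vs, fl)" by (metis prod.collapse)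
  have bit: "sz x \<le> 3" "1 \<le> sz x" for x :: bool by (cases x; simp)+
  have vs: "1 \<le> sz vs" by (cases vs) auto
  consider "b" "length vs < 2" | x y us where "b" "vs = x # y # us" | "\<not> b" "c" "lookup fs pl = None" |
    f where "\<not> b" "c" "lookup fs pl = Some f" | "\<not> b" "\<not> c"
    by (cases b; cases c; cases "lookup fs pl"; cases vs rule: remdups_adj.cases) auto
  thus ?thesis
  proof cases
    case 1
    thus ?thesis using vs bit[of ok] by (cases vs rule: remdups_adj.cases) (auto simp: p s)
  next
    case (2 x y us)
    let ?r = "ok \<and> c = op_bit op \<and> pl = [] \<and> a = (y \<or> (x \<and> a'))"
    have "check_step fs op p s = (?r, a # us, (\<not> a \<or> y) # fl)" using 2 by (simp add: p s)
    thus ?thesis using bit(1)[of ?r] bit(1)[of a] bit(1)[of "\<not> a \<or> y"] 2(2) by (simp only: code_Pair code_list.simps s) simp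
  next
    case 3
    thus ?thesis using vs by (auto simp: p s)
  next
    case (4 f)
    let ?r = "ok \<and> arity f \<le> length vs \<and> a = app f (take (arity f) vs)"
    have "check_step fs op p s = (?r, a # drop (arity f) vs, True # fl)" using 4 by (simp add: p s)
    thus ?thesis using bit(1)[of ?r] bit(1)[of a] sz_drop[of "arity f" vs] by (simp only: code_Pair code_list.simps s) simp
  next
    case 5
    have "check_step fs op p s = (ok \<and> canonical pl, a # vs, True # fl)" using 5 by (simp add: p s)
    thus ?thesis using bit(1)[of "ok \<and> canonical pl"] bit(1)[of a] by (simp only: code_Pair code_list.simps s) simp
  qed
qed

lemma pcf_check:
  fixes ts :: "'a::coded \<Rightarrow> tok list"
  assumes "pcf tm ts" "pcf tm A" "pcf tm A'"
  shows "pcf tm (\<lambda>x. check fs op (ts x) (A x) (A' x))"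
  unfolding check_def
proof (rule pcf_foldr[where q = "[:20:]"])
  show "pcf tm (\<lambda>z. check_step fs op (fst (snd z)) (snd (snd z)))"
    unfolding check_step_eq
    by (intro pcf_intros pcf_lookup pcf_canonical pcf_length_ge pcf_drop_const
      pcf_take_const[where H = "app f" for f])
  fix x :: 'a and y :: "tok \<times> bool \<times> bool" and s
  show "sz (check_step fs op y s) \<le> sz s + poly [:20:] (sz x + sz y)"
    using check_step_sz[of y s] by simp
qed (intro pcf_intros assms)+

lemma pcf_edge: "pcf tm (\<lambda>z. edge (fst z) (fst (snd z)) (snd (snd z)))"
proof -
  have vc: "pcf tm (\<lambda>x. var_consistent (ts x) (A x))" if "pcf tm ts" "pcf tm A"
    for ts :: "'a::coded \<Rightarrow> tok list" and A
    unfolding var_consistent_def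
    by (intro pcf_list_all pcf_intros that pcf_comp[OF pcf_fst_base that(1)] pcf_comp[OF pcf_fst_base that(2)])
  show ?thesis
    unfolding edge_def good_def fulfilled_def cur_def entry_def achieved_def phase1_def phase2_def
    by (intro pcf_intros pcf_first pcf_tl pcf_split pcf_check vc pcf_list_all pcf_map)
qed

lemma lex_step_sz: "sz (lex_step c s) \<le> sz s + 30"
proof -
  have r: "sz (rev l) = sz l" for l :: "bool list"
  proof (induction l)
    case (Cons b l)
    thus ?case using sz_append[of "rev l" "[b]"] by simp
  qed simp
  obtain pre cur ts where "s = (pre, cur, ts)" by (cases s) auto
  thus ?thesis using sz_pos[of cur] by (auto simp: r code_bool_def split: list.splits)
qed

lemma pcf_lex: "pcf tm lex"
proof -
  have "pcf tm (\<lambda>x. fold lex_step x ([], [], []))"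
  proof (rule pcf_fold[where q = "[:30:]"])
    have "lex_step c s = (case fst s of
      [] \<Rightarrow> ([c], [], snd (snd s))
    | a # pre' \<Rightarrow> (case pre' of
        [] \<Rightarrow> if a then ([], [], ((True, c), []) # snd (snd s)) else ([False, c], [], snd (snd s))
      | b # pre'' \<Rightarrow> (case pre'' of
          [] \<Rightarrow> if c then ([a, b, True], fst (snd s), snd (snd s))
               else ([], [], ((a, b), rev (fst (snd s))) # snd (snd s))
        | d # pre''' \<Rightarrow> ([a, b], c # fst (snd s), snd (snd s)))))" for c s
    proof -
      obtain pre cur ts where "s = (pre, cur, ts)" by (metis prod.collapse)
      thus ?thesis by (simp only: lex_step.simps fst_conv snd_conv)
    qed
    thus "pcf tm (\<lambda>z :: bool list \<times> bool \<times> bool list \<times> bool list \<times> tok list. lex_step (fst (snd z)) (snd (snd z)))"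
      by simp (intro pcf_intros)
    show "sz (lex_step y acc) \<le> sz acc + poly [:30:] (sz x + sz y)" for x :: "bool list" and y acc
      using lex_step_sz[of y acc] by simp
  qed (intro pcf_intros)+
  thus ?thesis unfolding lex_def .
qed

theorem SAT_PSPACE: "SAT {op} (set fs) \<in> PSPACE"
proof -
  let ?ts = "\<lambda>x. rev (snd (snd (lex x)))"
  let ?w = "\<lambda>x. [True, True] @ map (\<lambda>_. True) (?ts x @ ?ts x @ ?ts x)"
  have ts: "pcf False ?ts" by (intro pcf_intros pcf_lex)
  have w: "pcf False ?w" by (intro pcf_intros pcf_map ts)
  have lw: "length (?w x) = width (?ts x)" for x by (simp add: width_def)
  have "pcf False (\<lambda>x. (map (\<lambda>_. False) (?w x), map (\<lambda>_. True) (?w x)) \<in>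
    (graph (length (?w x)) (edge (?ts x)))\<^sup>*)"
  proof (rule pcf_reachable[OF w])
    show "pcf False (\<lambda>z. edge (?ts (fst z)) (fst (snd z)) (snd (snd z)))"
      by (rule pcf_app3[of False edge, OF pcf_edge]) (intro pcf_intros pcf_comp[OF pcf_fst_base ts])+
  qed (intro pcf_map pcf_intros w | simp)+
  moreover have "map (\<lambda>_. False) (?w x) = source (?ts x)" "map (\<lambda>_. True) (?w x) = target (?ts x)" for x
    unfolding source_def target_def lw[symmetric] map_replicate_const by simp_all
  ultimately have "pcf False (\<lambda>x. (source (?ts x), target (?ts x)) \<in> (graph (width (?ts x)) (edge (?ts x)))\<^sup>*)"
    by (simp only: lw)
  hence "pcf False (\<lambda>x. x \<in> SAT {op} (set fs))"
    unfolding SAT_iff by (intro pcf_intros pcf_lex)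
  from pcf_PSPACE[OF this] show ?thesis by simp
qed

end


section \<open>Terms over the clone\<close>

fun subst :: "(nat \<Rightarrow> formula) \<Rightarrow> formula \<Rightarrow> formula" where
  "subst \<sigma> (Var x) = \<sigma> x"
| "subst \<sigma> (Conn f \<phi>s) = Conn f (map (subst \<sigma>) \<phi>s)"
| "subst \<sigma> (Temp op \<phi> \<psi>) = Temp op (subst \<sigma> \<phi>) (subst \<sigma> \<psi>)"

fun beval :: "(nat \<Rightarrow> bool) \<Rightarrow> formula \<Rightarrow> bool" where
  "beval b (Var x) = b x"
| "beval b (Conn f \<phi>s) = app f (map (beval b) \<phi>s)"
| "beval b (Temp op \<phi> \<psi>) = False"

text \<open>The code of a formula with its variables left as placeholders.\<close>

fun tmpl :: "formula \<Rightarrow> (bool + nat) list" where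
  "tmpl (Var x) = [Inr x]"
| "tmpl (Conn f \<phi>s) = map Inl ([False, True] @ delimited (truth_table f)) @ concat (map tmpl \<phi>s)"
| "tmpl (Temp op \<phi> \<psi>) = map Inl [True, op_bit op] @ tmpl \<phi> @ tmpl \<psi>"

definition occ :: "nat \<Rightarrow> formula \<Rightarrow> nat" where
  "occ y T = count_list (tmpl T) (Inr y)"

lemma is_formula_Conn_iff: "is_formula M B (Conn f \<phi>s) \<longleftrightarrow>
    f \<in> B \<and> length \<phi>s = arity f \<and> (\<forall>\<phi> \<in> set \<phi>s. is_formula M B \<phi>)"
  using is_formula_ConnD by (auto intro: is_formula.intros)

lemma is_formula_Temp_iff: "is_formula M B (Temp op \<phi> \<psi>) \<longleftrightarrow>
    op \<in> M \<and> is_formula M B \<phi> \<and> is_formula M B \<psi>"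
  by (blast dest: is_formula_TempD intro: is_formula.intros)

lemma is_formula_subst:
  "is_formula {} B T \<Longrightarrow> (\<And>x. is_formula M B (\<sigma> x)) \<Longrightarrow> is_formula M B (subst \<sigma> T)"
  by (induction T) (auto simp: is_formula_Conn_iff is_formula_Temp_iff)

lemma beval_subst: "is_formula {} B T \<Longrightarrow> beval b (subst \<sigma> T) = beval (\<lambda>x. beval b (\<sigma> x)) T"
proof (induction T)
  case (Conn f \<phi>s)
  hence "map (\<lambda>\<phi>. beval b (subst \<sigma> \<phi>)) \<phi>s = map (beval (\<lambda>x. beval b (\<sigma> x))) \<phi>s"
    by (simp add: is_formula_Conn_iff)
  thus ?case by (simp only: subst.simps beval.simps list.map_comp o_def)
qed (auto simp: is_formula_Temp_iff)

lemma hs_subst: "is_formula {} B T \<Longrightarrow> hs v i (subst \<sigma> T) = beval (\<lambda>x. hs v i (\<sigma> x)) T"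
proof (induction T)
  case (Conn f \<phi>s)
  hence "map (\<lambda>\<phi>. hs v i (subst \<sigma> \<phi>)) \<phi>s = map (beval (\<lambda>x. hs v i (\<sigma> x))) \<phi>s"
    by (simp add: is_formula_Conn_iff)
  thus ?case by (simp only: subst.simps beval.simps hs.simps list.map_comp o_def)
qed (auto simp: is_formula_Temp_iff)

lemma encode_subst: "encode (subst \<sigma> T) = concat (map (case_sum (\<lambda>b. [b]) (\<lambda>x. encode (\<sigma> x))) (tmpl T))"
proof -
  have b: "concat (map (case_sum (\<lambda>b. [b]) g \<circ> Inl) bs) = bs" for g :: "nat \<Rightarrow> bool list" and bs
    by (induction bs) auto
  show ?thesis
  proof (induction T)
    case (Conn f \<phi>s)
    have "concat (map (encode \<circ> subst \<sigma>) \<phi>s) =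
      concat (map (case_sum (\<lambda>b. [b]) (\<lambda>x. encode (\<sigma> x))) (concat (map tmpl \<phi>s)))"
      using Conn by (induction \<phi>s) auto
    thus ?case by (simp add: b)
  qed (auto simp: encode_Temp)
qed

lemma tmpl_subst: "tmpl (subst \<sigma> T) = concat (map (case_sum (\<lambda>b. [Inl b]) (\<lambda>x. tmpl (\<sigma> x))) (tmpl T))"
proof -
  have b: "concat (map (case_sum (\<lambda>b. [Inl b]) g \<circ> Inl) bs) = map Inl bs" for g :: "nat \<Rightarrow> (bool + nat) list" and bs
    by (induction bs) auto
  show ?thesis
  proof (induction T)
    case (Conn f \<phi>s)
    have "concat (map (tmpl \<circ> subst \<sigma>) \<phi>s) =
      concat (map (case_sum (\<lambda>b. [Inl b]) (\<lambda>x. tmpl (\<sigma> x))) (concat (map tmpl \<phi>s)))"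
      using Conn by (induction \<phi>s) auto
    thus ?case by (simp add: b)
  qed auto
qed

lemma occ_subst:
  assumes "\<And>x. x \<noteq> z \<Longrightarrow> occ y (\<sigma> x) = 0"
  shows "occ y (subst \<sigma> T) = occ z T * occ y (\<sigma> z)"
proof -
  have "count_list (concat (map (case_sum (\<lambda>b. [Inl b]) (\<lambda>x. tmpl (\<sigma> x))) w)) (Inr y) =
    count_list w (Inr z) * occ y (\<sigma> z)" for w
  proof (induction w)
    case (Cons s w)
    thus ?case using assms by (cases s) (auto simp: occ_def)
  qed simp
  thus ?thesis by (simp add: occ_def tmpl_subst)
qed

lemma occ_Var: "occ y (Var x) = (if x = y then 1 else 0)"
  by (simp add: occ_def)

lemma occ_Conn: "occ y (Conn f \<phi>s) = sum_list (map (occ y) \<phi>s)"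
proof -
  have b: "count_list (map Inl bs) (Inr y) = 0" for bs :: "bool list" by (induction bs) auto
  have "count_list (concat (map tmpl \<phi>s)) (Inr y) = sum_list (map (occ y) \<phi>s)"
    by (induction \<phi>s) (auto simp: occ_def)
  thus ?thesis by (simp add: occ_def b)
qed

text \<open>Projections become variables, composition becomes substitution.\<close>

lemma clone_term:
  "f \<in> clone B \<Longrightarrow> \<exists>T. is_formula {} B T \<and> (\<forall>b. beval b T = app f (map b [0..<arity f]))"
proof (induction rule: clone.induct)
  case (base f)
  have "beval b (Conn f (map Var [0..<arity f])) = app f (map b [0..<arity f])" for b
    by (simp add: comp_def)
  moreover have "is_formula {} B (Conn f (map Var [0..<arity f]))"
    using base by (auto simp: is_formula_Conn_iff intro: is_formula.intros)
  ultimately show ?case by blast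
next
  case (proj i n)
  show ?case
    by (rule exI[of _ "Var i"]) (use proj in \<open>auto simp: projection_def intro: is_formula.intros\<close>)
next
  case (comp f gs m)
  obtain T where T: "is_formula {} B T" "\<And>b. beval b T = app f (map b [0..<arity f])" using comp.IH(1) by blast
  have "\<forall>g \<in> set gs. \<exists>U. is_formula {} B U \<and> (\<forall>b. beval b U = app g (map b [0..<m]))" using comp.IH(2) by auto
  then obtain U where U: "\<And>g. g \<in> set gs \<Longrightarrow> is_formula {} B (U g)"
    "\<And>g b. g \<in> set gs \<Longrightarrow> beval b (U g) = app g (map b [0..<m])" by metis
  define \<sigma> where "\<sigma> j = (if j < length gs then U (gs ! j) else Var 0)" for j
  have "beval b (subst \<sigma> T) = app (compose m f gs) (map b [0..<arity (compose m f gs)])" for b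
  proof -
    have "map (\<lambda>j. beval b (\<sigma> j)) [0..<arity f] = map (\<lambda>g. app g (map b [0..<m])) gs"
      using comp.hyps(2) U(2) by (intro nth_equalityI) (auto simp: \<sigma>_def)
    thus ?thesis using beval_subst[OF T(1), of b \<sigma>] T(2) by (simp add: compose_def)
  qed
  moreover have "is_formula {} B (subst \<sigma> T)"
    by (rule is_formula_subst[OF T(1)]) (auto simp: \<sigma>_def U(1) intro: is_formula.intros)
  ultimately show ?case by blast
qed

lemma clone_and_terms:
  assumes "S1 \<subseteq> clone B"
  obtains TA TN where "is_formula {} B TA" "\<And>b. beval b TA = (b 0 \<and> b 1)"
    "is_formula {} B TN" "\<And>b. beval b TN = (b 0 \<and> \<not> b 1)"
proof -
  let ?a = "mk_boolfun 2 (\<lambda>xs. xs ! 0 \<and> xs ! 1)" and ?n = "mk_boolfun 2 (\<lambda>xs. xs ! 0 \<and> \<not> xs ! 1)"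
  have "?a \<in> S1" "?n \<in> S1" unfolding S1_def by (auto intro!: exI[of _ 0])
  hence cl: "?a \<in> clone B" "?n \<in> clone B" using assms by blast+
  obtain TA where TA: "is_formula {} B TA" "\<And>b. beval b TA = app ?a (map b [0..<2])"
    using clone_term[OF cl(1)] by auto
  obtain TN where TN: "is_formula {} B TN" "\<And>b. beval b TN = app ?n (map b [0..<2])"
    using clone_term[OF cl(2)] by auto
  show ?thesis using that[OF TA(1) _ TN(1)] TA(2) TN(2) by (simp add: numeral_2_eq_2)
qed

subsection \<open>Contexts with a single hole\<close>

text \<open>
  Connectives of the clone may need several copies of an argument, so nesting them could blow up
  exponentially. Replacing the occurrences of a variable one at a time, by constants, isolates a
  single occurrence on which the value depends. Variable 1 is the hole; variables 2 and 3 serve as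
  the constants true and false.
\<close>

definition is_context :: "boolfun set \<Rightarrow> formula \<Rightarrow> bool" where
  "is_context B C \<longleftrightarrow> is_formula {} B C \<and> occ 1 C = 1"

definition plug :: "nat \<Rightarrow> formula \<Rightarrow> formula" where
  "plug c = subst (\<lambda>n. if n = 1 then Var c else Var n)"

lemma plug_simps: "plug c (Var n) = Var (if n = 1 then c else n)"
  "plug c (Conn f \<phi>s) = Conn f (map (plug c) \<phi>s)"
  by (simp_all add: plug_def)

lemma occ_plug: "c \<noteq> 1 \<Longrightarrow> occ 1 (plug c T) = 0"
  using occ_subst[of 1 1 "\<lambda>n. if n = 1 then Var c else Var n" T] by (auto simp: occ_Var plug_def)

lemma is_formula_plug: "is_formula {} B T \<Longrightarrow> is_formula {} B (plug c T)"
  unfolding plug_def by (rule is_formula_subst) (auto intro: is_formula.intros)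

lemma plug_no_occ: "is_formula {} B T \<Longrightarrow> occ 1 T = 0 \<Longrightarrow> plug c T = T"
proof (induction T)
  case (Conn f \<phi>s)
  thus ?case by (auto simp: is_formula_Conn_iff occ_Conn plug_simps intro!: map_idI)
qed (auto simp: occ_Var is_formula_Temp_iff plug_simps split: if_splits)

text \<open>One step switches a single occurrence from the variable for false to the one for true;
  all other occurrences are already fixed inside \<open>C\<close>.\<close>

definition hole_steps :: "boolfun set \<Rightarrow> (formula \<times> formula) set" where
  "hole_steps B = {(plug 3 C, plug 2 C) | C. is_context B C}"

lemma hole_steps_Conn:
  assumes "(a, b) \<in> (hole_steps B)\<^sup>*" "f \<in> B" "length us + length vs + 1 = arity f"
    "\<forall>u \<in> set us \<union> set vs. is_formula {} B u \<and> occ 1 u = 0"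
  shows "(Conn f (us @ a # vs), Conn f (us @ b # vs)) \<in> (hole_steps B)\<^sup>*"
  using assms(1)
proof (induction rule: rtrancl_induct)
  case (step b c)
  obtain C where C: "is_context B C" "b = plug 3 C" "c = plug 2 C"
    using step(2) by (auto simp: hole_steps_def)
  have id: "map (plug c) us = us" "map (plug c) vs = vs" for c
    using assms(4) by (auto intro!: map_idI plug_no_occ[of B])
  have "sum_list (map (occ 1) us) = 0" "sum_list (map (occ 1) vs) = 0" using assms(4) by auto
  hence "is_context B (Conn f (us @ C # vs))"
    using C(1) assms(2-4) by (auto simp: is_context_def is_formula_Conn_iff occ_Conn)
  hence "(Conn f (us @ b # vs), Conn f (us @ c # vs)) \<in> hole_steps B"
    unfolding hole_steps_def using id C(2,3)
    by (intro CollectI exI[of _ "Conn f (us @ C # vs)"]) (auto simp: plug_simps)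
  thus ?case using step by (meson rtrancl.rtrancl_into_rtrancl)
qed simp

lemma hole_steps_subst:
  "is_formula {} B T \<Longrightarrow> (plug 3 T, plug 2 T) \<in> (hole_steps B)\<^sup>*"
proof (induction T)
  case (Var x)
  show ?case
  proof (cases "x = 1")
    case True
    have "is_context B (Var 1)" by (auto simp: is_context_def occ_Var intro: is_formula.intros)
    thus ?thesis unfolding True hole_steps_def by (intro r_into_rtrancl CollectI exI[of _ "Var 1"]) auto
  qed (simp add: plug_simps)
next
  case (Conn f \<phi>s)
  let ?s = "plug 3" and ?t = "plug 2"
  have F: "f \<in> B" "length \<phi>s = arity f" "\<forall>\<phi> \<in> set \<phi>s. is_formula {} B \<phi>" using Conn.prems by (auto simp: is_formula_Conn_iff)
  \<comment> \<open>Arguments are switched from left to right; \<open>us\<close> collects those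
    already switched, in which variable 1 no longer occurs.\<close>
  have "(Conn f (us @ map ?s \<psi>s), Conn f (us @ map ?t \<psi>s)) \<in> (hole_steps B)\<^sup>*"
    if "set \<psi>s \<subseteq> set \<phi>s" "length us + length \<psi>s = arity f"
      "\<forall>u \<in> set us. is_formula {} B u \<and> occ 1 u = 0" for us \<psi>s
    using that
  proof (induction \<psi>s arbitrary: us)
    case (Cons \<psi> \<psi>s)
    have "(?s \<psi>, ?t \<psi>) \<in> (hole_steps B)\<^sup>*" by (rule Conn.IH) (use F(3) Cons.prems(1) in auto)
    hence "(Conn f (us @ ?s \<psi> # map ?s \<psi>s), Conn f (us @ ?t \<psi> # map ?s \<psi>s)) \<in> (hole_steps B)\<^sup>*"
      using Cons.prems F by (intro hole_steps_Conn) (auto simp: occ_plug[simplified] is_formula_plug)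
    moreover have "(Conn f ((us @ [?t \<psi>]) @ map ?s \<psi>s), Conn f ((us @ [?t \<psi>]) @ map ?t \<psi>s)) \<in> (hole_steps B)\<^sup>*"
      using Cons.prems F(3) by (intro Cons.IH) (auto simp: occ_plug[simplified] is_formula_plug)
    ultimately show ?case by (auto elim: rtrancl_trans)
  qed simp
  from this[of \<phi>s "[]"] F(2) show ?case by (simp add: plug_simps)
qed (simp add: is_formula_Temp_iff)

definition val :: "bool \<Rightarrow> bool \<Rightarrow> nat \<Rightarrow> bool" where
  "val x y n = (if n = 0 then x else if n = 1 then y else n = 2)"

lemma beval_hole:
  assumes "is_formula {} B C"
  shows "beval (val x y) (plug 3 C) = beval (val x False) C"
    "beval (val x y) (plug 2 C) = beval (val x True) C"
proof -
  have "(\<lambda>n. beval (val x y) (if n = 1 then Var 3 else Var n)) = val x False"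
    "(\<lambda>n. beval (val x y) (if n = 1 then Var 2 else Var n)) = val x True"
    by (auto simp: val_def fun_eq_iff)
  thus "beval (val x y) (plug 3 C) = beval (val x False) C"
    "beval (val x y) (plug 2 C) = beval (val x True) C"
    using beval_subst[OF assms] by (simp_all add: plug_def)
qed

text \<open>If no single switch lowered the value at \<open>x = True\<close>, it could not fall
  along the whole chain of switches.\<close>

lemma negation_context:
  assumes "is_formula {} B T" "beval (val True False) T" "\<not> beval (val True True) T"
  shows "\<exists>C. is_context B C \<and> beval (val True False) C \<and> \<not> beval (val True True) C"
proof (rule ccontr)
  assume no: "\<not> ?thesis"
  let ?e = "beval (val True True)"
  have "?e a \<longrightarrow> ?e b" if "(a, b) \<in> (hole_steps B)\<^sup>*" for a b
    using that
  proof (induction rule: rtrancl_induct)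
    case (step b c)
    obtain C where "is_context B C" "b = plug 3 C" "c = plug 2 C"
      using step(2) by (auto simp: hole_steps_def)
    thus ?case using step no beval_hole[of B C] by (auto simp: is_context_def)
  qed simp
  from this[OF hole_steps_subst[OF assms(1)]] show False using beval_hole[OF assms(1)] assms by simp
qed

text \<open>A parity argument: along the chain the value at \<open>x = True\<close> changes an odd
  number of times and the value at \<open>x = False\<close> an even number, so some switch changes
  exactly one of them.\<close>

lemma selecting_context:
  assumes "is_formula {} B T" "beval (val True False) T \<noteq> beval (val True True) T"
    "beval (val False False) T = beval (val False True) T"
  shows "\<exists>C. is_context B C \<and> (beval (val True False) C \<noteq> beval (val True True) C) \<noteq>
    (beval (val False False) C \<noteq> beval (val False True) C)"
proof (rule ccontr)
  assume no: "\<not> ?thesis"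
  let ?e = "\<lambda>x. beval (val x True)"
  have "(?e True a \<noteq> ?e True b) = (?e False a \<noteq> ?e False b)" if "(a, b) \<in> (hole_steps B)\<^sup>*" for a b
    using that
  proof (induction rule: rtrancl_induct)
    case (step b c)
    obtain C where "is_context B C" "b = plug 3 C" "c = plug 2 C"
      using step(2) by (auto simp: hole_steps_def)
    hence "(?e True b \<noteq> ?e True c) = (?e False b \<noteq> ?e False c)"
      using no beval_hole[of B C] by (auto simp: is_context_def)
    thus ?case using step.IH by argo
  qed simp
  from this[OF hole_steps_subst[OF assms(1)]] show False using beval_hole[OF assms(1)] assms by simp
qed

theorem conjunction_context:
  assumes "S1 \<subseteq> clone B"
  shows "\<exists>E. is_context B E \<and> (\<forall>b. b 2 \<longrightarrow> beval b E = (b 1 \<and> \<not> b 0))"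
proof -
  obtain TA TN where T: "is_formula {} B TA" "\<And>b. beval b TA = (b 0 \<and> b 1)"
    "is_formula {} B TN" "\<And>b. beval b TN = (b 0 \<and> \<not> b 1)" using clone_and_terms[OF assms] by blast
  obtain N where N: "is_context B N" "beval (val True False) N" "\<not> beval (val True True) N"
    using negation_context[OF T(3)] T(4) by (auto simp: val_def)
  obtain C where C: "is_context B C" "(beval (val True False) C \<noteq> beval (val True True) C) \<noteq>
    (beval (val False False) C \<noteq> beval (val False True) C)"
    using selecting_context[OF T(1)] T(2) by (auto simp: val_def)
  \<comment> \<open>The constant false, as true and not true.\<close>
  let ?Z = "subst (\<lambda>_. Var 2) TN"
  define fill where "fill D x y = subst (\<lambda>n. if n = 0 then x else if n = 1 then y else if n = 2 then Var 2 else ?Z) D"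
    for D x y
  have var: "is_formula {} B (Var n)" for n by (rule is_formula.intros)
  have Z: "is_formula {} B ?Z" "\<And>b. \<not> beval b ?Z" "occ 1 ?Z = 0"
    using is_formula_subst[OF T(3), of "{}" "\<lambda>_. Var 2"] var beval_subst[OF T(3)] T(4)
      occ_subst[of 1 1 "\<lambda>_. Var 2" TN] by (auto simp: occ_Var)
  have fill: "is_context B (fill D x y)"
    if "is_context B D" "is_formula {} B x" "occ 1 x = 0" "is_context B y" for D x y
  proof -
    have "occ 1 (fill D x y) = occ 1 D * occ 1 y" unfolding fill_def
      by (subst occ_subst[where z = 1]) (use that Z in \<open>auto simp: occ_Var\<close>)
    moreover have "is_formula {} B (fill D x y)" unfolding fill_def
      by (rule is_formula_subst) (use that Z var in \<open>auto simp: is_context_def\<close>)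
    ultimately show ?thesis using that by (simp add: is_context_def)
  qed
  have ev: "beval b (fill D x y) = beval (val (beval b x) (beval b y)) D" if "is_context B D" "b 2" for D x y b
  proof -
    have "(\<lambda>n. beval b (if n = 0 then x else if n = 1 then y else if n = 2 then Var 2 else ?Z)) =
      val (beval b x) (beval b y)"
      using Z(2) that(2) by (auto simp: val_def fun_eq_iff)
    thus ?thesis using that(1) beval_subst[of B D] by (simp add: fill_def is_context_def)
  qed
  \<comment> \<open>\<open>N\<close> is a negation when its variable 0 is true, which
    \<open>Var 2\<close> provides.\<close>
  define neg where "neg y = fill N (Var 2) y" for y
  have neg: "is_context B y \<Longrightarrow> is_context B (neg y)" "b 2 \<Longrightarrow> beval b (neg y) = (\<not> beval b y)" for y b
  proof -
    show "is_context B y \<Longrightarrow> is_context B (neg y)"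
      unfolding neg_def using N(1) var by (intro fill) (auto simp: occ_Var)
    show "b 2 \<Longrightarrow> beval b (neg y) = (\<not> beval b y)"
      unfolding neg_def using N by (cases "beval b y") (simp_all add: ev)
  qed
  \<comment> \<open>\<open>dep\<close> tells at which value of its variable 0 the context
    \<open>C\<close> depends on the hole; \<open>x\<close> is variable 0 or its negation, so that
    the dependence always occurs where \<open>b 0\<close> is false.\<close>
  define dep where "dep = (beval (val False False) C \<noteq> beval (val False True) C)"
  define x where "x = (if dep then Var 0 else subst (\<lambda>n. if n = 0 then Var 2 else Var 0) TN)"
  have x: "is_formula {} B x" "occ 1 x = 0" "b 2 \<Longrightarrow> beval b x = (b 0 = dep)" for b
    using is_formula_subst[OF T(3), of "{}" "\<lambda>n. if n = 0 then Var 2 else Var 0"] var beval_subst[OF T(3)] T(4)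
      occ_subst[of 1 1 "\<lambda>n. if n = 0 then Var 2 else Var 0" TN] by (auto simp: x_def occ_Var)
  define e where "e v y = beval (val (v = dep) y) C" for v y
  have e: "e False False \<noteq> e False True" "e True False = e True True"
    using C(2) by (auto simp: e_def dep_def)
  have G: "is_context B y \<Longrightarrow> is_context B (fill C x y)" "b 2 \<Longrightarrow> beval b (fill C x y) = e (b 0) (beval b y)" for y b
    using fill[OF C(1) x(1,2)] ev[OF C(1)] x(3) by (auto simp: e_def)
  have V: "is_context B (Var 1)" using var by (simp add: is_context_def occ_Var)
  \<comment> \<open>As \<open>e\<close> depends on its second argument at \<open>v = False\<close>
    only, two free bits and thus four functions remain. Negating the argument, the value, or both
    turns each of them into \<open>y \<and> \<not> v\<close>.\<close>
  consider "\<not> e False False" "\<not> e True False" | "\<not> e False False" "e True False" |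
    "e False False" "\<not> e True False" | "e False False" "e True False" by blast
  thus ?thesis
  proof cases
    case 1
    have "e v y = (y \<and> \<not> v)" for v y using 1 e by (cases v; cases y) auto
    thus ?thesis using G V by (intro exI[of _ "fill C x (Var 1)"]) auto
  next
    case 2
    have "e v y = (y \<or> v)" for v y using 2 e by (cases v; cases y) auto
    thus ?thesis using G V neg by (intro exI[of _ "neg (fill C x (neg (Var 1)))"]) auto
  next
    case 3
    have "e v y = (\<not> y \<and> \<not> v)" for v y using 3 e by (cases v; cases y) auto
    thus ?thesis using G V neg by (intro exI[of _ "fill C x (neg (Var 1))"]) auto
  next
    case 4
    have "e v y = (\<not> y \<or> v)" for v y using 4 e by (cases v; cases y) auto
    thus ?thesis using G V neg by (intro exI[of _ "neg (fill C x (Var 1))"]) auto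
  qed
qed

section \<open>Rule networks as formulae\<close>

text \<open>
  Facts are propositional variables. A rule derives a fact of the next stage from facts of the
  current one; \<open>alive\<close> is derived as long as the simulated machine has not accepted.
\<close>

fun stage :: "nat set \<Rightarrow> (nat list \<times> nat) set \<Rightarrow> nat \<Rightarrow> nat set" where
  "stage I Rs 0 = I"
| "stage I Rs (Suc n) = {l. \<exists>P. (P, l) \<in> Rs \<and> set P \<subseteq> stage I Rs n}"

record names =
  phA :: nat
  phB :: nat
  always :: nat
  start :: nat
  alive :: nat

context
  fixes op :: temporal_op and TA TN E :: formula and nm :: names
begin

definition And :: "formula \<Rightarrow> formula \<Rightarrow> formula" where
  "And \<phi> \<psi> = subst (\<lambda>n. if n = 0 then \<phi> else \<psi>) TA"

definition Minus :: "formula \<Rightarrow> formula \<Rightarrow> formula" where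
  "Minus \<phi> \<psi> = subst (\<lambda>n. if n = 0 then \<phi> else \<psi>) TN"

text \<open>The long rest of a chain goes to variable 1, which occurs once; the refused formula,
  which may be copied, is short. \<open>always nm\<close> supplies the constant true that
  \<open>E\<close> presupposes.\<close>

definition Refuse :: "formula \<Rightarrow> formula \<Rightarrow> formula" where
  "Refuse \<phi> \<psi> = subst (\<lambda>n. if n = 0 then \<phi> else if n = 1 then \<psi> else Var (always nm)) E"

definition chain :: "formula list \<Rightarrow> formula" where
  "chain \<phi>s = foldr Refuse \<phi>s (Var (always nm))"

text \<open>
  There is no next-time operator, so two alternating phases mark the stages: all states of a block
  of equal phase may repeat, and a rule constrains the first state of the following block. The end
  of the computation is marked by both phase variables.
\<close>

definition phase :: "bool \<Rightarrow> formula" where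
  "phase c = (if c then Minus (Var (phB nm)) (Var (phA nm)) else Minus (Var (phA nm)) (Var (phB nm)))"

text \<open>\<open>And\<close> may copy its arguments, but the premises of a rule are bounded in
  number for a fixed machine. The conjunct \<open>alive\<close> releases all rules once the machine
  has accepted, so that the sequence may end.\<close>

definition violation :: "bool \<Rightarrow> nat list \<Rightarrow> nat \<Rightarrow> formula" where
  "violation c P l = Minus (foldr (\<lambda>p. And (Var p)) P (And (phase c) (Var (alive nm))))
    (Temp op (phase c) (And (phase (\<not> c)) (Var l)))"

definition start_violation :: "nat \<Rightarrow> formula" where
  "start_violation l = Minus (Var (start nm)) (Var l)"

text \<open>The variable \<open>start\<close> is asserted at the first state only, while the chain
  holds at every state before the end; thus a refused \<open>start_violation\<close> can demand an
  initial fact without demanding it later.\<close>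

definition network_formula :: "formula list \<Rightarrow> formula" where
  "network_formula \<phi>s = And (Var (start nm)) (And (phase False)
    (Temp op (And (Var (always nm)) (chain \<phi>s)) (And (Var (phA nm)) (Var (phB nm)))))"

context
  fixes B :: "boolfun set"
  assumes TA: "is_formula {} B TA" "\<And>b. beval b TA = (b 0 \<and> b 1)"
    and TN: "is_formula {} B TN" "\<And>b. beval b TN = (b 0 \<and> \<not> b 1)"
    and E: "is_context B E" "\<And>b. b 2 \<Longrightarrow> beval b E = (b 1 \<and> \<not> b 0)"
begin

lemma hs_And [simp]: "hs v i (And \<phi> \<psi>) = (hs v i \<phi> \<and> hs v i \<psi>)"
  by (simp add: And_def hs_subst[OF TA(1)] TA(2))

lemma hs_Minus [simp]: "hs v i (Minus \<phi> \<psi>) = (hs v i \<phi> \<and> \<not> hs v i \<psi>)"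
  by (simp add: Minus_def hs_subst[OF TN(1)] TN(2))

lemma hs_Refuse [simp]: "v i (always nm) \<Longrightarrow> hs v i (Refuse \<phi> \<psi>) = (hs v i \<psi> \<and> \<not> hs v i \<phi>)"
  using E(1) by (simp add: Refuse_def hs_subst[of B E] is_context_def E(2))

lemma is_formula_connectives:
  "is_formula M B \<phi> \<Longrightarrow> is_formula M B \<psi> \<Longrightarrow> is_formula M B (And \<phi> \<psi>)"
  "is_formula M B \<phi> \<Longrightarrow> is_formula M B \<psi> \<Longrightarrow> is_formula M B (Minus \<phi> \<psi>)"
  "is_formula M B \<phi> \<Longrightarrow> is_formula M B \<psi> \<Longrightarrow> is_formula M B (Refuse \<phi> \<psi>)"
  unfolding And_def Minus_def Refuse_def
  using TA(1) TN(1) E(1) by (auto intro!: is_formula_subst is_formula.intros simp: is_context_def)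

lemma hs_chain: "v i (always nm) \<Longrightarrow> hs v i (chain \<phi>s) = (\<forall>\<phi> \<in> set \<phi>s. \<not> hs v i \<phi>)"
  by (induction \<phi>s) (auto simp: chain_def)

lemma is_formula_chain:
  "(\<And>\<phi>. \<phi> \<in> set \<phi>s \<Longrightarrow> is_formula M B \<phi>) \<Longrightarrow> is_formula M B (chain \<phi>s)"
  by (induction \<phi>s) (auto simp: chain_def intro: is_formula_connectives is_formula.intros)

lemma is_formula_phase: "is_formula M B (phase c)"
  by (auto simp: phase_def intro!: is_formula_connectives is_formula.intros)

lemma is_formula_violation: "is_formula {op} B (violation c P l)"
proof -
  have "is_formula {op} B (foldr (\<lambda>p. And (Var p)) P (And (phase c) (Var (alive nm))))"
    by (induction P) (auto intro!: is_formula_connectives is_formula_phase is_formula.intros)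
  thus ?thesis unfolding violation_def
    by (auto intro!: is_formula_connectives is_formula_phase is_formula.intros)
qed

lemma is_formula_start_violation: "is_formula M B (start_violation l)"
  unfolding start_violation_def by (intro is_formula_connectives is_formula.intros)

lemma is_formula_network:
  "(\<And>\<phi>. \<phi> \<in> set \<phi>s \<Longrightarrow> is_formula {op} B \<phi>) \<Longrightarrow> is_formula {op} B (network_formula \<phi>s)"
  unfolding network_formula_def
  by (auto intro!: is_formula_connectives is_formula_phase is_formula_chain is_formula.intros)

lemma hs_phase: "hs v i (phase c) = (if c then v i (phB nm) \<and> \<not> v i (phA nm) else v i (phA nm) \<and> \<not> v i (phB nm))"
  by (simp add: phase_def)

lemma hs_violation:
  "hs v i (violation c P l) \<longleftrightarrow> (\<forall>p \<in> set P. v i p) \<and> hs v i (phase c) \<and> v i (alive nm) \<and>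
    \<not> (\<exists>k\<ge>i. hs v k (phase (\<not> c)) \<and> v k l \<and> (\<forall>j. i \<le> j \<and> j < k \<longrightarrow> hs v j (phase c)))"
proof -
  have "hs v i (foldr (\<lambda>p. And (Var p)) P \<psi>) = ((\<forall>p \<in> set P. v i p) \<and> hs v i \<psi>)" for \<psi>
    by (induction P) auto
  thus ?thesis by (simp add: violation_def)
qed

lemma hs_start_violation: "hs v i (start_violation l) \<longleftrightarrow> v i (start nm) \<and> \<not> v i l"
  by (simp add: start_violation_def)

theorem network_sat:
  assumes dist: "distinct [phA nm, phB nm, always nm, start nm]"
    and sep: "\<And>P l. (P, l) \<in> Rs \<Longrightarrow> (insert l (set P)) \<inter> {phA nm, phB nm, always nm, start nm} = {}"
      "I \<inter> {phA nm, phB nm, always nm, start nm} = {}" "alive nm \<notin> {phA nm, phB nm, always nm, start nm}"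
    and \<phi>s: "set \<phi>s = {violation c P l | c P l. (P, l) \<in> Rs} \<union> start_violation ` I"
  shows "sat_seq op (network_formula \<phi>s) \<longleftrightarrow> (\<exists>n. alive nm \<notin> stage I Rs n)"
proof
  assume "\<exists>n. alive nm \<notin> stage I Rs n"
  define n where "n = (LEAST n. alive nm \<notin> stage I Rs n)"
  have n: "alive nm \<notin> stage I Rs n" "\<And>i. i < n \<Longrightarrow> alive nm \<in> stage I Rs i"
    unfolding n_def using LeastI_ex[OF \<open>\<exists>n. alive nm \<notin> stage I Rs n\<close>] not_less_Least by blast+
  let ?S = "{phA nm, phB nm, always nm, start nm}"
  \<comment> \<open>State \<open>i\<close> carries exactly stage \<open>i\<close> and the phase
    given by the parity of \<open>i\<close>; all states after \<open>n\<close> carry the end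
    mark.\<close>
  define v where "v i x = (if i \<le> n then (x \<in> stage I Rs i \<and> x \<notin> ?S) \<or> (x = phA nm \<and> even i) \<or>
      (x = phB nm \<and> odd i) \<or> x = always nm \<or> (x = start nm \<and> i = 0)
    else x = phA nm \<or> x = phB nm)" for i x
  have fact: "v i x \<longleftrightarrow> x \<in> stage I Rs i" if "x \<notin> ?S" "i \<le> n" for i x using that by (auto simp: v_def)
  have ph: "hs v i (phase c) \<longleftrightarrow> odd i = c" if "i \<le> n" for i c
    using that dist by (auto simp: hs_phase v_def)
  have "\<not> hs v i \<phi>" if i: "i \<le> n" and \<phi>: "\<phi> \<in> set \<phi>s" for i \<phi>
  proof
    assume h: "hs v i \<phi>"
    from \<phi> consider c P l where "\<phi> = violation c P l" "(P, l) \<in> Rs" | l where "\<phi> = start_violation l" "l \<in> I"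
      unfolding \<phi>s by blast
    thus False
    proof cases
      case (1 c P l)
      hence P: "\<forall>p \<in> set P. v i p" "hs v i (phase c)" "v i (alive nm)" using h by (auto simp: hs_violation)
      have "alive nm \<in> stage I Rs i" using P(3) fact[OF sep(3) i] by simp
      hence "i < n" using n(1) i by (cases "i = n") auto
      have "set P \<subseteq> stage I Rs i" using P(1) fact[OF _ i] sep(1)[OF 1(2)] by blast
      hence "l \<in> stage I Rs (Suc i)" using 1(2) by auto
      hence "v (Suc i) l" using fact[of l "Suc i"] sep(1)[OF 1(2)] \<open>i < n\<close> by auto
      moreover have "hs v (Suc i) (phase (\<not> c))" using ph[of "Suc i"] ph[OF i] P(2) \<open>i < n\<close> by auto
      moreover have "\<forall>j. i \<le> j \<and> j < Suc i \<longrightarrow> hs v j (phase c)" using P(2) by (auto simp: less_Suc_eq)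
      ultimately have "\<exists>k\<ge>i. hs v k (phase (\<not> c)) \<and> v k l \<and> (\<forall>j. i \<le> j \<and> j < k \<longrightarrow> hs v j (phase c))"
        by (intro exI[of _ "Suc i"]) simp
      thus False using h unfolding 1(1) hs_violation by blast
    next
      case (2 l)
      hence "v i (start nm)" "\<not> v i l" using h by (auto simp: hs_start_violation)
      moreover from this(1) i dist sep(2) have "i = 0" by (auto simp: v_def)
      ultimately show False using 2 fact[of l 0] sep(2) by auto
    qed
  qed
  hence "hs v i (And (Var (always nm)) (chain \<phi>s))" if "i \<le> n" for i
    using that hs_chain[of v i] by (simp add: v_def)
  moreover have "v (Suc n) (phA nm)" "v (Suc n) (phB nm)" by (auto simp: v_def)
  moreover have "hs v 0 (phase False)" "v 0 (start nm)" using ph[of 0 False] by (auto simp: v_def)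
  ultimately have "hs v 0 (network_formula \<phi>s)"
    unfolding network_formula_def by (auto intro!: exI[of _ "Suc n"] simp del: hs_And simp: hs_And[of v _ "Var _" "And _ _"]
      hs_And[of v _ "Var (phA nm)" "Var (phB nm)"] hs_And[of v _ "phase False"])
  moreover have "v j = v (Suc n)" if "j \<ge> Suc n" for j using that by (auto simp: v_def fun_eq_iff)
  hence "seq_ok op v" unfolding seq_ok_def by blast
  ultimately show "sat_seq op (network_formula \<phi>s)" unfolding sat_seq_def by blast
next
  assume "sat_seq op (network_formula \<phi>s)"
  then obtain v where v: "hs v 0 (network_formula \<phi>s)" unfolding sat_seq_def by blast
  then obtain k where k: "v 0 (start nm)" "hs v 0 (phase False)" "v k (phA nm)" "v k (phB nm)"
    "\<And>j. j < k \<Longrightarrow> v j (always nm) \<and> hs v j (chain \<phi>s)"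
    unfolding network_formula_def by auto
  have notend: "\<not> hs v k (phase c)" for c using k(3,4) by (simp add: hs_phase)
  have excl: "hs v i (phase c) \<Longrightarrow> \<not> hs v i (phase (\<not> c))" for i c by (auto simp: hs_phase split: if_splits)
  have viol: "\<not> hs v j \<phi>" if "j < k" "\<phi> \<in> set \<phi>s" for j \<phi> using k(5)[OF that(1)] hs_chain that(2) by blast
  show "\<exists>n. alive nm \<notin> stage I Rs n"
  proof (rule ccontr)
    assume "\<not> ?thesis"
    hence running: "alive nm \<in> stage I Rs n" for n by blast
    \<comment> \<open>Every stage occupies a block of at least one state before the end, so stage
      \<open>n\<close> begins no earlier than state \<open>n\<close>. Taking \<open>n = k\<close> is
      absurd.\<close>
    have "\<exists>s. n \<le> s \<and> s < k \<and> hs v s (phase (odd n)) \<and> (\<forall>x \<in> stage I Rs n. v s x)" for n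
    proof (induction n)
      case 0
      have "0 < k" using notend[of False] k(2) by (cases k) auto
      moreover have "v 0 x" if "x \<in> I" for x
        using viol[OF \<open>0 < k\<close>, of "start_violation x"] that \<phi>s k(1) by (auto simp: hs_start_violation)
      ultimately show ?case using k(2) by auto
    next
      case (Suc n)
      then obtain s where s: "n \<le> s" "s < k" "hs v s (phase (odd n))" "\<forall>x \<in> stage I Rs n. v s x" by blast
      let ?c = "odd n"
      have next_fact: "\<exists>r\<ge>s. hs v r (phase (\<not> ?c)) \<and> v r l \<and> (\<forall>j. s \<le> j \<and> j < r \<longrightarrow> hs v j (phase ?c))"
        if l: "l \<in> stage I Rs (Suc n)" for l
      proof -
        obtain P where P: "(P, l) \<in> Rs" "set P \<subseteq> stage I Rs n" using l by auto
        hence "violation ?c P l \<in> set \<phi>s" unfolding \<phi>s by blast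
        from viol[OF s(2) this] show ?thesis
          unfolding hs_violation using s(3,4) P(2) running[of n] by blast
      qed
      obtain r where r: "s \<le> r" "hs v r (phase (\<not> ?c))" "\<forall>j. s \<le> j \<and> j < r \<longrightarrow> hs v j (phase ?c)"
        using next_fact[OF running] by blast
      have "v r x" if x: "x \<in> stage I Rs (Suc n)" for x
      proof -
        obtain r' where r': "s \<le> r'" "hs v r' (phase (\<not> ?c))" "v r' x" "\<forall>j. s \<le> j \<and> j < r' \<longrightarrow> hs v j (phase ?c)"
          using next_fact[OF x] by blast
        \<comment> \<open>Both are the first state of the opposite phase after \<open>s\<close>,
          hence all facts of the next stage hold at the same state.\<close>
        have "\<not> r < r'" "\<not> r' < r" using r r' excl by blast+
        thus ?thesis using r'(3) by simp
      qed
      moreover have "s \<noteq> r" using r(2) s(3) excl by blast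
      \<comment> \<open>State \<open>k\<close> carries both phase variables and so belongs to
        neither phase; the next block cannot begin at \<open>k\<close>, nor can the current one
        extend past it.\<close>
      moreover have "r < k"
        using r s notend by (metis less_imp_le linorder_neqE_nat)
      ultimately show ?case using r s by (intro exI[of _ r]) auto
    qed
    from this[of k] show False by auto
  qed
qed

end

end


section \<open>Computations as rule networks\<close>

text \<open>
  The contents of a tape are described relative to the head: \<open>Lf a s\<close> at location \<open>i\<close> says that
  tape \<open>a\<close> has symbol \<open>s\<close> at distance \<open>i + 1\<close> to the left of the head, and \<open>Rt a s\<close> that it has
  \<open>s\<close> at distance \<open>i\<close> to the right. Moves then shift these two sequences, so that all facts a step
  depends on lie in a bounded window. A fresh symbol \<open>e\<close> fills the left sequence beyond cell 0.
\<close>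

datatype kind = PhA | PhB | Always | Start | Alive | St nat | Lf nat nat | Rt nat nat

type_synonym fact = "kind \<times> nat"

text \<open>A rule arises from a schema by choosing a location \<open>j\<close>:
  \<open>Abs i\<close> is a fixed location near the head, \<open>Rel d\<close> lies \<open>d\<close>
  beyond \<open>j\<close>.\<close>

datatype loc = Abs nat | Rel nat

fun place :: "nat \<Rightarrow> kind \<times> loc \<Rightarrow> fact" where
  "place j (\<kappa>, Abs i) = (\<kappa>, i)"
| "place j (\<kappa>, Rel d) = (\<kappa>, j + d)"

fun lf :: "nat \<Rightarrow> tape \<Rightarrow> nat \<Rightarrow> nat" where
  "lf e (c, h) i = (if i < h then c (h - 1 - i) else e)"

fun rt :: "tape \<Rightarrow> nat \<Rightarrow> nat" where
  "rt (c, h) i = c (h + i)"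

text \<open>\<open>Alive\<close> excludes the accepting state only, so a machine that has rejected
  stays alive forever.\<close>

fun true_fact :: "nat \<Rightarrow> config \<Rightarrow> fact \<Rightarrow> bool" where
  "true_fact e (q, ts) (Alive, i) \<longleftrightarrow> i = 0 \<and> q \<noteq> 1"
| "true_fact e (q, ts) (St q', i) \<longleftrightarrow> i = 0 \<and> q = q'"
| "true_fact e (q, ts) (Lf a s, i) \<longleftrightarrow> a < length ts \<and> lf e (ts ! a) i = s"
| "true_fact e (q, ts) (Rt a s, i) \<longleftrightarrow> a < length ts \<and> rt (ts ! a) i = s"
| "true_fact e (q, ts) _ \<longleftrightarrow> False"

text \<open>\<open>lf e t 0 = e\<close> detects a head on cell 0, where a left move stays; the test
  is reliable because \<open>e\<close> is not a tape symbol.\<close>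

lemma rt_act:
  assumes "\<And>n. fst t n < e"
  shows "rt (act_tape t (s, d)) i = (case d of
      Stay \<Rightarrow> if i = 0 then s else rt t i
    | Right_move \<Rightarrow> rt t (i + 1)
    | Left_move \<Rightarrow> if lf e t 0 = e then (if i = 0 then s else rt t i)
        else if i = 0 then lf e t 0 else if i = 1 then s else rt t (i - 1))"
proof -
  obtain c h where t: "t = (c, h)" by (cases t)
  have c: "c n < e" "c n \<noteq> e" for n using assms[of n] t by auto
  show ?thesis
  proof (cases h)
    case 0
    thus ?thesis by (cases d) (auto simp: t)
  next
    case (Suc h')
    thus ?thesis using c by (cases d; cases i) (auto simp: t)
  qed
qed

lemma lf_act:
  assumes "\<And>n. fst t n < e"
  shows "lf e (act_tape t (s, d)) i = (case d of
      Stay \<Rightarrow> lf e t i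
    | Right_move \<Rightarrow> if i = 0 then s else lf e t (i - 1)
    | Left_move \<Rightarrow> if lf e t 0 = e then lf e t i else lf e t (i + 1))"
proof -
  obtain c h where t: "t = (c, h)" by (cases t)
  have c: "c n < e" "c n \<noteq> e" for n using assms[of n] t by auto
  show ?thesis
  proof (cases h)
    case 0
    thus ?thesis by (cases d; cases i) (auto simp: t)
  next
    case (Suc h')
    thus ?thesis using c by (cases d; cases i) (auto simp: t)
  qed
qed

lemma read_rt: "read_tape t = rt t 0"
  by (cases t) simp

context
  fixes T :: tm
  assumes T: "is_tm T"
begin

definition config_ok :: "config \<Rightarrow> bool" where
  "config_ok C \<longleftrightarrow> length (snd C) = num_tapes T \<and> fst C < num_states T \<and>
    (\<forall>t \<in> set (snd C). \<forall>n. fst t n < num_syms T)"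

lemma trans_ok:
  assumes "config_ok (q, ts)" "trans T q (map read_tape ts) = (q', acts)"
  shows "q' < num_states T" "length acts = num_tapes T" "\<And>a. a < num_tapes T \<Longrightarrow> fst (acts ! a) < num_syms T"
proof -
  have reads: "\<forall>s \<in> set (map read_tape ts). s < num_syms T"
    using assms(1) by (auto simp: config_ok_def read_rt dest: bspec)
  have q: "q < num_states T" "length (map read_tape ts) = num_tapes T"
    using assms(1) by (simp_all add: config_ok_def)
  have "case trans T q (map read_tape ts) of (q', acts) \<Rightarrow>
      q' < num_states T \<and> length acts = num_tapes T \<and> (\<forall>(s, d) \<in> set acts. s < num_syms T)"
    using T[unfolded is_tm_def, THEN conjunct2, THEN conjunct2, THEN conjunct2, THEN spec, THEN spec,
      THEN mp, THEN mp, THEN mp, OF q reads] .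
  hence *: "q' < num_states T \<and> length acts = num_tapes T \<and> (\<forall>(s, d) \<in> set acts. s < num_syms T)"
    unfolding assms(2) by simp
  thus "q' < num_states T" "length acts = num_tapes T" by auto
  show "fst (acts ! a) < num_syms T" if "a < num_tapes T" for a
    using * that nth_mem[of a acts] by (metis (mono_tags, lifting) case_prod_beta)
qed

lemma config_ok_step:
  assumes "config_ok C"
  shows "config_ok (step T C)"
proof -
  obtain q ts where C: "C = (q, ts)" by (cases C)
  obtain q' acts where tr: "trans T q (map read_tape ts) = (q', acts)" by fastforce
  note ok = trans_ok[OF assms[unfolded C] tr]
  show ?thesis
  proof (cases "q = 1 \<or> q = 2")
    case False
    have len: "length ts = num_tapes T" using assms by (simp add: C config_ok_def)
    have "fst t n < num_syms T" if t: "t \<in> set (map2 act_tape ts acts)" for t n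
    proof -
      obtain a where a: "a < num_tapes T" "t = act_tape (ts ! a) (acts ! a)"
        using t len ok(2) by (auto simp: in_set_conv_nth)
      have "fst (ts ! a) m < num_syms T" for m using assms a(1) len by (simp add: C config_ok_def)
      thus ?thesis using a(2) ok(3)[OF a(1)] by (cases "ts ! a"; cases "acts ! a") auto
    qed
    thus ?thesis using False tr ok len by (auto simp: C config_ok_def)
  qed (use assms in \<open>auto simp: C\<close>)
qed

lemma config_ok_run: "config_ok (Defs.run T x n)"
proof (induction n)
  case 0
  have "num_tapes T \<ge> 1" "num_syms T \<ge> 3" "num_states T \<ge> 3" using T by (auto simp: is_tm_def)
  thus ?case by (auto simp: Defs.run_def init_config_def config_ok_def tape_content_def)
next
  case (Suc n)
  thus ?case using config_ok_step by (simp add: Defs.run_def)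
qed

abbreviation edge_sym :: nat where "edge_sym \<equiv> num_syms T"

section \<open>Local determinacy of a machine step\<close>

definition agree :: "config \<Rightarrow> nat \<Rightarrow> config \<Rightarrow> nat \<Rightarrow> bool" where
  "agree C j C' j' \<longleftrightarrow> fst C = fst C' \<and> (\<forall>a < num_tapes T.
    (\<forall>i \<in> {0, 1, 2}. rt (snd C ! a) i = rt (snd C' ! a) i \<and> lf edge_sym (snd C ! a) i = lf edge_sym (snd C' ! a) i) \<and>
    (\<forall>d \<in> {1, 2, 3}. rt (snd C ! a) (j + d) = rt (snd C' ! a) (j' + d) \<and>
      lf edge_sym (snd C ! a) (j + d) = lf edge_sym (snd C' ! a) (j' + d)))"

text \<open>A move shifts by at most one, so the new contents at distances 0, 1 and
  \<open>j + 2\<close> are determined by the old ones at 0, 1, 2 and at \<open>j + 1\<close>,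
  \<open>j + 2\<close>, \<open>j + 3\<close>. The offset 2 keeps the general location clear of the
  special cases 0 and 1 next to the head.\<close>

lemma step_agree:
  assumes ok: "config_ok C" "config_ok C'" and ag: "agree C j C' j'"
  shows "fst (step T C) = fst (step T C')" (is ?st)
    "\<And>a i. a < num_tapes T \<Longrightarrow> i \<in> {0, 1} \<Longrightarrow> rt (snd (step T C) ! a) i = rt (snd (step T C') ! a) i \<and>
      lf edge_sym (snd (step T C) ! a) i = lf edge_sym (snd (step T C') ! a) i" (is "\<And>a i. _ \<Longrightarrow> _ \<Longrightarrow> ?abs a i")
    "\<And>a. a < num_tapes T \<Longrightarrow> rt (snd (step T C) ! a) (j + 2) = rt (snd (step T C') ! a) (j' + 2) \<and>
      lf edge_sym (snd (step T C) ! a) (j + 2) = lf edge_sym (snd (step T C') ! a) (j' + 2)" (is "\<And>a. _ \<Longrightarrow> ?rel a")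
proof -
  obtain q ts q' ts' where C: "C = (q, ts)" "C' = (q', ts')" by (cases C; cases C')
  have q: "q' = q" using ag by (simp add: C agree_def)
  have len: "length ts = num_tapes T" "length ts' = num_tapes T" using ok by (auto simp: C config_ok_def)
  have "?st \<and> (\<forall>a < num_tapes T. (\<forall>i \<in> {0, 1}. ?abs a i) \<and> ?rel a)"
  proof (cases "q = 1 \<or> q = 2")
    case True
    hence "step T C = C" "step T C' = C'" by (auto simp: C q)
    thus ?thesis using ag by (simp add: agree_def)
  next
    case False
    have reads: "map read_tape ts' = map read_tape ts"
      using ag len by (intro nth_equalityI) (auto simp: agree_def C read_rt)
    obtain r acts where tr: "trans T q (map read_tape ts) = (r, acts)" by fastforce
    note tok = trans_ok[OF ok(1)[unfolded C] tr]
    have s: "step T C = (r, map2 act_tape ts acts)" "step T C' = (r, map2 act_tape ts' acts)"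
      using False tr reads by (auto simp: C q)
    have "(\<forall>i \<in> {0, 1}. ?abs a i) \<and> ?rel a" if a: "a < num_tapes T" for a
    proof -
      obtain w d where wd: "acts ! a = (w, d)" by (cases "acts ! a")
      have n: "snd (step T C) ! a = act_tape (ts ! a) (w, d)" "snd (step T C') ! a = act_tape (ts' ! a) (w, d)"
        using a len tok(2) wd by (auto simp: s)
      have sym: "fst (ts ! a) n < edge_sym" "fst (ts' ! a) n < edge_sym" for n
        using ok len a by (auto simp: C config_ok_def)
      have A: "rt (ts ! a) 0 = rt (ts' ! a) 0" "rt (ts ! a) 1 = rt (ts' ! a) 1" "rt (ts ! a) 2 = rt (ts' ! a) 2"
        "lf edge_sym (ts ! a) 0 = lf edge_sym (ts' ! a) 0" "lf edge_sym (ts ! a) 1 = lf edge_sym (ts' ! a) 1"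
        "lf edge_sym (ts ! a) 2 = lf edge_sym (ts' ! a) 2"
        "rt (ts ! a) (j + 1) = rt (ts' ! a) (j' + 1)" "rt (ts ! a) (j + 2) = rt (ts' ! a) (j' + 2)"
        "rt (ts ! a) (j + 3) = rt (ts' ! a) (j' + 3)"
        "lf edge_sym (ts ! a) (j + 1) = lf edge_sym (ts' ! a) (j' + 1)"
        "lf edge_sym (ts ! a) (j + 2) = lf edge_sym (ts' ! a) (j' + 2)"
        "lf edge_sym (ts ! a) (j + 3) = lf edge_sym (ts' ! a) (j' + 3)"
        using ag a by (auto simp: agree_def C)
      have ar: "(0::nat) + 1 = 1" "(1::nat) + 1 = 2" "j + 2 + 1 = j + 3" "j' + 2 + 1 = j' + 3" "j + 2 - 1 = j + 1"
        "j' + 2 - 1 = j' + 1" "(1::nat) - 1 = 0" "j + 2 \<noteq> 0" "j' + 2 \<noteq> 0" "j + 2 \<noteq> 1" "j' + 2 \<noteq> 1" by auto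
      show ?thesis
        by (cases d) (auto simp only: n rt_act[OF sym(1)] rt_act[OF sym(2)] lf_act[OF sym(1)] lf_act[OF sym(2)]
          ar A move.case if_False if_True insert_iff empty_iff zero_neq_one one_neq_zero refl simp_thms)
    qed
    thus ?thesis by (simp add: s)
  qed
  thus ?st "\<And>a i. a < num_tapes T \<Longrightarrow> i \<in> {0, 1} \<Longrightarrow> ?abs a i" "\<And>a. a < num_tapes T \<Longrightarrow> ?rel a" by blast+
qed

definition kinds :: "kind set" where
  "kinds = {Alive} \<union> St ` {..<num_states T} \<union> (\<Union>a<num_tapes T. Lf a ` {..edge_sym} \<union> Rt a ` {..edge_sym})"

lemma finite_kinds: "finite kinds"
  by (simp add: kinds_def)

definition locs :: "loc set" where
  "locs = {Abs 0, Abs 1, Abs 2, Rel 1, Rel 2, Rel 3}"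

definition window :: "config \<Rightarrow> nat \<Rightarrow> (kind \<times> loc) list" where
  "window C j = (St (fst C), Abs 0) # concat (map (\<lambda>a.
    map (\<lambda>i. (Rt a (rt (snd C ! a) i), Abs i)) [0, 1, 2] @
    map (\<lambda>i. (Lf a (lf edge_sym (snd C ! a) i), Abs i)) [0, 1, 2] @
    map (\<lambda>d. (Rt a (rt (snd C ! a) (j + d)), Rel d)) [1, 2, 3] @
    map (\<lambda>d. (Lf a (lf edge_sym (snd C ! a) (j + d)), Rel d)) [1, 2, 3]) [0..<num_tapes T])"

text \<open>Defined semantically, as all bounded rules sound at every location, instead of by a
  table of moves: soundness is then immediate and only completeness needs an argument. The set
  depends on the machine alone, and the length bound makes it finite.\<close>

definition schemas :: "((kind \<times> loc) list \<times> (kind \<times> loc)) set" where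
  "schemas = {(P, l). set P \<subseteq> kinds \<times> locs \<and> length P \<le> 1 + 12 * num_tapes T \<and> l \<in> kinds \<times> locs \<and>
    (\<forall>C j. config_ok C \<longrightarrow> (\<forall>p \<in> set P. true_fact edge_sym C (place j p)) \<longrightarrow> true_fact edge_sym (step T C) (place j l))}"

lemma finite_schemas: "finite schemas"
proof -
  have "finite (kinds \<times> locs)" using finite_kinds by (simp add: locs_def)
  hence "finite ({P. set P \<subseteq> kinds \<times> locs \<and> length P \<le> 1 + 12 * num_tapes T} \<times> (kinds \<times> locs))"
    using finite_lists_length_le by blast
  thus ?thesis by (rule finite_subset[rotated]) (auto simp: schemas_def)
qed

lemma lf_rt_le:
  assumes "config_ok C" "a < num_tapes T"
  shows "lf edge_sym (snd C ! a) i \<le> edge_sym" "rt (snd C ! a) i \<le> edge_sym"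
proof -
  obtain c h where ch: "snd C ! a = (c, h)" by (cases "snd C ! a")
  have "fst (snd C ! a) m < edge_sym" for m using assms by (simp add: config_ok_def)
  hence "c m < edge_sym" for m by (simp add: ch)
  thus "lf edge_sym (snd C ! a) i \<le> edge_sym" "rt (snd C ! a) i \<le> edge_sym"
    by (simp_all add: ch less_imp_le)
qed

lemma length_window: "length (window C j) = 1 + 12 * num_tapes T"
proof -
  have "length (concat (map f [0..<n])) = 12 * n" if "\<And>a. length (f a) = 12" for f :: "nat \<Rightarrow> (kind \<times> loc) list" and n
    by (induction n) (auto simp: that)
  thus ?thesis by (simp add: window_def)
qed

lemma kinds_iff [simp]:
  "Alive \<in> kinds" "St q \<in> kinds \<longleftrightarrow> q < num_states T"
  "Lf a s \<in> kinds \<longleftrightarrow> a < num_tapes T \<and> s \<le> edge_sym" "Rt a s \<in> kinds \<longleftrightarrow> a < num_tapes T \<and> s \<le> edge_sym"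
  by (auto simp: kinds_def)

lemma window_kinds:
  assumes "config_ok C"
  shows "set (window C j) \<subseteq> kinds \<times> locs"
proof -
  have "fst C < num_states T" using assms by (simp add: config_ok_def)
  thus ?thesis by (simp add: window_def locs_def lf_rt_le[OF assms] UN_subset_iff)
qed

lemma window_true:
  assumes "config_ok C" "p \<in> set (window C j)"
  shows "true_fact edge_sym C (place j p)"
proof -
  obtain q ts where "C = (q, ts)" by (cases C)
  thus ?thesis using assms by (auto simp: window_def config_ok_def)
qed

lemma window_agree:
  assumes "config_ok C'" "\<forall>p \<in> set (window C j). true_fact edge_sym C' (place j' p)"
  shows "agree C j C' j'"
proof -
  obtain q ts where C: "C' = (q, ts)" by (cases C')
  have 1: "true_fact edge_sym C' (place j' (St (fst C), Abs 0))" using assms(2) by (auto simp: window_def)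
  have 2: "true_fact edge_sym C' (place j' (Rt a (rt (snd C ! a) i), Abs i))"
    "true_fact edge_sym C' (place j' (Lf a (lf edge_sym (snd C ! a) i), Abs i))"
    if "a < num_tapes T" "i \<in> {0, 1, 2}" for a i
    using assms(2) that by (force simp: window_def)+
  have 3: "true_fact edge_sym C' (place j' (Rt a (rt (snd C ! a) (j + d)), Rel d))"
    "true_fact edge_sym C' (place j' (Lf a (lf edge_sym (snd C ! a) (j + d)), Rel d))"
    if "a < num_tapes T" "d \<in> {1, 2, 3}" for a d
    using assms(2) that by (force simp: window_def)+
  show ?thesis using 1 2 3 unfolding agree_def C by (auto simp: C)
qed

text \<open>Completeness of the schemas: any configuration satisfying the facts of the window agrees
  with \<open>C\<close> on everything that determines \<open>l\<close> after the step.\<close>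

lemma window_schema:
  assumes C: "config_ok C" and l: "fst l \<in> kinds" "snd l \<in> {Abs 0, Abs 1, Rel 2}"
    and t: "true_fact edge_sym (step T C) (place j l)"
  shows "(window C j, l) \<in> schemas"
proof -
  obtain \<kappa> p where lp: "l = (\<kappa>, p)" by (cases l)
  obtain r us where s: "step T C = (r, us)" by (cases "step T C")
  have us: "length us = num_tapes T" using config_ok_step[OF C] by (simp add: s config_ok_def)
  have "true_fact edge_sym (step T C') (place j' l)"
    if C': "config_ok C'" "\<forall>p \<in> set (window C j). true_fact edge_sym C' (place j' p)" for C' j'
  proof -
    note ag = step_agree[OF C C'(1) window_agree[OF C']]
    obtain r' us' where s': "step T C' = (r', us')" by (cases "step T C'")
    have us': "length us' = num_tapes T" using config_ok_step[OF C'(1)] by (simp add: s' config_ok_def)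
    show ?thesis
    proof (cases \<kappa>)
      case (Lf a z)
      thus ?thesis using t l us us' ag(2)[of a 0] ag(2)[of a 1] ag(3)[of a] by (auto simp: lp s s')
    next
      case (Rt a z)
      thus ?thesis using t l us us' ag(2)[of a 0] ag(2)[of a 1] ag(3)[of a] by (auto simp: lp s s')
    qed (use t l ag(1) in \<open>auto simp: lp s s'\<close>)
  qed
  moreover have "snd l \<in> locs" using l(2) by (auto simp: locs_def)
  ultimately show ?thesis
    using window_kinds[OF C, of j] length_window[of C j] l(1)
    unfolding schemas_def mem_Collect_eq prod.case mem_Times_iff by simp
qed

lemma run_blank:
  assumes "runs_in_space T sp" "sp (length x) \<le> m" "length x \<le> m" "t \<in> set (snd (Defs.run T x n))"
  shows "fst t m = 0"
  using assms(4)
proof (induction n arbitrary: t)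
  case 0
  thus ?case using assms(3) by (auto simp: Defs.run_def init_config_def tape_content_def split: if_splits)
next
  case (Suc n)
  obtain q ts where C: "Defs.run T x n = (q, ts)" by (cases "Defs.run T x n")
  have s: "Defs.run T x (Suc n) = step T (q, ts)" using C by (simp add: Defs.run_def)
  show ?case
  proof (cases "q = 1 \<or> q = 2")
    case True
    hence "step T (q, ts) = (q, ts)" by auto
    thus ?thesis using Suc C s by simp
  next
    case False
    obtain r acts where tr: "trans T q (map read_tape ts) = (r, acts)" by fastforce
    have "step T (q, ts) = (r, map2 act_tape ts acts)" using False tr by auto
    hence "t \<in> set (map2 act_tape ts acts)" using Suc.prems s by (simp del: step.simps)
    then obtain t0 a where t0: "t0 \<in> set ts" "t = act_tape t0 a" by (auto dest: set_zip_leftD)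
    have "fst t0 m = 0" using Suc.IH[of t0] C t0(1) by simp
    moreover have "snd t0 < sp (length x)"
      using assms(1) C t0(1) unfolding runs_in_space_def by (metis case_prod_beta snd_conv)
    ultimately show ?thesis using t0(2) assms(2) by (cases t0; cases a) auto
  qed
qed

text \<open>Halting states are never left, so no run can visit both of them.\<close>

lemma decides_iff:
  assumes "decides T L"
  shows "x \<in> L \<longleftrightarrow> (\<exists>n. fst (Defs.run T x n) = 1)"
proof
  assume "x \<in> L"
  thus "\<exists>n. fst (Defs.run T x n) = 1" using assms unfolding decides_def by metis
next
  assume "\<exists>n. fst (Defs.run T x n) = 1"
  then obtain n where n: "fst (Defs.run T x n) = 1" by blast
  show "x \<in> L"
  proof (rule ccontr)
    assume "x \<notin> L"
    then obtain m where m: "fst (Defs.run T x m) = 2" using assms unfolding decides_def by metis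
    have stop: "fst (Defs.run T x (k + d)) = fst (Defs.run T x k)" if "fst (Defs.run T x k) \<in> {1, 2}" for k d
    proof (induction d)
      case (Suc d)
      obtain q ts where C: "Defs.run T x (k + d) = (q, ts)" by (cases "Defs.run T x (k + d)")
      have "Defs.run T x (k + Suc d) = step T (q, ts)" using C by (simp add: Defs.run_def)
      thus ?case using C Suc that by auto
    qed simp
    show False using stop[of n "m - n"] stop[of m "n - m"] n m by (cases "n \<le> m") auto
  qed
qed

text \<open>
  Beyond the space bound the tapes are blank, which is what the two facts at location \<open>n + 2\<close>
  express; all other locations are served by the schemas.
\<close>

definition top_facts :: "(kind \<times> loc) set" where
  "top_facts = (\<Union>a<num_tapes T. {(Rt a 0, Rel 2), (Lf a edge_sym, Rel 2)})"

definition rules :: "nat \<Rightarrow> (fact list \<times> fact) set" where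
  "rules n = {(map (place j) P, place j l) | P l j. (P, l) \<in> schemas \<and> j < n} \<union> {([], place n l) | l. l \<in> top_facts}"

definition init_facts :: "bool list \<Rightarrow> nat \<Rightarrow> fact set" where
  "init_facts x n = {(\<kappa>, i). \<kappa> \<in> kinds \<and> i \<le> n + 2 \<and> true_fact edge_sym (init_config T x) (\<kappa>, i)}"

lemma top_facts_kinds: "l \<in> top_facts \<Longrightarrow> l \<in> kinds \<times> {Rel 2}"
  by (auto simp: top_facts_def kinds_def)

text \<open>An induction sandwiches each stage: what is true up to location \<open>n + 2\<close> is
  derived, and what is derived is true. A window at \<open>j < n\<close> reaches up to
  \<open>n + 2\<close>; the contents of that last location would depend on \<open>n + 3\<close>, so
  \<open>top_facts\<close> supplies them afresh at every step.\<close>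

theorem stage_facts:
  assumes V: "inj_on V (kinds \<times> UNIV)" and sp: "runs_in_space T sp"
    and n: "sp (length x) \<le> n + 2" "length x \<le> n + 2" "1 \<le> n"
  defines "Rs \<equiv> (\<lambda>(P, l). (map V P, V l)) ` rules n"
  shows "V ` {(\<kappa>, i). \<kappa> \<in> kinds \<and> i \<le> n + 2 \<and> true_fact edge_sym (Defs.run T x m) (\<kappa>, i)} \<subseteq>
      stage (V ` init_facts x n) Rs m \<and>
    stage (V ` init_facts x n) Rs m \<subseteq>
      V ` {(\<kappa>, i). \<kappa> \<in> kinds \<and> true_fact edge_sym (Defs.run T x m) (\<kappa>, i)}"
proof (induction m)
  case 0
  show ?case by (auto simp: init_facts_def Defs.run_def)
next
  case (Suc m)
  let ?C = "Defs.run T x m" and ?D = "Defs.run T x (Suc m)"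
  have D: "?D = step T ?C" by (simp add: Defs.run_def)
  have ok: "config_ok ?C" "config_ok ?D" using config_ok_run by blast+
  obtain r us where us: "?D = (r, us)" by (cases ?D)
  have top: "lf edge_sym (us ! a) (n + 2) = edge_sym" "rt (us ! a) (n + 2) = 0" "a < length us" if "a < num_tapes T" for a
  proof -
    show l: "a < length us" using ok(2) that by (simp add: us config_ok_def)
    obtain c h where ch: "us ! a = (c, h)" by (cases "us ! a")
    have mem: "(c, h) \<in> set (snd ?D)" using l ch us by (metis nth_mem snd_conv)
    have "h < sp (length x)" using sp mem unfolding runs_in_space_def by fastforce
    thus "lf edge_sym (us ! a) (n + 2) = edge_sym" using n(1) ch by simp
    show "rt (us ! a) (n + 2) = 0"
      using run_blank[OF sp, of x "h + (n + 2)" "(c, h)" "Suc m"] mem n ch by simp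
  qed
  have mem: "f \<in> {(\<kappa>, i). \<kappa> \<in> kinds \<and> true_fact edge_sym ?C (\<kappa>, i)}"
    if f: "V f \<in> stage (V ` init_facts x n) Rs m" "fst f \<in> kinds" for f
  proof -
    obtain g where g: "g \<in> {(\<kappa>, i). \<kappa> \<in> kinds \<and> true_fact edge_sym ?C (\<kappa>, i)}" "V f = V g"
      using subsetD[OF conjunct2[OF Suc.IH] f(1)] by (elim imageE)
    have "g \<in> kinds \<times> UNIV" "f \<in> kinds \<times> UNIV" using g(1) f(2) by (auto simp: mem_Times_iff)
    hence "f = g" using inj_onD[OF V g(2)] by blast
    thus ?thesis using g(1) by simp
  qed
  show ?case
  proof
    show "V ` {(\<kappa>, i). \<kappa> \<in> kinds \<and> i \<le> n + 2 \<and> true_fact edge_sym ?D (\<kappa>, i)} \<subseteq>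
      stage (V ` init_facts x n) Rs (Suc m)"
    proof safe
      fix \<kappa> i assume f: "\<kappa> \<in> kinds" "i \<le> n + 2" "true_fact edge_sym ?D (\<kappa>, i)"
      show "V (\<kappa>, i) \<in> stage (V ` init_facts x n) Rs (Suc m)"
      proof (cases "i = n + 2")
        case True
        have "(\<kappa>, Rel 2) \<in> top_facts"
          using f top by (cases \<kappa>) (auto simp: True us kinds_def top_facts_def)
        hence "([], place n (\<kappa>, Rel 2)) \<in> rules n" unfolding rules_def by blast
        hence "([], V (\<kappa>, i)) \<in> Rs" unfolding Rs_def True by force
        thus ?thesis by force
      next
        case False
        \<comment> \<open>Locations 0 and 1 are reached as absolute ones, a location
          \<open>i\<close> from 2 on as \<open>Rel 2\<close> at \<open>j = i - 2\<close>.\<close>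
        obtain j l where jl: "j < n" "place j l = (\<kappa>, i)" "fst l = \<kappa>" "snd l \<in> {Abs 0, Abs 1, Rel 2}"
        proof (cases "i \<le> 1")
          case True
          thus ?thesis using that[of 0 "(\<kappa>, Abs i)"] n(3) by (auto simp: le_Suc_eq)
        next
          case i: False
          thus ?thesis using that[of "i - 2" "(\<kappa>, Rel 2)"] f(2) False by auto
        qed
        have "(window ?C j, l) \<in> schemas" using window_schema[OF ok(1)] jl f D by simp
        hence "(map (place j) (window ?C j), place j l) \<in> rules n" using jl(1) unfolding rules_def by blast
        hence r: "(map V (map (place j) (window ?C j)), V (\<kappa>, i)) \<in> Rs" unfolding Rs_def jl(2)[symmetric] by force
        have "V (place j p) \<in> stage (V ` init_facts x n) Rs m" if p: "p \<in> set (window ?C j)" for p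
        proof -
          have k: "p \<in> kinds \<times> locs" using window_kinds[OF ok(1)] p by blast
          have "fst (place j p) \<in> kinds" "snd (place j p) \<le> n + 2"
            using k jl(1) n(3) by (cases p; auto simp: locs_def)+
          hence "place j p \<in> {(\<kappa>, i). \<kappa> \<in> kinds \<and> i \<le> n + 2 \<and> true_fact edge_sym ?C (\<kappa>, i)}"
            using window_true[OF ok(1) p] by (cases "place j p") simp
          thus ?thesis by (rule subsetD[OF conjunct1[OF Suc.IH] imageI])
        qed
        hence "set (map V (map (place j) (window ?C j))) \<subseteq> stage (V ` init_facts x n) Rs m" by auto
        thus ?thesis using r unfolding stage.simps by blast
      qed
    qed
    show "stage (V ` init_facts x n) Rs (Suc m) \<subseteq> V ` {(\<kappa>, i). \<kappa> \<in> kinds \<and> true_fact edge_sym ?D (\<kappa>, i)}"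
    proof
      fix v assume "v \<in> stage (V ` init_facts x n) Rs (Suc m)"
      then obtain P l where Pl: "(P, l) \<in> rules n" "set (map V P) \<subseteq> stage (V ` init_facts x n) Rs m" "v = V l"
        unfolding Rs_def by auto
      consider (schema) P' l' j where "(P', l') \<in> schemas" "P = map (place j) P'" "l = place j l'" |
        (top) l' where "l' \<in> top_facts" "l = place n l'" using Pl(1) unfolding rules_def by blast
      hence "fst l \<in> kinds \<and> true_fact edge_sym ?D l"
      proof cases
        case schema
        have k: "set P' \<subseteq> kinds \<times> locs" "l' \<in> kinds \<times> locs" using schema(1) by (auto simp: schemas_def)
        have fa: "fst (place j p) = fst p" for p by (cases "(j, p)" rule: place.cases) auto
        have "true_fact edge_sym ?C (place j p)" if p: "p \<in> set P'" for p
        proof -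
          have "V (place j p) \<in> stage (V ` init_facts x n) Rs m" using Pl(2) schema(2) p by auto
          moreover have "fst (place j p) \<in> kinds" using fa[of p] k(1) p by auto
          ultimately have "place j p \<in> {(\<kappa>, i). \<kappa> \<in> kinds \<and> true_fact edge_sym ?C (\<kappa>, i)}" by (rule mem)
          thus ?thesis by (cases "place j p") simp
        qed
        hence "true_fact edge_sym (step T ?C) (place j l')"
          using schema(1) ok(1) unfolding schemas_def by blast
        thus ?thesis using schema(3) k(2) fa[of l'] D by auto
      next
        case top
        thus ?thesis using \<open>\<And>a. a < num_tapes T \<Longrightarrow> rt (us ! a) (n + 2) = 0\<close>
          \<open>\<And>a. a < num_tapes T \<Longrightarrow> lf edge_sym (us ! a) (n + 2) = edge_sym\<close>
          \<open>\<And>a. a < num_tapes T \<Longrightarrow> a < length us\<close>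
          by (auto simp: top_facts_def us)
      qed
      thus "v \<in> V ` {(\<kappa>, i). \<kappa> \<in> kinds \<and> true_fact edge_sym ?D (\<kappa>, i)}" using Pl(3) by force
    qed
  qed
qed

end


section \<open>Generating the formula\<close>

text \<open>
  Location \<open>i\<close> is written in unary inside the index of a variable, so that \<open>unary_code i\<close> is a
  common suffix of the codes of all variables at this location.
\<close>

definition unary_code :: "nat \<Rightarrow> bool list" where
  "unary_code i = delimited (replicate i False @ [True])"

text \<open>The closing \<open>True\<close> makes the word canonical, so it reappears literally as
  the binary form of the index.\<close>

definition var :: "(kind \<Rightarrow> bool list) \<Rightarrow> fact \<Rightarrow> nat" where
  "var lb f = unbin (lb (fst f) @ replicate (snd f) False @ [True])"

lemma encode_var: "encode (Var (var lb (\<kappa>, i))) = [False, False] @ delim_open (lb \<kappa>) @ unary_code i"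
proof -
  have "canonical (lb \<kappa> @ replicate i False @ [True])" by (simp add: canonical_def)
  from binary_unbin[OF this] show ?thesis by (simp add: var_def unary_code_def delimited_append)
qed

lemma unary_code_add: "unary_code (i + d) = delim_open (replicate d False) @ unary_code i"
  by (simp add: unary_code_def replicate_add add.commute[of i] flip: delimited_append)

lemma inj_var:
  assumes "\<And>\<kappa>. length (lb \<kappa>) = e" "inj_on lb K"
  shows "inj_on (var lb) (K \<times> UNIV)"
proof (rule inj_onI)
  fix f g assume f: "f \<in> K \<times> UNIV" "g \<in> K \<times> (UNIV :: nat set)" "var lb f = var lb g"
  have can: "canonical (lb (fst f) @ replicate (snd f) False @ [True])" for f :: fact by (simp add: canonical_def)
  have eq: "lb (fst f) @ replicate (snd f) False @ [True] = lb (fst g) @ replicate (snd g) False @ [True]"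
    using f(3) unfolding var_def by (rule unbin_inject[OF can can])
  hence "lb (fst f) = lb (fst g)" "replicate (snd f) False @ [True] = replicate (snd g) False @ [True]"
    using assms(1) by (simp_all add: append_eq_append_conv)
  hence "fst f = fst g" "snd f = snd g"
    using inj_onD[OF assms(2)] f(1,2) by (auto simp: mem_Times_iff dest: arg_cong[of _ _ length])
  thus "f = g" by (rule prod_eqI)
qed

text \<open>Words of \<open>card K\<close> bits are more than enough in number; their equal length
  is what lets label and location be separated again.\<close>

lemma finite_label:
  assumes "finite (K :: 'k set)"
  shows "\<exists>e lb. (\<forall>\<kappa>. length (lb \<kappa> :: bool list) = e) \<and> inj_on lb K"
proof -
  let ?L = "{xs :: bool list. set xs \<subseteq> UNIV \<and> length xs = card K}"
  have "card K \<le> card ?L" using card_lists_length_eq[of "UNIV :: bool set" "card K"] by simp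
  moreover have "finite ?L" by (rule finite_lists_length_eq) simp
  ultimately obtain lb where lb: "lb ` K \<subseteq> ?L" "inj_on lb K"
    using card_le_inj[OF assms] by blast
  let ?lb = "\<lambda>\<kappa>. if \<kappa> \<in> K then lb \<kappa> else replicate (card K) False"
  have "inj_on ?lb K" using lb(2) by (auto simp: inj_on_def)
  moreover have "length (?lb \<kappa>) = card K" for \<kappa> using lb(1) by auto
  ultimately show ?thesis by (intro exI[where x = "card K"] exI[where x = ?lb]) blast
qed

definition locally_computable :: "(nat \<Rightarrow> formula) \<Rightarrow> bool" where
  "locally_computable \<phi> \<longleftrightarrow> (\<exists>G. pcf True G \<and> (\<forall>j. encode (\<phi> j) = G (unary_code j)))"

lemma pcf_template:
  assumes "\<And>n. Inr n \<in> set w \<Longrightarrow> pcf tm (g n)"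
  shows "pcf tm (\<lambda>x. concat (map (case_sum (\<lambda>b. [b :: bool]) (\<lambda>n. g n x)) w))"
  using assms
proof (induction w)
  case (Cons s w)
  hence IH: "pcf tm (\<lambda>x. concat (map (case_sum (\<lambda>b. [b]) (\<lambda>n. g n x)) w))" by simp
  show ?case
  proof (cases s)
    case (Inl b)
    thus ?thesis using pcf_append[OF pcf_const IH, of "[b]"] by simp
  next
    case (Inr n)
    thus ?thesis using pcf_append[OF _ IH, of "g n"] Cons.prems[of n] by simp
  qed
qed (simp add: pcf_const)

lemma pcf_encode_subst:
  assumes "\<And>n. pcf tm (\<lambda>x. encode (\<sigma> x n))"
  shows "pcf tm (\<lambda>x. encode (subst (\<sigma> x) U))"
  unfolding encode_subst by (rule pcf_template) (rule assms)

lemma pcf_encode_Temp: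
  assumes "pcf tm (\<lambda>x. encode (\<phi> x))" "pcf tm (\<lambda>x. encode (\<psi> x))"
  shows "pcf tm (\<lambda>x. encode (Temp op (\<phi> x) (\<psi> x)))"
  unfolding encode_Temp by (intro pcf_intros assms)

lemma lc_place:
  "locally_computable (\<lambda>j. Var (var lb (place j p)))"
proof (cases p)
  case (Pair \<kappa> l)
  show ?thesis
  proof (cases l)
    case (Abs i)
    show ?thesis unfolding locally_computable_def
      by (rule exI[of _ "\<lambda>_. encode (Var (var lb (\<kappa>, i)))"]) (simp add: Pair Abs pcf_const)
  next
    case (Rel d)
    have "pcf True (\<lambda>x. ([False, False] @ delim_open (lb \<kappa>) @ delim_open (replicate d False)) @ x)"
      by (intro pcf_intros)
    thus ?thesis unfolding locally_computable_def
      by (intro exI conjI) (auto simp: Pair Rel encode_var unary_code_add simp del: encode.simps)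
  qed
qed

lemma lc_const: "locally_computable (\<lambda>_. \<phi>)"
  unfolding locally_computable_def by (rule exI[of _ "\<lambda>_. encode \<phi>"]) (simp add: pcf_const)

lemma lc_subst:
  assumes "\<And>n. locally_computable (\<lambda>j. \<sigma> j n)"
  shows "locally_computable (\<lambda>j. subst (\<sigma> j) U)"
proof -
  obtain G where G: "\<And>n. pcf True (G n)" "\<And>n j. encode (\<sigma> j n) = G n (unary_code j)"
    using assms unfolding locally_computable_def by metis
  show ?thesis unfolding locally_computable_def encode_subst
    by (rule exI[of _ "\<lambda>x. concat (map (case_sum (\<lambda>b. [b]) (\<lambda>n. G n x)) (tmpl U))"])
      (use G in \<open>auto intro: pcf_template\<close>)
qed

lemma lc_Temp:
  assumes "locally_computable \<phi>" "locally_computable \<psi>"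
  shows "locally_computable (\<lambda>j. Temp op (\<phi> j) (\<psi> j))"
proof -
  obtain G H where G: "pcf True G" "\<And>j. encode (\<phi> j) = G (unary_code j)"
    "pcf True H" "\<And>j. encode (\<psi> j) = H (unary_code j)"
    using assms unfolding locally_computable_def by blast
  have "pcf True (\<lambda>x. [True, op_bit op] @ G x @ H x)" by (intro pcf_intros G)
  thus ?thesis unfolding locally_computable_def by (intro exI conjI) (auto simp: encode_Temp G)
qed

lemma lc_connectives:
  assumes "locally_computable \<phi>" "locally_computable \<psi>"
  shows "locally_computable (\<lambda>j. And TA (\<phi> j) (\<psi> j))" "locally_computable (\<lambda>j. Minus TN (\<phi> j) (\<psi> j))"
proof -
  have "locally_computable (\<lambda>j. if n = 0 then \<phi> j else \<psi> j)" for n :: nat using assms by (cases "n = 0") auto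
  thus "locally_computable (\<lambda>j. And TA (\<phi> j) (\<psi> j))" "locally_computable (\<lambda>j. Minus TN (\<phi> j) (\<psi> j))"
    unfolding And_def Minus_def by (rule lc_subst)+
qed

lemma lc_violation:
  "locally_computable (\<lambda>j. violation op TA TN nm c (map (\<lambda>p. var lb (place j p)) P) (var lb (place j l)))"
proof -
  have "locally_computable (\<lambda>j. foldr (\<lambda>p. And TA (Var p)) (map (\<lambda>p. var lb (place j p)) P) \<psi>)" for \<psi>
    by (induction P) (auto intro: lc_const lc_connectives lc_place)
  thus ?thesis unfolding violation_def
    by (intro lc_connectives lc_Temp lc_const lc_place)
qed

lemma lc_start_violation: "locally_computable (\<lambda>j. start_violation TN nm (var lb (place j l)))"
  unfolding start_violation_def by (intro lc_connectives lc_const lc_place)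

text \<open>
  As the hole of the context occurs only once, wrapping another formula around a chain just adds
  a prefix and a suffix to its code.
\<close>

lemma refuse_code:
  assumes "is_context B E" "\<And>w. w \<in> set ws \<Longrightarrow> locally_computable w"
  shows "\<exists>G H. pcf True G \<and> pcf True H \<and> (\<forall>j \<psi>. encode (foldr (Refuse E nm) (map (\<lambda>w. w j) ws) \<psi>) =
    G (unary_code j) @ encode \<psi> @ H (unary_code j))"
  using assms(2)
proof (induction ws)
  case Nil
  show ?case by (rule exI[of _ "\<lambda>_. []"], rule exI[of _ "\<lambda>_. []"]) (simp add: pcf_const)
next
  case (Cons w ws)
  obtain G H where GH: "pcf True G" "pcf True H" "\<And>j \<psi>. encode (foldr (Refuse E nm) (map (\<lambda>w. w j) ws) \<psi>) =
    G (unary_code j) @ encode \<psi> @ H (unary_code j)" using Cons by auto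
  obtain W where W: "pcf True W" "\<And>j. encode (w j) = W (unary_code j)"
    using Cons.prems[of w] unfolding locally_computable_def by auto
  have one: "count_list (tmpl E) (Inr 1) = 1" using assms(1) by (simp add: is_context_def occ_def)
  have "Inr 1 \<in> set (tmpl E)"
  proof (rule ccontr)
    assume "Inr 1 \<notin> set (tmpl E)"
    hence "count_list (tmpl E) (Inr 1) = 0" by (rule count_notin)
    thus False using one by linarith
  qed
  \<comment> \<open>The code is cut at the only placeholder for the hole; both sides are then
    independent of the formula plugged in.\<close>
  then obtain us vs where uv: "tmpl E = us @ Inr 1 # vs" "Inr 1 \<notin> set us" using split_list_first by metis
  have "count_list vs (Inr 1) = 0" using one unfolding uv(1) by (simp add: count_list_append)
  hence uv': "Inr 1 \<notin> set vs" by (simp only: count_list_0_iff not_False_eq_True)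
  define F where "F w x = concat (map (case_sum (\<lambda>b. [b]) (\<lambda>n. if n = 0 then W x else encode (Var (always nm)))) w)"
    for w :: "(bool + nat) list" and x
  have "pcf True (\<lambda>x. if n = 0 then W x else encode (Var (always nm)))" for n :: nat
    by (cases "n = 0") (simp_all add: W(1) pcf_const)
  hence F: "pcf True (F w)" for w unfolding F_def by (intro pcf_template)
  have ref: "encode (Refuse E nm (w j) \<psi>) = F us (unary_code j) @ encode \<psi> @ F vs (unary_code j)" for j \<psi>
  proof -
    have "concat (map (case_sum (\<lambda>b. [b]) (\<lambda>x. encode (if x = 0 then w j else if x = 1 then \<psi> else Var (always nm)))) u) =
      F u (unary_code j)" if "Inr 1 \<notin> set u" for u
      using that unfolding F_def
      by (intro arg_cong[of _ _ concat] map_cong) (auto simp: W(2) split: sum.splits simp del: encode.simps)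
    thus ?thesis using uv uv' unfolding Refuse_def encode_subst by (simp del: encode.simps)
  qed
  show ?case
  proof (intro exI conjI allI)
    show "pcf True (\<lambda>x. F us x @ G x)" "pcf True (\<lambda>x. H x @ F vs x)" by (intro pcf_intros F GH)+
    show "encode (foldr (Refuse E nm) (map (\<lambda>w. w j) (w # ws)) \<psi>) =
      (F us (unary_code j) @ G (unary_code j)) @ encode \<psi> @ H (unary_code j) @ F vs (unary_code j)" for j \<psi>
      by (simp add: ref GH(3))
  qed
qed

text \<open>Each round stores a copy of the current code, so the increment grows with the
  accumulator; \<open>fold_bounded\<close> with an explicit quadratic bound takes the place of
  \<open>pcf_fold\<close>.\<close>

lemma pcf_unary_codes:
  assumes "pcf True (u :: 'a::coded \<Rightarrow> bool list)"
  shows "pcf True (\<lambda>x. map unary_code [0..<length (u x)])" "pcf True (\<lambda>x. unary_code (length (u x)))"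
proof -
  let ?f = "\<lambda>(y :: bool) s :: bool list \<times> bool list list. ([True, False] @ fst s, fst s # snd s)"
  obtain q where q: "\<And>x. sz (u x) \<le> poly q (sz x)" using pcf_sz[OF assms] by blast
  have J: "unary_code (Suc i) = [True, False] @ unary_code i" for i
    using unary_code_add[of i 1] by (simp add: delim_open_def)
  have f: "fold ?f ys (unary_code 0, []) = (unary_code (length ys), rev (map unary_code [0..<length ys]))" for ys
  proof (induction ys rule: rev_induct)
    case (snoc y ys)
    thus ?case using J by simp
  qed simp
  have szJ: "sz (unary_code i) \<le> 8 * i + 13" for i
  proof -
    have "length (unary_code i) = 2 * i + 3" by (induction i) (auto simp: J unary_code_def)
    thus ?thesis using sz_bits[of "unary_code i"] by simp
  qed
  have szL: "sz (rev (map unary_code [0..<i])) \<le> i * (8 * i + 14) + 1" for i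
  proof -
    have "sz xs \<le> length xs * (K + 1) + 1" if "\<forall>x \<in> set xs. sz x \<le> K" for xs :: "bool list list" and K
      using that by (induction xs) auto
    note len = this
    have "sz (unary_code k) \<le> 8 * i + 13" if "k < i" for k using szJ[of k] that by linarith
    hence "\<forall>x \<in> set (rev (map unary_code [0..<i])). sz x \<le> 8 * i + 13" by simp
    from len[OF this] show ?thesis by (simp add: ac_simps)
  qed
  have F: "pcf True (\<lambda>x. fold ?f (u x) (unary_code 0, []))"
  proof (rule fold_bounded[where B = "smult 8 q + [:15:] + q * (smult 8 q + [:14:])"])
    fix x ys zs assume u: "u x = ys @ zs"
    have l: "length ys \<le> poly q (sz x)" using q[of x] length_le_sz[of "u x"] u by simp
    have "sz (fold ?f ys (unary_code 0, [])) \<le> 8 * length ys + 15 + length ys * (8 * length ys + 14)"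
      unfolding f using szJ[of "length ys"] szL[of "length ys"] by simp
    also have "\<dots> \<le> 8 * poly q (sz x) + 15 + poly q (sz x) * (8 * poly q (sz x) + 14)"
      using l by (intro add_mono mult_mono) auto
    finally show "sz (fold ?f ys (unary_code 0, [])) \<le> poly (smult 8 q + [:15:] + q * (smult 8 q + [:14:])) (sz x)"
      by simp
  qed (intro pcf_intros assms)+
  show "pcf True (\<lambda>x. map unary_code [0..<length (u x)])"
    using pcf_rev[OF pcf_snd[OF F]] by (simp only: f snd_conv rev_rev_ident)
  show "pcf True (\<lambda>x. unary_code (length (u x)))" using pcf_fst[OF F] by (simp only: f fst_conv)
qed

text \<open>Horner's rule in unary: multiplication by the input length is one copy per input
  bit.\<close>

lemma pcf_unary_poly: "\<exists>u. pcf True u \<and> (\<forall>x :: bool list. length (u x :: bool list) = poly p (length x))"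
proof (induction p)
  case 0
  show ?case by (rule exI[of _ "\<lambda>_. []"]) (simp add: pcf_const)
next
  case (pCons a p)
  then obtain u where u: "pcf True u" "\<And>x :: bool list. length (u x :: bool list) = poly p (length x)" by blast
  have "pcf True (\<lambda>x :: bool list. replicate a True @ concat (map (\<lambda>_. u x) x))"
    by (intro pcf_intros pcf_map pcf_comp[OF pcf_fst_base u(1)])
  moreover have "length (concat (map (\<lambda>_. u x) ys)) = length ys * poly p (length x)" for x ys :: "bool list"
    by (induction ys) (auto simp: u(2))
  ultimately show ?case by (intro exI conjI) auto
qed

section \<open>Completeness\<close>

text \<open>The formulas attached to a location depend on the input only through the symbol in that
  cell. A fixed prefix and suffix generator for each symbol therefore suffices, and the whole chain
  is produced by one fold over the locations.\<close>

theorem SAT_hard: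
  assumes S1: "S1 \<subseteq> clone B" and L: "L \<in> PSPACE"
  shows "poly_time_reducible L (SAT {op} B)"
proof -
  obtain T p where T: "is_tm T" "decides T L" "runs_in_space T (poly p)" using L unfolding PSPACE_def by blast
  obtain TA TN where TA: "is_formula {} B TA" "\<And>b. beval b TA = (b 0 \<and> b 1)"
    and TN: "is_formula {} B TN" "\<And>b. beval b TN = (b 0 \<and> \<not> b 1)" using clone_and_terms[OF S1] by metis
  obtain E where E: "is_context B E" "\<And>b. b 2 \<Longrightarrow> beval b E = (b 1 \<and> \<not> b 0)"
    using conjunction_context[OF S1] by blast
  let ?K = "kinds T \<union> {PhA, PhB, Always, Start}"
  obtain e lb where lb: "\<And>\<kappa>. length (lb \<kappa> :: bool list) = e" "inj_on lb ?K"
    using finite_label[of ?K] finite_kinds[OF T(1)] by auto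
  define V where "V = var lb"
  have inj: "inj_on V (?K \<times> UNIV)" unfolding V_def using inj_var[OF lb] .
  have V_eq: "V f = V g \<longleftrightarrow> f = g" if "fst f \<in> ?K" "fst g \<in> ?K" for f g
    using inj_on_eq_iff[OF inj, of f g] that by (auto simp: mem_Times_iff)
  define nm where "nm = \<lparr>phA = V (PhA, 0), phB = V (PhB, 0), always = V (Always, 0), start = V (Start, 0), alive = V (Alive, 0)\<rparr>"
  have special: "PhA \<notin> kinds T" "PhB \<notin> kinds T" "Always \<notin> kinds T" "Start \<notin> kinds T"
    using kinds_def[OF T(1)] by auto
  have alive: "Alive \<in> kinds T" using kinds_def[OF T(1)] by auto
  let ?spec = "{phA nm, phB nm, always nm, start nm}"
  have dist: "distinct [phA nm, phB nm, always nm, start nm]" by (auto simp: nm_def V_eq)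
  have sep: "V f \<notin> ?spec" if "fst f \<in> kinds T" for f
    using that special by (auto simp: nm_def V_eq)
  let ?viol = "violation op TA TN nm" and ?start = "start_violation TN nm"
  obtain Ss where Ss: "set Ss = schemas T" using finite_list[OF finite_schemas[OF T(1)]] by blast
  have "finite (top_facts T)" by (auto simp: top_facts_def[OF T(1)])
  then obtain Ts where Ts: "set Ts = top_facts T" using finite_list by blast
  \<comment> \<open>The kinds initially true at a location where the input tape holds
    \<open>c\<close>: all heads are on cell 0, so the left sequences consist of the edge symbol, and
    the other tapes are blank.\<close>
  define Ik where "Ik c = map (\<lambda>a. Lf a (num_syms T)) [0..<num_tapes T] @ map (\<lambda>a. Rt a 0) [1..<num_tapes T] @ [Rt 0 c]" for c
  define W where "W c = map (\<lambda>(b, P, l). \<lambda>j. ?viol b (map (\<lambda>p. V (place j p)) P) (V (place j l)))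
      (List.product [False, True] Ss) @ map (\<lambda>\<kappa>. \<lambda>j. ?start (V (place j (\<kappa>, Rel 0)))) (Ik c)" for c
  \<comment> \<open>Instantiated at \<open>N x\<close> only: the top rules, the initial facts of the
    last three locations, where the input tape is blank, and the two facts that do not concern a
    tape.\<close>
  define Wtop where "Wtop = map (\<lambda>(b, l). \<lambda>j. ?viol b (map (\<lambda>p. V (place j p)) []) (V (place j l))) (List.product [False, True] Ts) @
      map (\<lambda>(d, \<kappa>). \<lambda>j. ?start (V (place j (\<kappa>, Rel d)))) (List.product [0, 1, 2] (Ik 0)) @
      map (\<lambda>\<kappa>. \<lambda>j. ?start (V (place j (\<kappa>, Abs 0)))) [Alive, St 0]"
  have lcW: "locally_computable w" if "w \<in> set (W c)" for c w
    using that unfolding W_def V_def by (auto simp del: place.simps intro: lc_violation lc_start_violation)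
  have lcTop: "locally_computable w" if "w \<in> set Wtop" for w
    using that lc_violation[where P = "[]"] unfolding Wtop_def V_def by (auto simp del: place.simps intro: lc_start_violation)
  \<comment> \<open>The summand \<open>[:1, 1:]\<close> makes the number of locations positive and
    at least the input length, in addition to covering the space bound.\<close>
  obtain u where u: "pcf True u" "\<And>x :: bool list. length (u x :: bool list) = poly (p + [:1, 1:]) (length x)"
    using pcf_unary_poly by blast
  define N where "N x = length (u x)" for x
  have N: "poly p (length x) \<le> N x + 2" "length x \<le> N x" "1 \<le> N x" for x by (auto simp: N_def u(2))
  define \<phi>s where "\<phi>s x = concat (map (\<lambda>j. map (\<lambda>w. w j) (W (tape_content x j))) [0..<N x]) @ map (\<lambda>w. w (N x)) Wtop" for x
  define \<Phi> where "\<Phi> x = network_formula op TA TN E nm (\<phi>s x)" for x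
  let ?Rs = "\<lambda>x. (\<lambda>(P, l). (map V P, V l)) ` rules T (N x)"

  have init: "init_facts T x (N x) = {(\<kappa>, i). i \<le> N x + 2 \<and> \<kappa> \<in> set (Ik (tape_content x i))} \<union> {(Alive, 0), (St 0, 0)}" for x
  proof -
    have "num_tapes T \<ge> 1" "num_syms T \<ge> 3" "num_states T \<ge> 3" using T(1) by (auto simp: is_tm_def)
    moreover from this(2) have "tape_content x i \<le> num_syms T" for i by (auto simp: tape_content_def)
    ultimately have "(\<kappa>, i) \<in> init_facts T x (N x) \<longleftrightarrow> i \<le> N x + 2 \<and> \<kappa> \<in> set (Ik (tape_content x i)) \<or>
      (\<kappa>, i) \<in> {(Alive, 0), (St 0, 0)}" for \<kappa> i
      by (cases \<kappa>) (auto simp: init_facts_def[OF T(1)] kinds_iff[OF T(1)] init_config_def Ik_def nth_Cons')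
    thus ?thesis by auto
  qed
  have \<phi>s: "set (\<phi>s x) = {?viol c P l | c P l. (P, l) \<in> ?Rs x} \<union> ?start ` (V ` init_facts T x (N x))" for x
  proof -
    have blank: "tape_content x (N x + d) = 0" for d using N(2)[of x] by (simp add: tape_content_def)
    have V1: "{?viol c P l | c P l. (P, l) \<in> ?Rs x} =
      (\<Union>c. {?viol c (map (\<lambda>p. V (place j p)) P) (V (place j l)) | P l j. (P, l) \<in> schemas T \<and> j < N x} \<union>
        {?viol c [] (V (place (N x) l)) | l. l \<in> top_facts T})" (is "?A = ?A'")
    proof (intro equalityI subsetI)
      fix \<phi> assume "\<phi> \<in> ?A"
      then obtain c P l where 1: "\<phi> = ?viol c (map V P) (V l)" "(P, l) \<in> rules T (N x)" by auto
      from 1(2) consider P' l' j where "(P', l') \<in> schemas T" "P = map (place j) P'" "l = place j l'" "j < N x" |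
        l' where "l' \<in> top_facts T" "P = []" "l = place (N x) l'" unfolding rules_def[OF T(1)] by blast
      thus "\<phi> \<in> ?A'" using 1(1) by cases (fastforce simp: o_def)+
    next
      fix \<phi> assume "\<phi> \<in> ?A'"
      then consider c P l j where "\<phi> = ?viol c (map (\<lambda>p. V (place j p)) P) (V (place j l))" "(P, l) \<in> schemas T" "j < N x" |
        c l where "\<phi> = ?viol c [] (V (place (N x) l))" "l \<in> top_facts T" by blast
      thus "\<phi> \<in> ?A"
      proof cases
        case (1 c P l j)
        have "(map (place j) P, place j l) \<in> rules T (N x)" unfolding rules_def[OF T(1)] using 1(2,3) by blast
        from imageI[OF this, of "\<lambda>(P, l). (map V P, V l)"]
        have "(map (\<lambda>p. V (place j p)) P, V (place j l)) \<in> ?Rs x" by (simp only: prod.case map_map o_def)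
        thus ?thesis using 1(1) by blast
      next
        case (2 c l)
        have "([], place (N x) l) \<in> rules T (N x)" unfolding rules_def[OF T(1)] using 2(2) by blast
        from imageI[OF this, of "\<lambda>(P, l). (map V P, V l)"]
        have "([], V (place (N x) l)) \<in> ?Rs x" by (simp only: prod.case list.map)
        thus ?thesis using 2(1) by blast
      qed
    qed
    have V2: "?start ` (V ` init_facts T x (N x)) =
      {?start (V (\<kappa>, j)) | \<kappa> j. j < N x \<and> \<kappa> \<in> set (Ik (tape_content x j))} \<union>
      {?start (V (\<kappa>, N x + d)) | \<kappa> d. d \<in> {0, 1, 2} \<and> \<kappa> \<in> set (Ik 0)} \<union> {?start (V (Alive, 0)), ?start (V (St 0, 0))}"
      (is "?A = ?A'")
    proof (intro equalityI subsetI)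
      fix \<phi> assume "\<phi> \<in> ?A"
      then obtain \<kappa> i where 1: "\<phi> = ?start (V (\<kappa>, i))" "(\<kappa>, i) \<in> init_facts T x (N x)" by auto
      from 1(2) consider "i < N x" "\<kappa> \<in> set (Ik (tape_content x i))" |
        d where "i = N x + d" "d \<in> {0, 1, 2}" "\<kappa> \<in> set (Ik (tape_content x i))" | "(\<kappa>, i) = (Alive, 0)" | "(\<kappa>, i) = (St 0, 0)"
        unfolding init
      proof -
        assume *: "i < N x \<Longrightarrow> \<kappa> \<in> set (Ik (tape_content x i)) \<Longrightarrow> thesis"
          "\<And>d. i = N x + d \<Longrightarrow> d \<in> {0, 1, 2} \<Longrightarrow> \<kappa> \<in> set (Ik (tape_content x i)) \<Longrightarrow> thesis"
          "(\<kappa>, i) = (Alive, 0) \<Longrightarrow> thesis" "(\<kappa>, i) = (St 0, 0) \<Longrightarrow> thesis"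
          "(\<kappa>, i) \<in> {(\<kappa>, i). i \<le> N x + 2 \<and> \<kappa> \<in> set (Ik (tape_content x i))} \<union> {(Alive, 0), (St 0, 0)}"
        show thesis
        proof (cases "i < N x")
          case False
          hence "i \<le> N x + 2 \<Longrightarrow> i = N x + (i - N x) \<and> i - N x \<in> {0, 1, 2}" by auto
          thus thesis using * by blast
        qed (use * in auto)
      qed
      thus "\<phi> \<in> ?A'" using 1(1) blank by cases auto
    next
      fix \<phi> assume "\<phi> \<in> ?A'"
      then consider \<kappa> j where "\<phi> = ?start (V (\<kappa>, j))" "j < N x" "\<kappa> \<in> set (Ik (tape_content x j))" |
        \<kappa> d where "\<phi> = ?start (V (\<kappa>, N x + d))" "d \<in> {0, 1, 2}" "\<kappa> \<in> set (Ik 0)" |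
        "\<phi> = ?start (V (Alive, 0))" | "\<phi> = ?start (V (St 0, 0))" by blast
      thus "\<phi> \<in> ?A"
      proof cases
        case (1 \<kappa> j)
        hence "(\<kappa>, j) \<in> init_facts T x (N x)" unfolding init by auto
        thus ?thesis using 1(1) by blast
      next
        case (2 \<kappa> d)
        hence "(\<kappa>, N x + d) \<in> init_facts T x (N x)" unfolding init using blank by auto
        thus ?thesis using 2(1) by blast
      qed (auto simp: init)
    qed
    have B: "set [False, True] = UNIV" by auto
    have I3: "(\<lambda>w. w j) ` (\<lambda>(b, P, l). \<lambda>j. f b P l j) ` (UNIV \<times> X) = {f b P l j | b P l. (P, l) \<in> X}"
      for f :: "bool \<Rightarrow> (kind \<times> loc) list \<Rightarrow> kind \<times> loc \<Rightarrow> nat \<Rightarrow> formula" and X and j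
      by (auto simp: image_iff) force
    have I2: "(\<lambda>w. w j) ` (\<lambda>(b, l). \<lambda>j. f b l j) ` (X \<times> Y) = {f b l j | b l. b \<in> X \<and> l \<in> Y}"
      for f :: "'x \<Rightarrow> 'y \<Rightarrow> nat \<Rightarrow> formula" and X Y j
      by (auto simp: image_iff)
    have WS: "(\<lambda>w. w j) ` set (W c) =
      {?viol b (map (\<lambda>p. V (place j p)) P) (V (place j l)) | b P l. (P, l) \<in> schemas T} \<union>
      {?start (V (\<kappa>, j)) | \<kappa>. \<kappa> \<in> set (Ik c)}" for j c
      unfolding W_def set_append set_map set_product Ss B image_Un I3 by (simp add: image_image) blast
    have WT: "(\<lambda>w. w n) ` set Wtop =
      {?viol b [] (V (place n l)) | b l. b \<in> UNIV \<and> l \<in> top_facts T} \<union>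
      {?start (V (\<kappa>, n + d)) | d \<kappa>. d \<in> {0, 1, 2} \<and> \<kappa> \<in> set (Ik 0)} \<union>
      {?start (V (Alive, 0)), ?start (V (St 0, 0))}" for n
      unfolding Wtop_def set_append set_map set_product Ts B image_Un I2 by simp
    have "set (\<phi>s x) = (\<Union>j<N x. (\<lambda>w. w j) ` set (W (tape_content x j))) \<union> (\<lambda>w. w (N x)) ` set Wtop"
      unfolding \<phi>s_def by auto
    moreover have "(\<Union>j<n. {f c P l j | c P l. (P, l) \<in> X}) = (\<Union>c. {f c P l j | P l j. (P, l) \<in> X \<and> j < n})"
      for f :: "bool \<Rightarrow> (kind \<times> loc) list \<Rightarrow> kind \<times> loc \<Rightarrow> nat \<Rightarrow> formula" and X and n :: nat by blast
    moreover have "{f c l | c l. c \<in> UNIV \<and> l \<in> X} = (\<Union>c. {f c l | l. l \<in> X})"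
      for f :: "bool \<Rightarrow> kind \<times> loc \<Rightarrow> formula" and X by blast
    moreover have "(\<Union>j<n. {f \<kappa> j | \<kappa>. \<kappa> \<in> X j}) = {f \<kappa> j | \<kappa> j. j < n \<and> \<kappa> \<in> X j}"
      for f :: "kind \<Rightarrow> nat \<Rightarrow> formula" and X and n :: nat by blast
    moreover have "{f d \<kappa> | d \<kappa>. d \<in> X \<and> \<kappa> \<in> Y} = {f d \<kappa> | \<kappa> d. d \<in> X \<and> \<kappa> \<in> Y}"
      for f :: "nat \<Rightarrow> kind \<Rightarrow> formula" and X Y by blast
    ultimately show ?thesis unfolding V1 V2 WS WT UN_Un_distrib by (simp only: Un_ac)
  qed
  have form: "is_formula {op} B (\<Phi> x)" for x
  proof -
    have "is_formula {op} B \<phi>" if "\<phi> \<in> set (\<phi>s x)" for \<phi>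
      using that unfolding \<phi>s
      using is_formula_violation[OF TA TN E] is_formula_start_violation[OF TA TN E] by auto
    thus ?thesis unfolding \<Phi>_def by (intro is_formula_network[OF TA TN E])
  qed
  have correct: "x \<in> L \<longleftrightarrow> encode (\<Phi> x) \<in> SAT {op} B" for x
  proof -
    have al: "alive nm = V (Alive, 0)" by (simp add: nm_def)
    have fa: "fst (place j l) = fst l" for j l by (cases "(j, l)" rule: place.cases) auto
    have rk: "fst ` insert l (set P) \<subseteq> kinds T" if "(P, l) \<in> rules T (N x)" for P l
    proof -
      have top: "fst l \<in> kinds T" if "l \<in> top_facts T" for l using top_facts_kinds[OF T(1) that] by auto
      have sch: "fst ` insert l (set P) \<subseteq> kinds T" if "(P, l) \<in> schemas T" for P l
        using that by (auto simp: schemas_def[OF T(1)])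
      from that consider P' l' j where "(P', l') \<in> schemas T" "P = map (place j) P'" "l = place j l'" |
        l' where "l' \<in> top_facts T" "P = []" "l = place (N x) l'" unfolding rules_def[OF T(1)] by blast
      thus ?thesis
      proof cases
        case 1
        have "fst ` insert l (set P) = fst ` insert l' (set P')" unfolding 1(2,3) by (simp add: image_image fa)
        thus ?thesis using sch[OF 1(1)] by simp
      next
        case 2
        thus ?thesis using top[OF 2(1)] by (simp add: fa)
      qed
    qed
    have disj: "V ` X \<inter> Y = {}" if "\<And>f. f \<in> X \<Longrightarrow> V f \<notin> Y" for X Y using that by blast
    have inj': "inj_on V (kinds T \<times> UNIV)" using inj by (rule inj_on_subset) auto
    have "encode (\<Phi> x) \<in> SAT {op} B \<longleftrightarrow> sat_seq op (\<Phi> x)"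
      using encode_in_SAT_iff[OF form] satisfiable_iff_sat_seq[OF form] by simp
    also have "\<dots> \<longleftrightarrow> (\<exists>n. alive nm \<notin> stage (V ` init_facts T x (N x)) (?Rs x) n)"
      unfolding \<Phi>_def
    proof (rule network_sat[OF TA TN E dist])
      fix P l assume "(P, l) \<in> ?Rs x"
      then obtain P' l' where P: "(P', l') \<in> rules T (N x)" "P = map V P'" "l = V l'" by auto
      have eq: "insert l (set P) = V ` insert l' (set P')" unfolding P(2,3) by simp
      have "V f \<notin> ?spec" if "f \<in> insert l' (set P')" for f
        by (rule sep) (use rk[OF P(1)] that in blast)
      thus "insert l (set P) \<inter> ?spec = {}" unfolding eq by (rule disj)
    next
      have "V f \<notin> ?spec" if "f \<in> init_facts T x (N x)" for f
        by (rule sep) (use that in \<open>auto simp: init_facts_def[OF T(1)]\<close>)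
      thus "V ` init_facts T x (N x) \<inter> ?spec = {}" by (rule disj)
      show "alive nm \<notin> ?spec" using sep[of "(Alive, 0)"] alive by (simp add: al)
    qed (assumption | rule \<phi>s)+
    also have "\<dots> \<longleftrightarrow> (\<exists>n. fst (Defs.run T x n) = 1)"
    proof -
      have "alive nm \<in> stage (V ` init_facts T x (N x)) (?Rs x) n \<longleftrightarrow> fst (Defs.run T x n) \<noteq> 1" for n
      proof -
        note sf = stage_facts[OF T(1) inj' T(3) N(1)[of x] trans_le_add1[OF N(2)[of x], of 2] N(3)[of x], of n]
        obtain q ts where C: "Defs.run T x n = (q, ts)" by (cases "Defs.run T x n")
        show ?thesis
        proof
          assume "alive nm \<in> stage (V ` init_facts T x (N x)) (?Rs x) n"
          hence "V (Alive, 0) \<in> V ` {(\<kappa>, i). \<kappa> \<in> kinds T \<and> true_fact (num_syms T) (Defs.run T x n) (\<kappa>, i)}"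
            using subsetD[OF conjunct2[OF sf]] by (simp add: al)
          then obtain f where f: "V (Alive, 0) = V f" "fst f \<in> kinds T" "true_fact (num_syms T) (Defs.run T x n) f" by auto
          hence "f = (Alive, 0)" using V_eq[of "(Alive, 0)" f] alive by auto
          thus "fst (Defs.run T x n) \<noteq> 1" using f(3) C by simp
        next
          assume "fst (Defs.run T x n) \<noteq> 1"
          hence "(Alive, 0) \<in> {(\<kappa>, i). \<kappa> \<in> kinds T \<and> i \<le> N x + 2 \<and> true_fact (num_syms T) (Defs.run T x n) (\<kappa>, i)}"
            using alive C by simp
          from subsetD[OF conjunct1[OF sf] imageI[OF this, of V]]
          show "alive nm \<in> stage (V ` init_facts T x (N x)) (?Rs x) n" by (simp add: al)
        qed
      qed
      thus ?thesis by simp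
    qed
    also have "\<dots> \<longleftrightarrow> x \<in> L" using decides_iff[OF T(1,2)] by simp
    finally show ?thesis by simp
  qed
  have comp: "pcf True (\<lambda>x. encode (\<Phi> x))"
  proof -
    have "\<forall>c. \<exists>G H. pcf True G \<and> pcf True H \<and> (\<forall>j \<psi>. encode (foldr (Refuse E nm) (map (\<lambda>w. w j) (W c)) \<psi>) =
      G (unary_code j) @ encode \<psi> @ H (unary_code j))" by (intro allI refuse_code[OF E(1)] lcW)
    then obtain G H where GH: "\<And>c. pcf True (G c)" "\<And>c. pcf True (H c)"
      "\<And>c j \<psi>. encode (foldr (Refuse E nm) (map (\<lambda>w. w j) (W c)) \<psi>) = G c (unary_code j) @ encode \<psi> @ H c (unary_code j)"
      by metis
    obtain G' H' where GH': "pcf True G'" "pcf True H'"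
      "\<And>j \<psi>. encode (foldr (Refuse E nm) (map (\<lambda>w. w j) Wtop) \<psi>) = G' (unary_code j) @ encode \<psi> @ H' (unary_code j)"
      using refuse_code[OF E(1) lcTop, of Wtop nm] by blast
    \<comment> \<open>A tape symbol as two bits: whether the location lies inside the input, and
      which input bit it holds.\<close>
    define sy where "sy b = (if fst b then if snd b then 2 else 1 else 0 :: nat)" for b :: "bool \<times> bool"
    define F where "F y M = G (sy (snd y)) (fst y) @ M @ H (sy (snd y)) (fst y)" for y :: "bool list \<times> bool \<times> bool" and M
    \<comment> \<open>The padding has \<open>N x\<close> elements, at least as many as can be
      wanted; \<open>zip\<close> cuts off the surplus.\<close>
    define items where "items x = zip (map unary_code [0..<N x]) (map (Pair True) x @ map (\<lambda>_. (False, False)) (u x))" for x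
    define base where "base x = G' (unary_code (N x)) @ encode (Var (always nm)) @ H' (unary_code (N x))" for x
    have codes: "pcf True (\<lambda>x. map unary_code [0..<N x])" "pcf True (\<lambda>x. unary_code (N x))"
      unfolding N_def by (rule pcf_unary_codes[OF u(1)])+
    have items: "pcf True items" unfolding items_def by (intro pcf_intros pcf_map codes u(1))
    have base: "pcf True base" unfolding base_def
      by (intro pcf_intros pcf_comp[OF codes(2) GH'(1)] pcf_comp[OF codes(2) GH'(2)])
    have select: "pcf tm (\<lambda>z. g (sy (a z)) (b z))" if "\<And>c. pcf tm (g c)" "pcf tm a" "pcf tm b"
      for tm and g :: "nat \<Rightarrow> bool list \<Rightarrow> bool list" and a :: "'z::coded \<Rightarrow> bool \<times> bool" and b
    proof -
      have "g (sy (a z)) (b z) = (if fst (a z) then if snd (a z) then g 2 (b z) else g 1 (b z) else g 0 (b z))" for z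
        by (simp add: sy_def)
      thus ?thesis by simp (intro pcf_intros that pcf_comp[OF that(3,1)])
    qed
    have chain: "pcf True (\<lambda>x. foldr F (items x) (base x))"
    proof -
      have "pcf True (\<lambda>y :: bool list \<times> bool \<times> bool. (G (sy (snd y)) (fst y), H (sy (snd y)) (fst y)))"
        by (rule pcf_Pair; rule select[OF GH(1)] select[OF GH(2)]; intro pcf_intros)
      then obtain q where q: "\<And>y. sz (G (sy (snd y)) (fst y), H (sy (snd y)) (fst y)) \<le> poly q (sz y)"
        using pcf_sz by blast
      show ?thesis
      proof (rule pcf_foldr[where q = q, OF items base])
        show "pcf True (\<lambda>z :: bool list \<times> (bool list \<times> bool \<times> bool) \<times> bool list. F (fst (snd z)) (snd (snd z)))"
          unfolding F_def
          by (rule pcf_append, rule select[OF GH(1)], (intro pcf_intros)+, rule select[OF GH(2)], (intro pcf_intros)+)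
        fix x :: "bool list" and y M
        let ?g = "G (sy (snd y)) (fst y)" and ?h = "H (sy (snd y)) (fst y)"
        have "Suc (sz (F y M)) = sz ?g + sz (M @ ?h)" "Suc (sz (M @ ?h)) = sz M + sz ?h"
          unfolding F_def by (rule sz_append)+
        moreover have "1 + sz ?g + sz ?h \<le> poly q (sz y)" using q[of y] by simp
        moreover have "poly q (sz y) \<le> poly q (sz x + sz y)" by (intro poly_nat_mono) simp
        ultimately show "sz (F y M) \<le> sz M + poly q (sz x + sz y)" by linarith
      qed
    qed
    have "encode (chain E nm (\<phi>s x)) = foldr F (items x) (base x)" for x
    proof -
      have b: "encode (foldr (Refuse E nm) (map (\<lambda>w. w (N x)) Wtop) (Var (always nm))) = base x"
        unfolding GH'(3) base_def ..
      have "encode (foldr (Refuse E nm) (concat (map (\<lambda>j. map (\<lambda>w. w j) (W (tape_content x j))) js)) \<psi>) =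
        foldr F (map (\<lambda>j. (unary_code j, if j < length x then (True, x ! j) else (False, False))) js) (encode \<psi>)" for js \<psi>
      proof (induction js)
        case (Cons j js)
        have "sy (if j < length x then (True, x ! j) else (False, False)) = tape_content x j"
          by (simp add: sy_def tape_content_def)
        thus ?case using Cons by (simp add: GH(3) F_def)
      qed simp
      moreover have "map (\<lambda>j. (unary_code j, if j < length x then (True, x ! j) else (False, False))) [0..<N x] = items x"
        unfolding items_def by (rule nth_equalityI) (auto simp: N_def nth_append)
      ultimately show ?thesis unfolding chain_def \<phi>s_def foldr_append using b by simp
    qed
    hence ch: "pcf True (\<lambda>x. encode (chain E nm (\<phi>s x)))" using chain by simp
    have and_pcf: "pcf True (\<lambda>x. encode (And TA (\<phi> x) (\<psi> x)))"
      if "pcf True (\<lambda>x. encode (\<phi> x))" "pcf True (\<lambda>x. encode (\<psi> x))" for \<phi> \<psi> :: "bool list \<Rightarrow> formula"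
      unfolding And_def 
    proof (rule pcf_encode_subst)
      show "pcf True (\<lambda>x. encode (if n = 0 then \<phi> x else \<psi> x))" for n :: nat
        by (cases "n = 0") (simp_all add: that)
    qed
    show ?thesis unfolding \<Phi>_def network_formula_def
      by (intro and_pcf pcf_encode_Temp ch pcf_const)
  qed
  show ?thesis unfolding poly_time_reducible_def
    using pcf_poly_time_computable[OF comp] correct by blast
qed

theorem theorem3p3:
  fixes B :: "boolfun set"
  assumes "finite B"
    and "S1 \<subseteq> clone B"
  shows "PSPACE_complete (SAT {Since} B) \<and> PSPACE_complete (SAT {Until} B)"
proof -
  obtain fs where "set fs = B" using finite_list[OF assms(1)] by blast
  thus ?thesis unfolding PSPACE_complete_def
    using SAT_PSPACE[of _ fs] SAT_hard[OF assms(2)] by blast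
qed

end
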